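(* Let $m_1,m_2,n_1,n_2,l,k$ be positive integers, $s\ge 2$ and $q\ge0$ integers, $v=\min\{m_1n_1,m_2n_2\}$, and $k+s\le v$. Let $L$ be the invertible linear transform $L(\mathcal{A})=\mathcal{A}\times_3\mathbf{L}$ associated with an invertible matrix $\mathbf{L}\in\mathbb{C}^{l\times l}$ (with $L$ mapping real tensors to real tensors), and suppose that for some constant $\rho>0$ one has $\mathbf{L}^{\mathrm H}\mathbf{L}=\mathbf{L}\mathbf{L}^{\mathrm H}=\rho\,\mathbf{I}_l$ and $\mathbf{L}^{-1}=\mathbf{L}^{\mathrm H}/\rho$. Let $\mathcal{A}\in\mathbb{R}^{m_1m_2\times n_1n_2\times l}$ and let $\mathcal{G}\in\mathbb{R}^{m_2n_2\times(k+s)\times l}$ be a Gaussian random tensor. Let $\hat\sigma_1^{(j)}\ge\dots\ge\hat\sigma_v^{(j)}\ge0$ be the singular values of $\mathscr{R}(\bar{\mathcal{A}}^{(j)})$, where $\bar{\mathcal{A}}=L(\mathcal{A})$, and suppose that for each $j=1,\dots,l$ one has $\hat\sigma_k^{(j)}>0$ and the singular value gap $\tau_k^{(j)}=\hat\sigma_{k+1}^{(j)}/\hat\sigma_k^{(j)}$ satisfies $\tau_k^{(j)}<1$. If $\widetilde{\mathcal{A}}=\sum_{i=1}^{k}\mathcal{U}_i\ltimes_L\mathcal{S}_i\ltimes_L\mathcal{V}_i^\top$, where $\mathcal{U}_i,\mathcal{S}_i,\mathcal{V}_i$ are the output of the MRSTP-SVD algorithm (described in the context) with number of terms $k$, oversampling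 parameter $s$, $q$ power iterations and random tensor $\mathcal{G}$, then $$\mathbb{E}\,\|\mathcal{A}-\widetilde{\mathcal{A}}\|_F^2\le\frac{2}{\rho}\sum_{j=1}^{l}\left[\left(2+\frac{k}{s-1}\bigl(\tau_k^{(j)}\bigr)^{4q}\right)\left(\sum_{i=k+1}^{v}\bigl(\hat\sigma_i^{(j)}\bigr)^2\right)\right].$$
   Context: Tensors. For a third-order tensor $\mathcal{A}$ with third dimension $l$, $\mathcal{A}^{(j)}$ denotes its $j$-th frontal slice (the matrix with entries $\mathcal{A}_{abj}$), and $\|\mathcal{A}\|_F=(\sum_{a,b,j}|\mathcal{A}_{abj}|^2)^{1/2}$. Transform. Given an invertible matrix $\mathbf{L}\in\mathbb{C}^{l\times l}$, the linear transform $L:\mathbb{R}^{p\times r\times l}\to\mathbb{R}^{p\times r\times l}$ (for all $p,r$) is the mode-3 product $\bar{\mathcal{A}}=L(\mathcal{A})=\mathcal{A}\times_3\mathbf{L}$, i.e. $\bar{\mathcal{A}}_{abj}=\sum_{j'}\mathbf{L}_{jj'}\mathcal{A}_{abj'}$; its inverse is $L^{-1}(\bar{\mathcal{A}})=\bar{\mathcal{A}}\times_3\mathbf{L}^{-1}$. t-product. $\mathrm{bdiag}(\bar{\mathcal{A}})$ is the block-diagonal matrix with diagonal blocks $\bar{\mathcal{A}}^{(1)},\dots,\bar{\mathcal{A}}^{(l)}$, and $\mathrm{fold}$ is the inverse operation. For tensors of sizes $p\times r\times l$ and $r\times w\times l$, $\mathcal{A}*_L\mathcal{B}=L^{-1}[\mathrm{fold}(\mathrm{bdiag}(\bar{\mathcal{A}})\,\mathrm{bdiag}(\bar{\mathcal{B}}))]$.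 The transpose $\mathcal{A}^\top$ under $L$ is the tensor with $L(\mathcal{A}^\top)^{(j)}=(L(\mathcal{A})^{(j)})^\top$ for all $j$. Semi-tensor product of tensors. For $\mathcal{A}\in\mathbb{R}^{p\times r\times l}$, $\mathcal{B}\in\mathbb{R}^{u\times w\times l}$ and $t=\mathrm{lcm}(r,u)$, $$\mathcal{A}\ltimes_L\mathcal{B}=(\mathcal{A}\otimes\mathcal{I}_{t/r})*_L(\mathcal{B}\otimes\mathcal{I}_{t/u})\in\mathbb{R}^{p(t/r)\times w(t/u)\times l},$$ where $\mathcal{I}_c\in\mathbb{R}^{c\times c\times1}$ is the tensor whose only frontal slice is $\mathbf{I}_c$ and $\mathcal{A}\otimes\mathcal{I}_c$ is the tensor with frontal slices $\mathcal{A}^{(j)}\otimes\mathbf{I}_c$ (matrix Kronecker product). Rearrangement operator. For $\mathbf{A}\in\mathbb{R}^{m_1m_2\times n_1n_2}$ partitioned into blocks $\mathbf{A}_{a,b}\in\mathbb{R}^{m_2\times n_2}$ ($1\le a\le m_1$, $1\le b\le n_1$), put $\mathbf{A}_b=[\mathrm{vec}(\mathbf{A}_{1,b}),\dots,\mathrm{vec}(\mathbf{A}_{m_1,b})]^\top\in\mathbb{R}^{m_1\times m_2n_2}$ ($\mathrm{vec}$ stacks columns); $\mathscr{R}(\mathbf{A})\in\mathbb{R}^{m_1n_1\times m_2n_2}$ is the matrix obtained by stacking $\mathbf{A}_1,\dots,\mathbf{A}_{n_1}$ vertically. Gaussian random tensor. $\mathcal{G}$ is a Gaussian random tensor if each frontal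 slice $\bar{\mathcal{G}}^{(j)}$ of $\bar{\mathcal{G}}=L(\mathcal{G})$ has independent standard normal entries. MRSTP-SVD algorithm. Input: $\mathcal{A}\in\mathbb{R}^{m_1m_2\times n_1n_2\times l}$, number of terms $k$, oversampling parameter $s$, power iteration parameter $q$. Generate a Gaussian random tensor $\mathcal{G}\in\mathbb{R}^{m_2n_2\times(k+s)\times l}$ and compute $\bar{\mathcal{A}}=L(\mathcal{A})$, $\bar{\mathcal{G}}=L(\mathcal{G})$. For each $j=1,\dots,l$: 1. form $\mathbf{M}=\mathscr{R}(\bar{\mathcal{A}}^{(j)})$ and $\mathbf{Y}=(\mathbf{M}\mathbf{M}^\top)^q\,\mathbf{M}\,\bar{\mathcal{G}}^{(j)}$; 2. compute a thin QR factorization $\mathbf{Y}=\mathbf{Q}_j\mathbf{R}$ ($\mathbf{Q}_j$ is $m_1n_1\times(k+s)$ with orthonormal columns); 3. compute $\mathbf{B}=\mathbf{Q}_j^\top\mathbf{M}$ and its SVD $\mathbf{B}=\mathbf{U}\mathbf{S}\mathbf{V}^\top$ (singular values in decreasing order); 4. let $\mathbf{U}_k,\mathbf{V}_k,\mathbf{S}_k$ be the truncations of $\mathbf{Q}_j\mathbf{U},\mathbf{V},\mathbf{S}$ to the leading $k$ singular components; 5. for $i=1,\dots,k$, define $\mathbf{B}_i^{(j)}\in\mathbb{R}^{m_1\times n_1}$ and $\mathbf{C}_i^{(j)}\in\mathbb{R}^{m_2\times n_2}$ by $\mathrm{vec}(\mathbf{B}_i^{(j)})=\sqrt{\mathbf{S}_k(i,i)}\,\mathbf{U}_k(:,i)$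 and $\mathrm{vec}(\mathbf{C}_i^{(j)})=\sqrt{\mathbf{S}_k(i,i)}\,\mathbf{V}_k(:,i)$; compute a full SVD $\mathbf{B}_i^{(j)}=\mathbf{U}_i^{(j)}\mathbf{\Sigma}_{\mathbf{B}_i}^{(j)}(\mathbf{V}_i^{(j)})^\top$ and set $\mathbf{\Sigma}_i^{(j)}=\mathbf{\Sigma}_{\mathbf{B}_i}^{(j)}\otimes\mathbf{C}_i^{(j)}$. Output: for $i=1,\dots,k$, the tensors $\mathcal{U}_i,\mathcal{S}_i,\mathcal{V}_i$ obtained by applying $L^{-1}$ to the tensors whose $j$-th frontal slices are $\mathbf{U}_i^{(j)},\mathbf{\Sigma}_i^{(j)},\mathbf{V}_i^{(j)}$ respectively. *)

theory Defs
  imports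
    "HOL-Probability.Probability"
    "Jordan_Normal_Form.Schur_Decomposition"
    "Jordan_Normal_Form.Gauss_Jordan_Elimination"
    "Jordan_Normal_Form.Char_Poly"
begin

no_notation Finite_Cartesian_Product.vec_nth (infixl \<open>$\<close> 90)
no_notation Inner_Product.real_inner_class.inner (infix \<open>\<bullet>\<close> 70)

definition kronecker :: "'a :: times mat \<Rightarrow> 'a mat \<Rightarrow> 'a mat" (infixl \<open>\<otimes>\<^sub>K\<close> 70) where
  "A \<otimes>\<^sub>K B = mat (dim_row A * dim_row B) (dim_col A * dim_col B)
     (\<lambda>(i, j). A $$ (i div dim_row B, j div dim_col B) * B $$ (i mod dim_row B, j mod dim_col B))"

text \<open>The operator \<open>vec\<close> of the paper: the columns are stacked.\<close>

definition stack_cols :: "'a mat \<Rightarrow> 'a Matrix.vec" where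
  "stack_cols A = Matrix.vec (dim_row A * dim_col A) (\<lambda>c. A $$ (c mod dim_row A, c div dim_row A))"

definition block :: "nat \<Rightarrow> nat \<Rightarrow> 'a mat \<Rightarrow> nat \<Rightarrow> nat \<Rightarrow> 'a mat" where
  "block m\<^sub>2 n\<^sub>2 A a b = mat m\<^sub>2 n\<^sub>2 (\<lambda>(x, y). A $$ (a * m\<^sub>2 + x, b * n\<^sub>2 + y))"

definition rearrange :: "nat \<Rightarrow> nat \<Rightarrow> nat \<Rightarrow> nat \<Rightarrow> 'a mat \<Rightarrow> 'a mat" where
  "rearrange m\<^sub>1 m\<^sub>2 n\<^sub>1 n\<^sub>2 A = mat_of_rows (m\<^sub>2 * n\<^sub>2)
     (concat (map (\<lambda>b. map (\<lambda>a. stack_cols (block m\<^sub>2 n\<^sub>2 A a b)) [0..<m\<^sub>1]) [0..<n\<^sub>1]))"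

text \<open>
  The singular values are the square roots of the \<open>min (dim_row A) (dim_col A)\<close> largest eigenvalues
  of \<open>A\<^sup>T A\<close>, counted with multiplicity and listed in decreasing order. The index \<open>i\<close> starts at 1,
  and only \<open>1 \<le> i \<le> min (dim_row A) (dim_col A)\<close> is meaningful.
\<close>

definition singular_value :: "real mat \<Rightarrow> nat \<Rightarrow> real" where
  "singular_value A i =
     sqrt (rev (sorted_list_of_multiset (proots (char_poly (transpose_mat A * A)))) ! (i - 1))"

definition is_full_svd :: "real mat \<Rightarrow> real mat \<Rightarrow> real mat \<Rightarrow> real mat \<Rightarrow> bool" where
  "is_full_svd A U S V \<longleftrightarrow>
     U \<in> carrier_mat (dim_row A) (dim_row A) \<and> transpose_mat U * U = 1\<^sub>m (dim_row A) \<and>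
     V \<in> carrier_mat (dim_col A) (dim_col A) \<and> transpose_mat V * V = 1\<^sub>m (dim_col A) \<and>
     S \<in> carrier_mat (dim_row A) (dim_col A) \<and> diagonal_mat S \<and>
     (\<forall>i < min (dim_row A) (dim_col A). 0 \<le> S $$ (i, i)) \<and>
     (\<forall>i j. i \<le> j \<and> j < min (dim_row A) (dim_col A) \<longrightarrow> S $$ (j, j) \<le> S $$ (i, i)) \<and>
     A = U * S * transpose_mat V"

definition is_thin_qr :: "real mat \<Rightarrow> real mat \<Rightarrow> real mat \<Rightarrow> bool" where
  "is_thin_qr Y Q R \<longleftrightarrow>
     Q \<in> carrier_mat (dim_row Y) (dim_col Y) \<and> transpose_mat Q * Q = 1\<^sub>m (dim_col Y) \<and>
     R \<in> carrier_mat (dim_col Y) (dim_col Y) \<and> upper_triangular R \<and>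
     Y = Q * R"

text \<open>
  A tensor is the list of its frontal slices, so the entry with indices \<open>a, b, j\<close> (all starting
  at 0) is \<open>(\<A> ! j) $$ (a, b)\<close>.
\<close>

type_synonym 'a tensor = "'a mat list"

definition tensors :: "nat \<Rightarrow> nat \<Rightarrow> nat \<Rightarrow> 'a tensor set" where
  "tensors p r l = {\<A>. length \<A> = l \<and> set \<A> \<subseteq> carrier_mat p r}"

abbreviation t_rows :: "'a tensor \<Rightarrow> nat" where "t_rows \<A> \<equiv> dim_row (hd \<A>)"
abbreviation t_cols :: "'a tensor \<Rightarrow> nat" where "t_cols \<A> \<equiv> dim_col (hd \<A>)"

definition t_minus :: "'a :: minus tensor \<Rightarrow> 'a tensor \<Rightarrow> 'a tensor" where
  "t_minus \<A> \<B> = map2 (-) \<A> \<B>"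

definition t_sum :: "nat \<Rightarrow> nat \<Rightarrow> nat \<Rightarrow> ('i \<Rightarrow> 'a :: comm_monoid_add tensor) \<Rightarrow> 'i set \<Rightarrow> 'a tensor" where
  "t_sum p r l \<T> I = map (\<lambda>j. mat p r (\<lambda>(a, b). \<Sum>i\<in>I. (\<T> i ! j) $$ (a, b))) [0..<l]"

definition frobenius_norm :: "real tensor \<Rightarrow> real" where
  "frobenius_norm \<A> =
     sqrt (\<Sum>j<length \<A>. \<Sum>a<t_rows \<A>. \<Sum>b<t_cols \<A>. \<bar>(\<A> ! j) $$ (a, b)\<bar>\<^sup>2)"

definition mode3_product :: "complex tensor \<Rightarrow> complex mat \<Rightarrow> complex tensor" (infixl \<open>\<times>\<^sub>3\<close> 70) where
  "\<A> \<times>\<^sub>3 L = map (\<lambda>j. mat (t_rows \<A>) (t_cols \<A>)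
     (\<lambda>(a, b). \<Sum>j'<length \<A>. L $$ (j, j') * (\<A> ! j') $$ (a, b))) [0..<dim_row L]"

definition t_complex :: "real tensor \<Rightarrow> complex tensor" where
  "t_complex = map (map_mat complex_of_real)"

definition maps_real_to_real :: "complex mat \<Rightarrow> bool" where
  "maps_real_to_real L \<longleftrightarrow>
     (\<forall>p r. \<forall>\<A> \<in> tensors p r (dim_col L). \<exists>\<B> \<in> tensors p r (dim_row L). t_complex \<A> \<times>\<^sub>3 L = t_complex \<B>)"

text \<open>
  The transform as an operation on real tensors. Taking real parts only changes the type: for \<open>L\<close>
  with \<open>maps_real_to_real L\<close> the imaginary parts of \<open>t_complex \<A> \<times>\<^sub>3 L\<close> are zero.
\<close>

definition transform :: "complex mat \<Rightarrow> real tensor \<Rightarrow> real tensor" where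
  "transform L \<A> = map (map_mat Re) (t_complex \<A> \<times>\<^sub>3 L)"

definition inv_transform :: "complex mat \<Rightarrow> real tensor \<Rightarrow> real tensor" where
  "inv_transform L = transform (the (mat_inverse L))"

text \<open>Reads off the \<open>l\<close> diagonal blocks of equal size.\<close>

definition t_fold :: "nat \<Rightarrow> 'a mat \<Rightarrow> 'a tensor" where
  "t_fold l X = (let p = dim_row X div l; r = dim_col X div l in map (\<lambda>j. block p r X j j) [0..<l])"

definition t_product :: "complex mat \<Rightarrow> real tensor \<Rightarrow> real tensor \<Rightarrow> real tensor" where
  "t_product L \<A> \<B> = inv_transform L (t_fold (dim_row L)
     (diag_block_mat (transform L \<A>) * diag_block_mat (transform L \<B>)))"

definition t_transpose :: "complex mat \<Rightarrow> real tensor \<Rightarrow> real tensor" where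
  "t_transpose L \<A> = inv_transform L (map transpose_mat (transform L \<A>))"

definition semi_tensor_product :: "complex mat \<Rightarrow> real tensor \<Rightarrow> real tensor \<Rightarrow> real tensor" where
  "semi_tensor_product L \<A> \<B> = (let r = t_cols \<A>; u = t_rows \<B>; t = lcm r u in
     t_product L (map (\<lambda>M. M \<otimes>\<^sub>K 1\<^sub>m (t div r)) \<A>) (map (\<lambda>M. M \<otimes>\<^sub>K 1\<^sub>m (t div u)) \<B>))"

text \<open>Independence is only required within each slice of the transformed tensor.\<close>

definition gaussian_random_tensor ::
  "'w measure \<Rightarrow> complex mat \<Rightarrow> nat \<Rightarrow> nat \<Rightarrow> ('w \<Rightarrow> real tensor) \<Rightarrow> bool" where
  "gaussian_random_tensor P L p r \<G> \<longleftrightarrow>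
     (\<forall>\<omega> \<in> space P. \<G> \<omega> \<in> tensors p r (dim_row L)) \<and>
     (\<forall>j < dim_row L.
        prob_space.indep_vars P (\<lambda>_. borel) (\<lambda>(a, b) \<omega>. (transform L (\<G> \<omega>) ! j) $$ (a, b))
          ({..<p} \<times> {..<r}) \<and>
        (\<forall>a < p. \<forall>b < r.
           distributed P lborel (\<lambda>\<omega>. (transform L (\<G> \<omega>) ! j) $$ (a, b)) std_normal_density))"

text \<open>
  QR factorizations and singular value decompositions are not unique, so the algorithm is a relation
  between its input and its admissible outputs.

  \<open>mrstp_svd_slice\<close> is one pass of the loop, for a slice \<open>A\<close> of the transformed input and a
  slice \<open>G\<close> of the transformed random tensor; \<open>Us i\<close>, \<open>Ss i\<close>, \<open>Vs i\<close> are the matrices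
  it produces for \<open>i < k\<close>. The number of columns of \<open>Y\<close> and \<open>Q\<close> is that of \<open>G\<close>, namely \<open>k + s\<close>.
  The decomposition of \<open>B\<close> is a full one; as only its leading \<open>k\<close> components are used, a thin
  one would give the same outputs.
\<close>

definition mrstp_svd_slice :: "nat \<Rightarrow> nat \<Rightarrow> nat \<Rightarrow> nat \<Rightarrow> nat \<Rightarrow> nat \<Rightarrow> real mat \<Rightarrow> real mat \<Rightarrow>
    (nat \<Rightarrow> real mat) \<Rightarrow> (nat \<Rightarrow> real mat) \<Rightarrow> (nat \<Rightarrow> real mat) \<Rightarrow> bool" where
  "mrstp_svd_slice m\<^sub>1 m\<^sub>2 n\<^sub>1 n\<^sub>2 k q A G Us Ss Vs \<longleftrightarrow>
     (\<exists>M Y Q R B U S V.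
        M = rearrange m\<^sub>1 m\<^sub>2 n\<^sub>1 n\<^sub>2 A \<and>
        Y = (M * transpose_mat M) ^\<^sub>m q * M * G \<and>
        is_thin_qr Y Q R \<and>
        B = transpose_mat Q * M \<and>
        is_full_svd B U S V \<and>
        (\<forall>i<k. \<exists>B\<^sub>i \<in> carrier_mat m\<^sub>1 n\<^sub>1. \<exists>C\<^sub>i \<in> carrier_mat m\<^sub>2 n\<^sub>2. \<exists>\<Sigma>.
           stack_cols B\<^sub>i = sqrt (S $$ (i, i)) \<cdot>\<^sub>v col (Q * U) i \<and>
           stack_cols C\<^sub>i = sqrt (S $$ (i, i)) \<cdot>\<^sub>v col V i \<and>
           is_full_svd B\<^sub>i (Us i) \<Sigma> (Vs i) \<and>
           Ss i = \<Sigma> \<otimes>\<^sub>K C\<^sub>i))"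

definition mrstp_svd :: "complex mat \<Rightarrow> nat \<Rightarrow> nat \<Rightarrow> nat \<Rightarrow> nat \<Rightarrow> nat \<Rightarrow> nat \<Rightarrow> nat \<Rightarrow> real tensor \<Rightarrow> real tensor \<Rightarrow>
    (nat \<Rightarrow> real tensor) \<Rightarrow> (nat \<Rightarrow> real tensor) \<Rightarrow> (nat \<Rightarrow> real tensor) \<Rightarrow> bool" where
  "mrstp_svd L m\<^sub>1 m\<^sub>2 n\<^sub>1 n\<^sub>2 k s q \<A> \<G> \<U> \<S> \<V> \<longleftrightarrow>
     \<A> \<in> tensors (m\<^sub>1 * m\<^sub>2) (n\<^sub>1 * n\<^sub>2) (dim_row L) \<and> \<G> \<in> tensors (m\<^sub>2 * n\<^sub>2) (k + s) (dim_row L) \<and>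
     (\<exists>Us Ss Vs :: nat \<Rightarrow> nat \<Rightarrow> real mat.
        (\<forall>j < dim_row L. mrstp_svd_slice m\<^sub>1 m\<^sub>2 n\<^sub>1 n\<^sub>2 k q (transform L \<A> ! j) (transform L \<G> ! j)
           (\<lambda>i. Us i j) (\<lambda>i. Ss i j) (\<lambda>i. Vs i j)) \<and>
        (\<forall>i<k. \<U> i = inv_transform L (map (Us i) [0..<dim_row L]) \<and>
               \<S> i = inv_transform L (map (Ss i) [0..<dim_row L]) \<and>
               \<V> i = inv_transform L (map (Vs i) [0..<dim_row L])))"

definition mrstp_approx :: "complex mat \<Rightarrow> nat \<Rightarrow> nat \<Rightarrow> nat \<Rightarrow>
    (nat \<Rightarrow> real tensor) \<Rightarrow> (nat \<Rightarrow> real tensor) \<Rightarrow> (nat \<Rightarrow> real tensor) \<Rightarrow> real tensor" where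
  "mrstp_approx L m n k \<U> \<S> \<V> = t_sum m n (dim_row L)
     (\<lambda>i. semi_tensor_product L (semi_tensor_product L (\<U> i) (\<S> i)) (t_transpose L (\<V> i))) {..<k}"

end

theory Submission
  imports Defs
begin

text \<open>
  The transform is \<open>\<surd>\<rho>\<close> times an isometry, so the squared error is \<open>1 / \<rho>\<close> times the sum over the slices
  \<open>j\<close> of \<open>\<parallel>M - Q B\<^sub>k\<parallel>\<^sup>2\<close>, where \<open>M\<close> is the rearranged slice, \<open>Q\<close> the orthonormal factor of the sketch and
  \<open>B\<^sub>k\<close> the rank \<open>k\<close> truncation of \<open>B = Q\<^sup>T M\<close>: the rearrangement is isometric and turns \<open>B\<^sub>i \<otimes> C\<^sub>i\<close> into
  \<open>vec B\<^sub>i (vec C\<^sub>i)\<^sup>T\<close>. By Pythagoras this is \<open>\<parallel>M - Q B\<parallel>\<^sup>2 + \<parallel>B - B\<^sub>k\<parallel>\<^sup>2\<close>, and Ky Fan's inequality bounds the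
  second term by the tail \<open>\<Sum>\<^bsub>i > k\<^esub> \<sigma>\<^sub>i\<^sup>2\<close>.

  For the first term, let \<open>V\<close> be an orthogonal matrix of right singular vectors and let \<open>\<Omega>\<^sub>1\<close>, \<open>\<Omega>\<^sub>2\<close> be the
  first \<open>k\<close> and the remaining rows of \<open>V\<^sup>T G\<close>. As the range of \<open>Q\<close> contains that of
  \<open>M V \<Lambda>\<^sup>q V\<^sup>T G\<close> with \<open>\<Lambda> = diag (\<sigma>\<^sub>i\<^sup>2)\<close>, every right inverse \<open>X\<close> of \<open>\<Omega>\<^sub>1\<close> gives
  \<open>\<parallel>M - Q B\<parallel>\<^sup>2 \<le> \<Sum>\<^bsub>i > k\<^esub> \<sigma>\<^sub>i\<^sup>2 + \<tau>\<^bsup>4q\<^esup> \<parallel>\<Sigma>\<^sub>2 \<Omega>\<^sub>2 X\<parallel>\<^sup>2\<close> with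
  \<open>\<Sigma>\<^sub>2 = diag (\<sigma>\<^sub>i)\<^bsub>i > k\<^esub>\<close>. By rotation invariance \<open>V\<^sup>T G\<close> is again a Gaussian
  matrix, so with \<open>X\<close> the pseudoinverse of \<open>\<Omega>\<^sub>1\<close> the last norm has expectation
  \<open>(\<Sum>\<^bsub>i > k\<^esub> \<sigma>\<^sub>i\<^sup>2) \<cdot> E \<parallel>X\<parallel>\<^sup>2\<close>. The squared length of the \<open>i\<close>-th column of \<open>X\<close> is the inverse of the squared
  distance of the \<open>i\<close>-th row of \<open>\<Omega>\<^sub>1\<close> from the span of the others, an inverse chi-squared variable with
  \<open>s + 1\<close> degrees of freedom and mean \<open>1 / (s - 1)\<close>.
\<close>

section \<open>Real symmetric matrices\<close>

text \<open>The algorithm is a relation, so its outputs are arbitrary functions of the sample point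
  and the error need not be measurable. The proof therefore never integrates the error itself: it
  bounds it almost surely by a measurable function \<open>g\<close> of the Gaussian entries, valid
  for every admissible QR and singular value decomposition, and integrates \<open>g\<close>. This
  separates the work. The deterministic bound accepts any right inverse, and chance enters only when
  the pseudoinverse is chosen, by an explicit formula that is visibly measurable and fails to be a
  right inverse only on a null set.

  The rotation \<open>V\<close> depends on the data alone, so it is fixed before anything random
  happens. The slices meet only in a sum of expectations, hence their joint law never matters. The
  exponent \<open>4 * q\<close> arises because \<open>q\<close> rounds of the iteration scale the
  \<open>i\<close>-th singular direction by \<sigma>_i to the power \<open>2 * q\<close>, and
  lengths are squared.\<close>

abbreviation diagonal :: "nat \<Rightarrow> (nat \<Rightarrow> real) \<Rightarrow> real mat" where
  "diagonal n f \<equiv> Matrix.mat n n (\<lambda>(i, j). if i = j then f i else 0)"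

lemma orthogonal_mat_with_first_column:
  \<comment> \<open>Needed for deflation in the spectral theorem below. A reflection along the
    difference of the first unit vector and \<open>v\<close> works unless the two coincide, in which
    case the identity does.\<close>
  fixes v :: "real Matrix.vec"
  assumes v: "v \<in> carrier_vec n" and n: "0 < n" and unit: "v \<bullet> v = 1"
  shows "\<exists>H \<in> carrier_mat n n. H\<^sup>T * H = 1\<^sub>m n \<and> col H 0 = v"
proof (cases "v $ 0 = 1")
  case True
  have "(\<Sum>i<n. (v $ i)\<^sup>2) = 1"
    using unit v by (simp add: scalar_prod_def power2_eq_square lessThan_atLeast0)
  moreover have "(\<Sum>i<n. (v $ i)\<^sup>2) = (v $ 0)\<^sup>2 + (\<Sum>i\<in>{..<n}-{0}. (v $ i)\<^sup>2)"
    using n by (subst sum.remove[of _ 0]) auto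
  ultimately have "(\<Sum>i\<in>{..<n}-{0}. (v $ i)\<^sup>2) = 0"
    using True by simp
  then have "\<forall>i\<in>{..<n}-{0}. (v $ i)\<^sup>2 = 0"
    by (subst (asm) sum_nonneg_eq_0_iff) auto
  then have "col (1\<^sub>m n) 0 = v"
    using v n True by (intro eq_vecI) auto
  then show ?thesis
    by (intro bexI[of _ "1\<^sub>m n"]) auto
next
  case False
  \<comment> \<open>The Householder reflection that exchanges \<open>v\<close> and the first unit vector.\<close>
  define u where "u i = (if i = 0 then 1 else 0) - v $ i" for i
  \<comment> \<open>This is 2 / |u|^2, as |u|^2 = 2 (1 - v_0) for a unit vector
    \<open>v\<close>.\<close>
  define c where "c = 1 / (1 - v $ 0)"
  define H where "H = Matrix.mat n n (\<lambda>(i, j). (if i = j then 1 else 0) - c * u i * u j)"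
  have H: "H \<in> carrier_mat n n" by (simp add: H_def)
  have vv: "(\<Sum>i<n. v $ i * v $ i) = 1"
    using unit v by (simp add: scalar_prod_def lessThan_atLeast0)
  have "(\<Sum>i<n. u i * u i) = (\<Sum>i<n. (if i = 0 then 1 - 2 * v $ 0 else 0) + v $ i * v $ i)"
    by (intro sum.cong) (auto simp: u_def algebra_simps)
  also have "\<dots> = 2 * (1 - v $ 0)"
    using n vv by (simp add: sum.distrib)
  finally have cu: "c * (\<Sum>i<n. u i * u i) = 2"
    using False by (simp add: c_def field_simps)
  have "H\<^sup>T * H = 1\<^sub>m n"
  proof (rule eq_matI)
    fix i j assume "i < dim_row (1\<^sub>m n)" "j < dim_col (1\<^sub>m n)"
    then have ij: "i < n" "j < n" by auto
    have "(H\<^sup>T * H) $$ (i, j) = (\<Sum>k<n. H $$ (k, i) * H $$ (k, j))"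
      using ij H by (simp add: scalar_prod_def lessThan_atLeast0)
    also have "\<dots> = (\<Sum>k<n. (if k = i then (if i = j then 1 else 0) - c * u i * u j else 0)
        - (if k = j then c * u i * u j else 0) + c * c * u i * u j * (u k * u k))"
      using ij by (intro sum.cong) (auto simp: H_def algebra_simps)
    also have "\<dots> = (if i = j then 1 else 0) - 2 * c * u i * u j + c * u i * u j * (c * (\<Sum>k<n. u k * u k))"
      using ij by (simp add: sum.distrib sum_subtractf sum_distrib_left mult_ac)
    also have "\<dots> = (if i = j then 1 else 0)"
      by (simp add: cu)
    finally show "(H\<^sup>T * H) $$ (i, j) = 1\<^sub>m n $$ (i, j)" using ij by simp
  qed (use H in auto)
  moreover have "col H 0 = v"
  proof (rule eq_vecI)
    fix i assume "i < dim_vec v"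
    then have i: "i < n" using v by auto
    have "c * u 0 = 1" using False by (simp add: c_def u_def)
    then have "c * u i * u 0 = u i" by (metis mult.assoc mult.commute mult.right_neutral)
    moreover have "col H 0 $ i = (if i = 0 then 1 else 0) - c * u i * u 0"
      using i n by (simp add: H_def)
    ultimately have "col H 0 $ i = (if i = 0 then 1 else 0) - u i" by (simp only:)
    then show "col H 0 $ i = v $ i"
      by (simp add: u_def)
  qed (use v H in auto)
  ultimately show ?thesis using H by blast
qed

text \<open>Deflation: conjugating by an orthogonal matrix whose first column is an eigenvector
  clears the first column, and symmetry then clears the first row. The remaining block is symmetric
  and its characteristic polynomial has lost the factor of \<open>e\<close>. Since the list
  \<open>es\<close> drives the induction, the eigenvalues appear on the diagonal in any prescribed
  order, in particular in the decreasing one.\<close>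

lemma symmetric_mat_diagonalizable:
  fixes A :: "real mat"
  assumes "A \<in> carrier_mat n n" and "A\<^sup>T = A"
    and "char_poly A = (\<Prod>e\<leftarrow>es. [:- e, 1:])"
  shows "\<exists>V \<in> carrier_mat n n. V\<^sup>T * V = 1\<^sub>m n \<and>
    V\<^sup>T * (A * V) = diagonal n (\<lambda>i. es ! i)"
  using assms
proof (induction es arbitrary: n A)
  case Nil
  then have "n = 0" using degree_monic_char_poly[of A n] by simp
  then show ?case by (intro bexI[of _ "1\<^sub>m n"]) (auto intro!: eq_matI)
next
  case (Cons e es)
  have A: "A \<in> carrier_mat n n" by fact
  have "poly (char_poly A) e = 0" using Cons.prems(3) by simp
  then have "eigenvalue A e" using eigenvalue_root_char_poly[OF A] by simp
  then obtain w where w: "w \<in> carrier_vec n" "w \<noteq> 0\<^sub>v n" "A *\<^sub>v w = e \<cdot>\<^sub>v w"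
    using A unfolding eigenvalue_def eigenvector_def by auto
  have n: "0 < n" using w by (cases n) auto
  define v where "v = (1 / sqrt (w \<bullet> w)) \<cdot>\<^sub>v w"
  have "0 < w \<bullet> w"
    using conjugate_square_greater_0_vec[OF w(1)] w(2) by (simp add: conjugate_vec_def)
  moreover have v: "v \<in> carrier_vec n" using w by (simp add: v_def)
  ultimately have vv: "v \<bullet> v = 1"
    using w(1) by (simp add: v_def)
  have Av: "A *\<^sub>v v = e \<cdot>\<^sub>v v"
    using w A by (simp add: v_def mult_mat_vec smult_smult_assoc mult.commute)
  obtain H where H: "H \<in> carrier_mat n n" "H\<^sup>T * H = 1\<^sub>m n" "col H 0 = v"
    using orthogonal_mat_with_first_column[OF v n vv] by auto
  have HH: "H * H\<^sup>T = 1\<^sub>m n"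
    using mat_mult_left_right_inverse[of "H\<^sup>T" n H] H by auto
  define A' where "A' = H\<^sup>T * (A * H)"
  have A': "A' \<in> carrier_mat n n" using H A by (simp add: A'_def)
  have symA': "A'\<^sup>T = A'"
    using H A Cons.prems(2) unfolding A'_def
    by (simp add: transpose_mult[of _ n n _ n] assoc_mult_mat[of _ n n _ n _ n])
  have "similar_mat_wit A A' H (H\<^sup>T)"
  proof (rule similar_mat_witI)
    have "H * A' * H\<^sup>T = (H * H\<^sup>T) * A * (H * H\<^sup>T)"
      unfolding A'_def using H A by (simp add: assoc_mult_mat[of _ n n _ n _ n])
    then show "A = H * A' * H\<^sup>T" using A by (simp add: HH)
  qed (use H HH A A' in auto)
  then have sim: "char_poly A = char_poly A'"
    by (intro char_poly_similar) (auto simp: similar_mat_def)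
  have col0: "col A' 0 = e \<cdot>\<^sub>v unit_vec n 0"
  proof -
    have "col A' 0 = H\<^sup>T *\<^sub>v col (A * H) 0"
      unfolding A'_def using H A n by (intro col_mult2[of _ n n _ n]) auto
    also have "col (A * H) 0 = A *\<^sub>v v"
      unfolding H(3)[symmetric] using H A n by (intro col_mult2[of _ n n _ n]) auto
    also have "H\<^sup>T *\<^sub>v (A *\<^sub>v v) = e \<cdot>\<^sub>v (H\<^sup>T *\<^sub>v v)"
      using H v by (simp add: Av mult_mat_vec)
    also have "H\<^sup>T *\<^sub>v v = col (H\<^sup>T * H) 0"
      unfolding H(3)[symmetric] using H(1) n by (intro col_mult2[symmetric, of _ n n _ n]) auto
    finally show ?thesis using n by (simp add: H(2))
  qed
  define m where "m = n - 1"
  have nm: "n = 1 + m" using n by (simp add: m_def)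
  define A3 where "A3 = Matrix.mat m m (\<lambda>(i, j). A' $$ (Suc i, Suc j))"
  have A3: "A3 \<in> carrier_mat m m" by (simp add: A3_def)
  have A'0: "A' $$ (i, 0) = (if i = 0 then e else 0)" if "i < n" for i
  proof -
    have "A' $$ (i, 0) = col A' 0 $ i" using that A' n by simp
    then show ?thesis using that by (simp add: col0)
  qed
  have A'0': "A' $$ (0, i) = (if i = 0 then e else 0)" if "i < n" for i
    using A'0[OF that] that A' n symA' by (metis index_transpose_mat(1) carrier_matD)
  have blk: "A' = four_block_mat (Matrix.mat 1 1 (\<lambda>_. e)) (0\<^sub>m 1 m) (0\<^sub>m m 1) A3"
    using A' by (intro eq_matI) (auto simp: nm A3_def A'0 A'0' less_Suc_eq_0_disj)
  have cp1: "char_poly (Matrix.mat 1 1 (\<lambda>_. e)) = [:- e, 1:]"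
    by (subst char_poly_upper_triangular[of _ 1]) (auto simp: diag_mat_def)
  have "char_poly A' = [:- e, 1:] * char_poly A3"
    unfolding blk by (subst char_poly_four_block_zeros_col[of _ _ m]) (auto simp: A3 cp1[simplified])
  then have "char_poly A3 = (\<Prod>e\<leftarrow>es. [:- e, 1:])"
    using Cons.prems(3) unfolding sim by (simp del: mult_pCons_left)
  moreover have "transpose_mat A3 = A3"
    using symA' A' unfolding A3_def
    by (intro eq_matI) (auto simp: nm, metis Suc_eq_plus1_left Suc_mono carrier_matD index_transpose_mat(1))
  ultimately obtain V where V: "V \<in> carrier_mat m m" "V\<^sup>T * V = 1\<^sub>m m"
    "V\<^sup>T * (A3 * V) = diagonal m (\<lambda>i. es ! i)"
    using Cons.IH[OF A3] by blast
  define F where "F = four_block_mat (1\<^sub>m 1) (0\<^sub>m 1 m) (0\<^sub>m m 1) V"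
  have F: "F \<in> carrier_mat n n" using V by (auto simp: F_def nm)
  have Ft: "F\<^sup>T = four_block_mat (1\<^sub>m 1) (0\<^sub>m 1 m) (0\<^sub>m m 1) (V\<^sup>T)"
    unfolding F_def by (subst transpose_four_block_mat[of _ 1 1 _ m _ m]) (use V in auto)
  have FF: "F\<^sup>T * F = 1\<^sub>m n"
    unfolding Ft unfolding F_def
    by (subst mult_four_block_mat[of _ 1 1 _ m _ m _ _ 1 _ m]) (use V in \<open>auto simp: nm intro!: eq_matI\<close>)
  have FAF: "F\<^sup>T * (A' * F) = diagonal n (\<lambda>i. (e # es) ! i)"
  proof -
    have "A' * F = four_block_mat (Matrix.mat 1 1 (\<lambda>_. e)) (0\<^sub>m 1 m) (0\<^sub>m m 1) (A3 * V)"
      unfolding blk F_def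
      by (subst mult_four_block_mat[of _ 1 1 _ m _ m _ _ 1 _ m]) (use V A3 in auto)
    then have "F\<^sup>T * (A' * F)
        = four_block_mat (Matrix.mat 1 1 (\<lambda>_. e)) (0\<^sub>m 1 m) (0\<^sub>m m 1) (V\<^sup>T * (A3 * V))"
      unfolding Ft
      by simp (subst mult_four_block_mat[of _ 1 1 _ m _ m _ _ 1 _ m], use V A3 in auto)
    then show ?thesis
      unfolding V(3) by (simp only:) (rule eq_matI, auto simp: nm less_Suc_eq_0_disj split: if_splits)
  qed
  show ?case
  proof (intro bexI[of _ "H * F"] conjI)
    have t: "(H * F)\<^sup>T = F\<^sup>T * H\<^sup>T"
      using H F by (simp add: transpose_mult[of _ n n])
    have "H\<^sup>T * (H * F) = F"
      using H(1) F by (simp add: assoc_mult_mat[symmetric, of _ n n _ n _ n] H(2))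
    then show "(H * F)\<^sup>T * (H * F) = 1\<^sub>m n"
      unfolding t using H F FF by (simp add: assoc_mult_mat[of _ n n _ n _ n])
    have "(H * F)\<^sup>T * (A * (H * F)) = F\<^sup>T * (A' * F)"
      unfolding t A'_def using H F A by (simp add: assoc_mult_mat[of _ n n _ n _ n])
    then show "(H * F)\<^sup>T * (A * (H * F))
        = diagonal n (\<lambda>i. (e # es) ! i)"
      by (simp only: FAF)
  qed (use H F in auto)
qed

text \<open>The number \<open>s\<close> = v^H A v equals its own conjugate by symmetry, and it
  equals \<open>a\<close> times the positive number |v|^2.\<close>

lemma symmetric_mat_eigenvalue_real:
  fixes A :: "real mat"
  assumes A: "A \<in> carrier_mat n n" and sym: "A\<^sup>T = A"
    and ev: "eigenvalue (map_mat complex_of_real A) a"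
  shows "Im a = 0"
proof -
  obtain v where v: "v \<in> carrier_vec n" "v \<noteq> 0\<^sub>v n" "map_mat complex_of_real A *\<^sub>v v = a \<cdot>\<^sub>v v"
    using A ev unfolding eigenvalue_def eigenvector_def by auto
  have Av: "(\<Sum>j<n. complex_of_real (A $$ (i, j)) * v $ j) = a * v $ i" if "i < n" for i
    using arg_cong[OF v(3), of "\<lambda>w. w $ i"] that v(1) A
    by (simp add: scalar_prod_def lessThan_atLeast0)
  have symij: "A $$ (i, j) = A $$ (j, i)" if "i < n" "j < n" for i j
    using that A sym by (metis index_transpose_mat(1) carrier_matD)
  define s where "s = (\<Sum>i<n. cnj (v $ i) * (\<Sum>j<n. complex_of_real (A $$ (i, j)) * v $ j))"
  have "cnj s = (\<Sum>i<n. \<Sum>j<n. v $ i * (complex_of_real (A $$ (i, j)) * cnj (v $ j)))"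
    by (simp add: s_def sum_distrib_left)
  also have "\<dots> = (\<Sum>j<n. \<Sum>i<n. v $ i * (complex_of_real (A $$ (i, j)) * cnj (v $ j)))"
    by (rule sum.swap)
  also have "\<dots> = s"
    unfolding s_def sum_distrib_left by (intro sum.cong refl) (simp add: symij mult_ac)
  finally have "Im s = 0"
    by (metis Reals_cnj_iff complex_is_Real_iff)
  moreover have "s = a * complex_of_real (\<Sum>i<n. (cmod (v $ i))\<^sup>2)"
  proof -
    have "s = (\<Sum>i<n. cnj (v $ i) * (a * v $ i))" by (simp add: s_def Av)
    also have "\<dots> = a * complex_of_real (\<Sum>i<n. (cmod (v $ i))\<^sup>2)"
      unfolding of_real_sum complex_norm_square sum_distrib_left by (simp add: mult_ac)
    finally show ?thesis .
  qed
  moreover have "(\<Sum>i<n. (cmod (v $ i))\<^sup>2) \<noteq> 0"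
  proof
    assume "(\<Sum>i<n. (cmod (v $ i))\<^sup>2) = 0"
    then have "\<forall>i<n. v $ i = 0" by (subst (asm) sum_nonneg_eq_0_iff) auto
    then show False using v by auto
  qed
  ultimately show ?thesis by simp
qed

text \<open>Factor over the complex numbers, observe that all roots are real, and pull the
  factorization back along the injective embedding of polynomials. The length statement ensures that
  the list behind \<open>singular_value\<close> has an entry for every column.\<close>

lemma symmetric_mat_char_poly_splits:
  fixes A :: "real mat"
  assumes A: "A \<in> carrier_mat n n" and sym: "A\<^sup>T = A"
  defines "es \<equiv> rev (sorted_list_of_multiset (proots (char_poly A)))"
  shows "char_poly A = (\<Prod>e\<leftarrow>es. [:- e, 1:])" and "length es = n"
proof -
  interpret h': map_poly_inj_comm_ring_hom complex_of_real ..
  let ?A = "map_mat complex_of_real A"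
  have cA: "?A \<in> carrier_mat n n" using A by simp
  obtain as where as: "char_poly ?A = (\<Prod>a\<leftarrow>as. [:- a, 1:])" "length as = n"
    using char_poly_factorized[OF cA] by blast
  have "eigenvalue ?A a" if "a \<in> set as" for a
    unfolding eigenvalue_root_char_poly[OF cA] as(1) using that
    by (auto simp: poly_prod_list prod_list_zero_iff)
  then have "complex_of_real (Re a) = a" if "a \<in> set as" for a
    using symmetric_mat_eigenvalue_real[OF A sym, of a] that by (simp add: complex_eq_iff)
  then have eq: "map (\<lambda>a. [:- a, 1:]) as = map (map_poly complex_of_real) (map (\<lambda>a. [:- a, 1:]) (map Re as))"
    by (auto)
  have "map_poly complex_of_real (char_poly A) = char_poly ?A"
    by (rule of_real_hom.char_poly_hom[OF A, symmetric])
  also have "\<dots> = map_poly complex_of_real (\<Prod>a\<leftarrow>map Re as. [:- a, 1:])"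
    unfolding as(1) eq h'.hom_prod_list ..
  finally have cp: "char_poly A = (\<Prod>a\<leftarrow>map Re as. [:- a, 1:])"
    by (rule h'.injectivity)
  have "proots (\<Prod>a\<leftarrow>bs. [:- a, 1:]) = mset bs" for bs :: "real list"
  proof (induction bs)
    case (Cons b bs)
    have "(\<Prod>a\<leftarrow>bs. [:- a, 1:]) \<noteq> 0" by (auto simp: prod_list_zero_iff)
    then have "proots ([:- b, 1:] * (\<Prod>a\<leftarrow>bs. [:- a, 1:])) = {#b#} + mset bs"
      by (subst proots_mult) (simp_all add: Cons.IH)
    then show ?case by (simp del: mult_pCons_left)
  qed simp
  then have pr: "proots (char_poly A) = mset (map Re as)" by (simp only: cp)
  then have mes: "mset es = mset (map Re as)" by (simp add: es_def)
  then show "length es = n" using as(2) by (metis length_map size_mset)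
  show "char_poly A = (\<Prod>e\<leftarrow>es. [:- e, 1:])"
    unfolding cp by (metis (no_types, lifting) mes mset_map prod_mset_prod_list)
qed

section \<open>Singular values and the Frobenius norm\<close>

definition fro :: "real mat \<Rightarrow> real" where
  "fro A = (\<Sum>i<dim_row A. \<Sum>j<dim_col A. (A $$ (i, j))\<^sup>2)"

lemma fro_gram: "fro A = (\<Sum>j<dim_col A. (A\<^sup>T * A) $$ (j, j))"
  unfolding fro_def by (subst sum.swap) (simp add: scalar_prod_def power2_eq_square lessThan_atLeast0)

lemma fro_cols: "fro A = (\<Sum>j<dim_col A. col A j \<bullet> col A j)"
  unfolding fro_gram by simp

lemma fro_transpose: "fro (A\<^sup>T) = fro A"
  unfolding fro_def by (subst sum.swap) simp

lemma mult_mat_entry: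
  fixes A B :: "'a :: comm_semiring_0 mat"
  assumes "A \<in> carrier_mat m p" "B \<in> carrier_mat p n" "i < m" "j < n"
  shows "(A * B) $$ (i, j) = (\<Sum>k<p. A $$ (i, k) * B $$ (k, j))"
  using assms by (simp add: scalar_prod_def lessThan_atLeast0)

lemma gram_entry:
  assumes "A \<in> carrier_mat m n" "i < n" "j < n"
  shows "(A\<^sup>T * A) $$ (i, j) = col A i \<bullet> col A j"
  using assms by simp

lemma fro_mult_left:
  assumes "Q \<in> carrier_mat m p" "Q\<^sup>T * Q = 1\<^sub>m p" "A \<in> carrier_mat p n"
  shows "fro (Q * A) = fro A"
proof -
  have "(Q * A)\<^sup>T * (Q * A) = A\<^sup>T * (Q\<^sup>T * (Q * A))"
    using assms by (simp add: transpose_mult[of _ m p] assoc_mult_mat[of _ n p _ m _ n])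
  also have "Q\<^sup>T * (Q * A) = A"
    using assms by (simp add: assoc_mult_mat[symmetric, of _ p m _ p _ n])
  finally show ?thesis using assms by (simp add: fro_gram)
qed

lemma fro_mult_right:
  assumes "V \<in> carrier_mat p n" "V\<^sup>T * V = 1\<^sub>m n" "A \<in> carrier_mat m n"
  shows "fro (A * V\<^sup>T) = fro A"
  using assms fro_mult_left[of V p n "A\<^sup>T" m] fro_transpose[of "A * V\<^sup>T"]
  by (simp add: transpose_mult[of _ m n] fro_transpose)

lemma orthogonal_mat_right_inverse:
  fixes V :: "real mat"
  assumes "V \<in> carrier_mat n n" "V\<^sup>T * V = 1\<^sub>m n"
  shows "V * V\<^sup>T = 1\<^sub>m n"
  using mat_mult_left_right_inverse[of "V\<^sup>T" n V] assms by auto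

lemma orthogonal_mat_sums:
  fixes V :: "real mat"
  assumes V: "V \<in> carrier_mat n n" "V\<^sup>T * V = 1\<^sub>m n" and ij: "i < n" "j < n"
  shows "(\<Sum>k<n. V $$ (k, i) * V $$ (k, j)) = (if i = j then 1 else 0)"
    and "(\<Sum>k<n. V $$ (i, k) * V $$ (j, k)) = (if i = j then 1 else 0)"
  using arg_cong[OF V(2), of "\<lambda>X. X $$ (i, j)"]
    arg_cong[OF orthogonal_mat_right_inverse[OF V], of "\<lambda>X. X $$ (i, j)"] V(1) ij
  by (simp_all add: scalar_prod_def lessThan_atLeast0)

lemma sum_lessThan_split:
  "k \<le> n \<Longrightarrow> (\<Sum>i<n. f i) = (\<Sum>i<k. f i) + (\<Sum>i=k..<n. f i)" for f :: "nat \<Rightarrow> real"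
  by (subst sum.union_disjoint[symmetric]) (auto intro!: sum.cong)

lemma fro_pythagoras:
  assumes "A \<in> carrier_mat m n" "B \<in> carrier_mat m n" "A\<^sup>T * B = 0\<^sub>m n n"
  shows "fro (A + B) = fro A + fro B"
proof -
  have "B\<^sup>T * A = (A\<^sup>T * B)\<^sup>T"
    using assms(1,2) by (simp add: transpose_mult[of _ n m])
  then have *: "B\<^sup>T * A = 0\<^sub>m n n" using assms(3) by simp
  have "(A + B)\<^sup>T * (A + B) = A\<^sup>T * A + B\<^sup>T * B"
    using assms by (simp add: transpose_add[of _ m n] add_mult_distrib_mat[of _ n m]
        mult_add_distrib_mat[of _ n m] *)
  then show ?thesis using assms by (simp add: fro_gram sum.distrib del: index_mult_mat(1))
qed

lemma scalar_prod_self_sum: "v \<in> carrier_vec n \<Longrightarrow> v \<bullet> v = (\<Sum>i<n. (v $ i)\<^sup>2)"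
  for v :: "real Matrix.vec"
  by (simp add: scalar_prod_def power2_eq_square lessThan_atLeast0)

lemma scalar_prod_self_nonneg: "0 \<le> v \<bullet> v" for v :: "real Matrix.vec"
  by (simp add: scalar_prod_def sum_nonneg)

lemma residual_norm:
  fixes Q :: "real mat"
  assumes Q: "Q \<in> carrier_mat m p" "Q\<^sup>T * Q = 1\<^sub>m p" and x: "x \<in> carrier_vec m"
  defines "y \<equiv> Q\<^sup>T *\<^sub>v x"
  shows "(x - Q *\<^sub>v y) \<bullet> (x - Q *\<^sub>v y) = x \<bullet> x - y \<bullet> y"
proof -
  have y: "y \<in> carrier_vec p" using Q x by (simp add: y_def)
  have Qy: "Q *\<^sub>v y \<in> carrier_vec m" using Q y by simp
  have 1: "x \<bullet> (Q *\<^sub>v y) = y \<bullet> y"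
    using transpose_vec_mult_scalar[OF Q(1) y x] by (simp only: y_def)
  have "Q\<^sup>T *\<^sub>v (Q *\<^sub>v y) = y"
    using Q y by (simp add: assoc_mult_mat_vec[symmetric, of _ p m _ p])
  then have 2: "(Q *\<^sub>v y) \<bullet> (Q *\<^sub>v y) = y \<bullet> y"
    using transpose_vec_mult_scalar[of Q m p y "Q *\<^sub>v y"] Q y by simp
  have "(x - Q *\<^sub>v y) \<bullet> (x - Q *\<^sub>v y) = x \<bullet> x - x \<bullet> (Q *\<^sub>v y) - ((Q *\<^sub>v y) \<bullet> x - (Q *\<^sub>v y) \<bullet> (Q *\<^sub>v y))"
    using x Qy by (simp add: minus_scalar_prod_distrib[of _ m] scalar_prod_minus_distrib[of _ m])
  then show ?thesis
    using 1 2 comm_scalar_prod[OF x Qy] by linarith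
qed

lemma bessel_inequality:
  fixes Q :: "real mat"
  assumes "Q \<in> carrier_mat m p" "Q\<^sup>T * Q = 1\<^sub>m p" "x \<in> carrier_vec m"
  shows "(Q\<^sup>T *\<^sub>v x) \<bullet> (Q\<^sup>T *\<^sub>v x) \<le> x \<bullet> x"
  using residual_norm[OF assms] scalar_prod_self_nonneg[of "x - Q *\<^sub>v (Q\<^sup>T *\<^sub>v x)"] by simp

text \<open>Count \<open>fro Q\<close> twice: by columns it is \<open>p\<close>, and by rows it is
  at most \<open>m\<close>, because Bessel's inequality for a unit vector bounds each row by
  1.\<close>

lemma orthonormal_columns_le:
  fixes Q :: "real mat"
  assumes Q: "Q \<in> carrier_mat m p" "Q\<^sup>T * Q = 1\<^sub>m p"
  shows "p \<le> m"
proof -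
  have "real p = (\<Sum>j<p. (Q\<^sup>T * Q) $$ (j, j))" unfolding Q(2) by simp
  also have "\<dots> = fro Q" using Q by (simp add: fro_gram)
  also have "\<dots> = (\<Sum>i<m. \<Sum>j<p. (Q $$ (i, j))\<^sup>2)" using Q by (simp add: fro_def)
  also have "\<dots> \<le> (\<Sum>i<m. 1)"
  proof (rule sum_mono)
    fix i assume "i \<in> {..<m}"
    then have i: "i < m" by simp
    have "(\<Sum>j<p. (Q $$ (i, j))\<^sup>2) = (Q\<^sup>T *\<^sub>v unit_vec m i) \<bullet> (Q\<^sup>T *\<^sub>v unit_vec m i)"
      using i Q by (subst scalar_prod_self_sum[of _ p]) auto
    also have "\<dots> \<le> unit_vec m i \<bullet> unit_vec m i" by (rule bessel_inequality[OF Q]) simp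
    also have "\<dots> = 1" using i by simp
    finally show "(\<Sum>j<p. (Q $$ (i, j))\<^sup>2) \<le> 1" .
  qed
  finally show ?thesis by simp
qed

text \<open>Only right singular vectors are built. It is enough that the columns of
  \<open>M * V\<close> are orthogonal with the singular values as lengths, so no left factor has to
  be completed where these vanish. The eigenvalue list has \<open>n\<close> entries even if
  \<open>m\<close> is smaller; the last clause says that the surplus is zero.\<close>

lemma right_singular_basis:
  fixes M :: "real mat"
  assumes M: "M \<in> carrier_mat m n"
  defines "\<sigma> \<equiv> \<lambda>i. singular_value M (Suc i)"
  obtains V where "V \<in> carrier_mat n n" "V\<^sup>T * V = 1\<^sub>m n"
    "(M * V)\<^sup>T * (M * V) = diagonal n (\<lambda>i. (\<sigma> i)\<^sup>2)"
    "\<And>i. i < n \<Longrightarrow> 0 \<le> \<sigma> i"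
    "\<And>i j. i \<le> j \<Longrightarrow> j < n \<Longrightarrow> \<sigma> j \<le> \<sigma> i"
    "\<And>i. m \<le> i \<Longrightarrow> i < n \<Longrightarrow> \<sigma> i = 0"
proof -
  let ?A = "M\<^sup>T * M"
  define es where "es = rev (sorted_list_of_multiset (proots (char_poly ?A)))"
  have A: "?A \<in> carrier_mat n n" using M by simp
  have sym: "?A\<^sup>T = ?A" using M by (simp add: transpose_mult[of _ n m])
  note cp = symmetric_mat_char_poly_splits[OF A sym, folded es_def]
  obtain V where V: "V \<in> carrier_mat n n" "V\<^sup>T * V = 1\<^sub>m n"
    and VAV: "V\<^sup>T * (?A * V) = diagonal n (\<lambda>i. es ! i)"
    using symmetric_mat_diagonalizable[OF A sym cp(1)] by blast
  define N where "N = M * V"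
  have N: "N \<in> carrier_mat m n" using M V by (simp add: N_def)
  have NN: "N\<^sup>T * N = diagonal n (\<lambda>i. es ! i)"
    unfolding VAV[symmetric] N_def using M V
    by (simp add: transpose_mult[of _ m n] assoc_mult_mat[of _ n n _ m _ n] assoc_mult_mat[of _ n m _ n _ n])
  have col_N: "col N i \<bullet> col N j = (if i = j then es ! i else 0)" if "i < n" "j < n" for i j
    using arg_cong[OF NN, of "\<lambda>X. X $$ (i, j)"] that N by simp
  have es_nonneg: "0 \<le> es ! i" if "i < n" for i
    using col_N[OF that that] scalar_prod_self_nonneg[of "col N i"] by simp
  have \<sigma>: "\<sigma> i = sqrt (es ! i)" for i
    by (simp add: \<sigma>_def singular_value_def es_def)
  have sq: "(\<sigma> i)\<^sup>2 = es ! i" if "i < n" for i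
    using es_nonneg[OF that] by (simp add: \<sigma>)
  have anti: "es ! j \<le> es ! i" if "i \<le> j" "j < n" for i j
    using sorted_rev_nth_mono[of es i j] that cp(2)
    by (simp add: es_def)
  \<comment> \<open>If \<open>es ! i\<close> were positive, the first \<open>i + 1\<close> columns
    of \<open>N\<close>, scaled to length one, would be more than \<open>m\<close> orthonormal
    vectors in dimension \<open>m\<close>.\<close>
  have zero: "es ! i = 0" if i: "m \<le> i" "i < n" for i
  proof (rule ccontr)
    assume "es ! i \<noteq> 0"
    then have "0 < es ! i" using es_nonneg[OF i(2)] by simp
    then have pos: "0 < es ! j" if "j \<le> i" for j
      using anti[OF that i(2)] by simp
    define W where "W = Matrix.mat m (Suc i) (\<lambda>(a, j). N $$ (a, j) / sqrt (es ! j))"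
    have W: "W \<in> carrier_mat m (Suc i)" by (simp add: W_def)
    have "W\<^sup>T * W = 1\<^sub>m (Suc i)"
    proof (rule eq_matI)
      fix a b assume "a < dim_row (1\<^sub>m (Suc i))" "b < dim_col (1\<^sub>m (Suc i))"
      then have ab: "a < Suc i" "b < Suc i" by auto
      have "(W\<^sup>T * W) $$ (a, b) = (\<Sum>c<m. (N $$ (c, a) * N $$ (c, b)) / (sqrt (es ! a) * sqrt (es ! b)))"
        using ab by (simp add: W_def scalar_prod_def lessThan_atLeast0)
      also have "\<dots> = (col N a \<bullet> col N b) / (sqrt (es ! a) * sqrt (es ! b))"
        using ab i N by (simp add: scalar_prod_def lessThan_atLeast0 sum_divide_distrib)
      also have "\<dots> = (if a = b then 1 else 0)"
        using ab i pos[of a] by (subst col_N) auto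
      finally show "(W\<^sup>T * W) $$ (a, b) = 1\<^sub>m (Suc i) $$ (a, b)" using ab by simp
    qed (use W in auto)
    from orthonormal_columns_le[OF W this] i show False by simp
  qed
  show thesis
  proof (rule that[of V])
    show "(M * V)\<^sup>T * (M * V) = diagonal n (\<lambda>i. (\<sigma> i)\<^sup>2)"
      unfolding N_def[symmetric] NN by (rule eq_matI) (auto simp: sq)
  qed (use V es_nonneg anti zero in \<open>auto simp: \<sigma>\<close>)
qed

section \<open>Power iteration\<close>

lemma pow_mat_Suc_left:
  assumes "A \<in> carrier_mat n n"
  shows "A ^\<^sub>m Suc q = A * A ^\<^sub>m q"
proof (induction q)
  case (Suc q)
  have "A ^\<^sub>m Suc (Suc q) = A * A ^\<^sub>m q * A" unfolding Suc.IH[symmetric] by simp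
  also have "\<dots> = A * (A ^\<^sub>m q * A)"
    by (rule assoc_mult_mat[of _ n n _ n _ n]) (use assms in auto)
  finally show ?case by simp
qed (use assms in simp)

lemma diag_mat_mult:
  fixes f g :: "nat \<Rightarrow> real"
  shows "diagonal n f * diagonal n g
    = diagonal n (\<lambda>i. f i * g i)" (is "?F * ?G = ?H")
proof (rule eq_matI)
  fix i j assume "i < dim_row ?H" "j < dim_col ?H"
  then have ij: "i < n" "j < n" by auto
  have "(?F * ?G) $$ (i, j) = (\<Sum>k=0..<n. (if i = k then f i else 0) * (if k = j then g k else 0))"
    using ij by (simp add: scalar_prod_def)
  also have "\<dots> = (\<Sum>k=0..<n. if k = i then (if i = j then f i * g i else 0) else 0)"
    by (rule sum.cong) auto
  finally show "(?F * ?G) $$ (i, j) = ?H $$ (i, j)" using ij by simp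
qed auto

lemma diag_mat_mult_vec:
  fixes f :: "nat \<Rightarrow> real"
  assumes "w \<in> carrier_vec n" "a < n"
  shows "(diagonal n f *\<^sub>v w) $ a = f a * w $ a"
proof -
  have "(diagonal n f *\<^sub>v w) $ a =
      (\<Sum>b=0..<n. (if a = b then f a else 0) * w $ b)"
    using assms by (simp add: scalar_prod_def)
  also have "\<dots> = (\<Sum>b=0..<n. if b = a then f a * w $ a else 0)"
    by (rule sum.cong) auto
  finally show ?thesis using assms by simp
qed

text \<open>With \<open>N = M * V\<close> one has M M^T = N N^T, and N^T N is diagonal. Each round
  therefore multiplies column \<open>i\<close> of \<open>N\<close> by the square of
  \<open>\<sigma> i\<close>.\<close>

lemma power_iteration:
  fixes M V :: "real mat"
  assumes M: "M \<in> carrier_mat m n" and V: "V \<in> carrier_mat n n" "V\<^sup>T * V = 1\<^sub>m n"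
    and gram: "(M * V)\<^sup>T * (M * V) = diagonal n (\<lambda>i. (\<sigma> i)\<^sup>2)"
  shows "(M * M\<^sup>T) ^\<^sub>m q * (M * V) =
    (M * V) * diagonal n (\<lambda>i. \<sigma> i ^ (2 * q))"
proof (induction q)
  case 0
  have "diagonal n (\<lambda>i. \<sigma> i ^ (2 * 0)) = 1\<^sub>m n"
    by (rule eq_matI) auto
  then show ?case using M V by simp
next
  case (Suc q)
  let ?D = "\<lambda>q. diagonal n (\<lambda>i. \<sigma> i ^ (2 * q))"
  let ?N = "M * V"
  have N: "?N \<in> carrier_mat m n" using M V by simp
  have MM: "M * M\<^sup>T \<in> carrier_mat m m" using M by simp
  have MM_N: "M * M\<^sup>T = ?N * ?N\<^sup>T"
  proof -
    have "?N * ?N\<^sup>T = M * ((V * V\<^sup>T) * M\<^sup>T)"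
      using M V(1) by (simp add: transpose_mult[of _ m n] assoc_mult_mat[of _ m n _ n _ m] assoc_mult_mat[of _ n n _ n _ m])
    then show ?thesis using M by (simp add: orthogonal_mat_right_inverse[OF V])
  qed
  have "(M * M\<^sup>T) ^\<^sub>m Suc q * ?N = (M * M\<^sup>T) * ((M * M\<^sup>T) ^\<^sub>m q * ?N)"
    unfolding pow_mat_Suc_left[OF MM] using MM N by (simp add: assoc_mult_mat[of _ m m _ m _ n])
  also have "\<dots> = ?N * ?N\<^sup>T * (?N * ?D q)" by (subst Suc) (simp only: MM_N)
  also have "\<dots> = ?N * ((?N\<^sup>T * ?N) * ?D q)"
    using N by (simp add: assoc_mult_mat[of _ m n _ m _ n] assoc_mult_mat[of _ n m _ n _ n])
  also have "(?N\<^sup>T * ?N) * ?D q = ?D (Suc q)"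
    unfolding gram diag_mat_mult by (rule eq_matI) (auto simp: power_add power2_eq_square)
  finally show ?case .
qed

section \<open>Error of the randomized range finder\<close>

text \<open>The map \<open>r\<close> projects onto the orthogonal complement of the range of
  \<open>Q\<close> and thus kills the range of \<open>Y = N * (D * \<Omega>)\<close>. For
  \<open>j < k\<close> a multiple of \<open>x j\<close> is sent by \<open>Y\<close> to column
  \<open>j\<close> of \<open>N\<close> plus a combination \<open>N *\<^sub>v z\<close> of trailing
  columns, so up to sign both have the same residual, which is no longer than
  \<open>N *\<^sub>v z\<close>. For a trailing column its own length is bound enough.\<close>

lemma range_finder_error:
  fixes M V G Q R :: "real mat"
  assumes M: "M \<in> carrier_mat m n" and V: "V \<in> carrier_mat n n" "V\<^sup>T * V = 1\<^sub>m n"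
    and gram: "(M * V)\<^sup>T * (M * V) = diagonal n (\<lambda>i. (\<sigma> i)\<^sup>2)"
    and nonneg: "\<And>i. i < n \<Longrightarrow> 0 \<le> \<sigma> i"
    and anti: "\<And>i j. i \<le> j \<Longrightarrow> j < n \<Longrightarrow> \<sigma> j \<le> \<sigma> i"
    and k: "0 < k" "k < n" and pos: "0 < \<sigma> (k - 1)"
    and G: "G \<in> carrier_mat n p"
    and qr: "is_thin_qr ((M * M\<^sup>T) ^\<^sub>m q * M * G) Q R"
    and x: "\<And>i. i < k \<Longrightarrow> x i \<in> carrier_vec p"
    and right_inv: "\<And>a i. a < k \<Longrightarrow> i < k \<Longrightarrow> (V\<^sup>T * G *\<^sub>v x i) $ a = (if a = i then 1 else 0)"
  shows "fro (M - Q * (Q\<^sup>T * M)) \<le> (\<Sum>a=k..<n. (\<sigma> a)\<^sup>2) +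
    (\<sigma> k / \<sigma> (k - 1)) ^ (4 * q) * (\<Sum>a=k..<n. \<Sum>i<k. (\<sigma> a)\<^sup>2 * ((V\<^sup>T * G *\<^sub>v x i) $ a)\<^sup>2)"
proof -
  define N where "N = M * V"
  define \<Omega> where "\<Omega> = V\<^sup>T * G"
  define D where "D = diagonal n (\<lambda>i. \<sigma> i ^ (2 * q))"
  define Y where "Y = (M * M\<^sup>T) ^\<^sub>m q * M * G"
  define \<tau> where "\<tau> = \<sigma> k / \<sigma> (k - 1)"
  have N: "N \<in> carrier_mat m n" using M V by (simp add: N_def)
  have \<Omega>: "\<Omega> \<in> carrier_mat n p" using V G by (simp add: \<Omega>_def)
  have D: "D \<in> carrier_mat n n" by (simp add: D_def)
  have MM: "(M * M\<^sup>T) ^\<^sub>m q \<in> carrier_mat m m" using M by (simp add: pow_carrier_mat)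
  have Y: "Y \<in> carrier_mat m p" unfolding Y_def using MM M G by (intro mult_carrier_mat) auto
  have Q: "Q \<in> carrier_mat m p" "Q\<^sup>T * Q = 1\<^sub>m p" "R \<in> carrier_mat p p" "Y = Q * R"
    using qr Y unfolding is_thin_qr_def Y_def[symmetric] by auto
  have "Y = (M * M\<^sup>T) ^\<^sub>m q * (M * (V * V\<^sup>T)) * G"
    unfolding Y_def orthogonal_mat_right_inverse[OF V] using M by simp
  also have "\<dots> = ((M * M\<^sup>T) ^\<^sub>m q * N) * \<Omega>"
    unfolding N_def \<Omega>_def using MM M V(1) G
    by (simp add: assoc_mult_mat[of _ m n _ n _ n] assoc_mult_mat[of _ m m _ n _ p] assoc_mult_mat[of _ m n _ n _ p] assoc_mult_mat[of _ n n _ n _ p])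
  also have "(M * M\<^sup>T) ^\<^sub>m q * N = N * D"
    unfolding N_def D_def by (rule power_iteration[OF M V gram])
  finally have YN: "Y = N * (D * \<Omega>)"
    using N D \<Omega> by (simp add: assoc_mult_mat[of _ m n _ n _ p])
  define r where "r y = y - Q *\<^sub>v (Q\<^sup>T *\<^sub>v y)" for y
  have r_carrier: "r y \<in> carrier_vec m" if "y \<in> carrier_vec m" for y
    using that Q by (simp add: r_def)
  have r_norm: "r y \<bullet> r y \<le> y \<bullet> y" if "y \<in> carrier_vec m" for y
    using residual_norm[OF Q(1,2) that] scalar_prod_self_nonneg[of "Q\<^sup>T *\<^sub>v y"]
    by (simp add: r_def)
  have r_Y: "r (Y *\<^sub>v w) = 0\<^sub>v m" if w: "w \<in> carrier_vec p" for w
  proof -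
    have Yw: "Y *\<^sub>v w = Q *\<^sub>v (R *\<^sub>v w)" using Q w by (simp add: assoc_mult_mat_vec[of _ m p _ p])
    have "Q\<^sup>T *\<^sub>v (Q *\<^sub>v (R *\<^sub>v w)) = R *\<^sub>v w"
      using Q(1,2,3) w by (simp add: assoc_mult_mat_vec[symmetric, of _ p m _ p])
    then show ?thesis using Q(1,3) w by (simp add: r_def Yw)
  qed
  have r_add: "r (y + z) = r y + r z" if y: "y \<in> carrier_vec m" and z: "z \<in> carrier_vec m" for y z
  proof -
    have Qy: "Q *\<^sub>v (Q\<^sup>T *\<^sub>v y) \<in> carrier_vec m" using Q y by simp
    have Qz: "Q *\<^sub>v (Q\<^sup>T *\<^sub>v z) \<in> carrier_vec m" using Q z by simp
    have "Q *\<^sub>v (Q\<^sup>T *\<^sub>v (y + z)) = Q *\<^sub>v (Q\<^sup>T *\<^sub>v y) + Q *\<^sub>v (Q\<^sup>T *\<^sub>v z)"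
      using Q y z by (simp add: mult_add_distrib_mat_vec[of _ p m] mult_add_distrib_mat_vec[of _ m p])
    then show ?thesis using y z Qy Qz Q(1)
      by (intro eq_vecI) (auto simp: r_def simp del: index_mult_mat_vec)
  qed
  have N_norm: "(N *\<^sub>v z) \<bullet> (N *\<^sub>v z) = (\<Sum>a<n. (\<sigma> a)\<^sup>2 * (z $ a)\<^sup>2)" if z: "z \<in> carrier_vec n" for z
  proof -
    have "(N *\<^sub>v z) \<bullet> (N *\<^sub>v z) = (N\<^sup>T *\<^sub>v (N *\<^sub>v z)) \<bullet> z"
      using transpose_vec_mult_scalar[of N m n z "N *\<^sub>v z"] N z by simp
    also have "N\<^sup>T *\<^sub>v (N *\<^sub>v z) = (N\<^sup>T * N) *\<^sub>v z"
      using N z by (simp add: assoc_mult_mat_vec[of _ n m _ n])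
    also have "\<dots> = Matrix.vec n (\<lambda>a. (\<sigma> a)\<^sup>2 * z $ a)"
      unfolding N_def gram using z by (intro eq_vecI) (simp_all add: diag_mat_mult_vec del: index_mult_mat_vec)
    finally show ?thesis
      using z by (simp add: scalar_prod_def lessThan_atLeast0 power2_eq_square mult_ac)
  qed
  have N_col: "col N j \<bullet> col N j = (\<sigma> j)\<^sup>2" if "j < n" for j
    using arg_cong[OF gram, of "\<lambda>X. X $$ (j, j)"] that N by (simp add: N_def[symmetric])
  have colN: "col N j = N *\<^sub>v unit_vec n j" if "j < n" for j
    using N that by (intro eq_vecI) auto
  have large: "r (col N j) \<bullet> r (col N j) \<le> (\<sigma> j)\<^sup>2" if "j < n" for j
    using r_norm[of "col N j"] N_col[OF that] N that by simp
  have small: "r (col N j) \<bullet> r (col N j) \<le> \<tau> ^ (4 * q) * (\<Sum>a=k..<n. (\<sigma> a)\<^sup>2 * ((\<Omega> *\<^sub>v x j) $ a)\<^sup>2)"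
    if j: "j < k" for j
  proof -
    have \<sigma>j: "0 < \<sigma> j" "\<sigma> (k - 1) \<le> \<sigma> j" using anti[of j "k - 1"] j k pos by linarith+
    \<comment> \<open>The right inverse property annihilates the leading entries of
      \<open>\<Omega> *\<^sub>v x j\<close> except the \<open>j\<close>-th; \<open>c\<close> undoes
      the factor that \<open>D\<close> puts on that one. What is left in \<open>z\<close> are
      trailing entries with weights (\<sigma>_a / \<sigma>_j)^(2q).\<close>
    define c where "c = 1 / \<sigma> j ^ (2 * q)"
    define z where "z = Matrix.vec n (\<lambda>a. if a < k then 0 else c * (\<sigma> a ^ (2 * q) * (\<Omega> *\<^sub>v x j) $ a))"
    have z: "z \<in> carrier_vec n" by (simp add: z_def)
    have \<Omega>x: "\<Omega> *\<^sub>v x j \<in> carrier_vec n" using \<Omega> x[OF j] by simp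
    have Dv: "(D *\<^sub>v w) $ a = \<sigma> a ^ (2 * q) * w $ a" if "w \<in> carrier_vec n" "a < n" for w a
      unfolding D_def by (rule diag_mat_mult_vec[OF that])
    have cx: "c \<cdot>\<^sub>v x j \<in> carrier_vec p" using x[OF j] by simp
    have "(D * \<Omega>) *\<^sub>v (c \<cdot>\<^sub>v x j) = D *\<^sub>v (\<Omega> *\<^sub>v (c \<cdot>\<^sub>v x j))"
      by (rule assoc_mult_mat_vec[OF D \<Omega> cx])
    also have "\<Omega> *\<^sub>v (c \<cdot>\<^sub>v x j) = c \<cdot>\<^sub>v (\<Omega> *\<^sub>v x j)"
      by (rule mult_mat_vec[OF \<Omega> x[OF j]])
    also have "D *\<^sub>v (c \<cdot>\<^sub>v (\<Omega> *\<^sub>v x j)) = c \<cdot>\<^sub>v (D *\<^sub>v (\<Omega> *\<^sub>v x j))"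
      by (rule mult_mat_vec[OF D \<Omega>x])
    also have "\<dots> = unit_vec n j + z"
    proof (rule eq_vecI)
      fix a assume "a < dim_vec (unit_vec n j + z)"
      then have a: "a < n" using z by simp
      have "D *\<^sub>v (\<Omega> *\<^sub>v x j) \<in> carrier_vec n" using D by (rule mult_mat_vec_carrier[OF _ \<Omega>x])
      then have "(c \<cdot>\<^sub>v (D *\<^sub>v (\<Omega> *\<^sub>v x j))) $ a = c * (\<sigma> a ^ (2 * q) * (\<Omega> *\<^sub>v x j) $ a)"
        using a Dv[OF \<Omega>x a] index_smult_vec(1)[of a "D *\<^sub>v (\<Omega> *\<^sub>v x j)" c] by (metis carrier_vecD)
      also have "\<dots> = (unit_vec n j + z) $ a"
      proof (cases "a < k")
        case True
        have "(\<Omega> *\<^sub>v x j) $ a = (if a = j then 1 else 0)"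
          unfolding \<Omega>_def by (rule right_inv[OF True j])
        moreover have "z $ a = 0" using a True by (simp add: z_def)
        ultimately show ?thesis using a j k \<sigma>j z by (cases "a = j") (simp_all add: c_def)
      next
        case False
        then show ?thesis using a j by (simp add: z_def)
      qed
      finally show "(c \<cdot>\<^sub>v (D *\<^sub>v (\<Omega> *\<^sub>v x j))) $ a = (unit_vec n j + z) $ a" .
    qed (use D z in auto)
    finally have w: "(D * \<Omega>) *\<^sub>v (c \<cdot>\<^sub>v x j) = unit_vec n j + z" .
    have "D * \<Omega> \<in> carrier_mat n p" using D \<Omega> by simp
    then have "Y *\<^sub>v (c \<cdot>\<^sub>v x j) = N *\<^sub>v (unit_vec n j + z)"
      unfolding YN w[symmetric] by (rule assoc_mult_mat_vec[OF N _ cx])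
    also have "\<dots> = col N j + N *\<^sub>v z"
      using N z j k by (simp add: mult_add_distrib_mat_vec[of _ m n] colN)
    finally have "r (col N j + N *\<^sub>v z) = 0\<^sub>v m"
      using r_Y[of "c \<cdot>\<^sub>v x j"] x[OF j] by simp
    moreover have colNj: "col N j \<in> carrier_vec m" using N by (rule col_carrier_vec[rotated]) (use j k in simp)
    ultimately have sum0: "r (col N j) + r (N *\<^sub>v z) = 0\<^sub>v m"
      using r_add[OF colNj, of "N *\<^sub>v z"] N z by simp
    have "r (col N j) = - r (N *\<^sub>v z)"
    proof (rule eq_vecI)
      fix a assume "a < dim_vec (- r (N *\<^sub>v z))"
      then have "a < m" using r_carrier[of "N *\<^sub>v z"] N z by simp
      then show "r (col N j) $ a = (- r (N *\<^sub>v z)) $ a"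
        using arg_cong[OF sum0, of "\<lambda>w. w $ a"] r_carrier[of "N *\<^sub>v z"] N z by simp
    next
      show "dim_vec (r (col N j)) = dim_vec (- r (N *\<^sub>v z))"
        using r_carrier[of "N *\<^sub>v z"] r_carrier[OF colNj] N z by simp
    qed
    then have "r (col N j) \<bullet> r (col N j) = r (N *\<^sub>v z) \<bullet> r (N *\<^sub>v z)"
      by (simp add: scalar_prod_def)
    also have "\<dots> \<le> (N *\<^sub>v z) \<bullet> (N *\<^sub>v z)" using r_norm[of "N *\<^sub>v z"] N z by simp
    also have "\<dots> = (\<Sum>a<n. (\<sigma> a)\<^sup>2 * (z $ a)\<^sup>2)" by (rule N_norm[OF z])
    also have "\<dots> = (\<Sum>a=k..<n. (\<sigma> a)\<^sup>2 * (z $ a)\<^sup>2)"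
      by (rule sum.mono_neutral_right) (auto simp: z_def)
    also have "\<dots> \<le> (\<Sum>a=k..<n. \<tau> ^ (4 * q) * ((\<sigma> a)\<^sup>2 * ((\<Omega> *\<^sub>v x j) $ a)\<^sup>2))"
    proof (rule sum_mono)
      fix a assume "a \<in> {k..<n}"
      then have a: "k \<le> a" "a < n" by auto
      \<comment> \<open>The index \<open>a\<close> lies behind the gap and \<open>j\<close> before
        it, so \<open>\<sigma> a\<close> is at most \<open>\<sigma> k\<close> and
        \<open>\<sigma> j\<close> at least \<open>\<sigma> (k - 1)\<close>.\<close>
      have "\<sigma> a / \<sigma> j \<le> \<tau>"
        unfolding \<tau>_def using anti[OF a] \<sigma>j pos nonneg[OF a(2)] nonneg[OF k(2)] by (intro frac_le) auto
      then have "(\<sigma> a / \<sigma> j) ^ (4 * q) \<le> \<tau> ^ (4 * q)"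
        using nonneg[OF a(2)] \<sigma>j by (intro power_mono) auto
      moreover have "(z $ a)\<^sup>2 = (\<sigma> a / \<sigma> j) ^ (4 * q) * ((\<Omega> *\<^sub>v x j) $ a)\<^sup>2"
      proof -
        have "z $ a = (\<sigma> a / \<sigma> j) ^ (2 * q) * (\<Omega> *\<^sub>v x j) $ a"
          using a by (simp add: z_def c_def power_divide)
        moreover have "((\<sigma> a / \<sigma> j) ^ (2 * q))\<^sup>2 = (\<sigma> a / \<sigma> j) ^ (4 * q)"
          by (simp only: power_mult[symmetric]) simp
        ultimately show ?thesis by (simp only: power_mult_distrib)
      qed
      ultimately have "(z $ a)\<^sup>2 \<le> \<tau> ^ (4 * q) * ((\<Omega> *\<^sub>v x j) $ a)\<^sup>2"
        by (simp add: mult_right_mono)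
      then have "(\<sigma> a)\<^sup>2 * (z $ a)\<^sup>2 \<le> (\<sigma> a)\<^sup>2 * (\<tau> ^ (4 * q) * ((\<Omega> *\<^sub>v x j) $ a)\<^sup>2)"
        by (rule mult_left_mono) simp
      then show "(\<sigma> a)\<^sup>2 * (z $ a)\<^sup>2 \<le> \<tau> ^ (4 * q) * ((\<sigma> a)\<^sup>2 * ((\<Omega> *\<^sub>v x j) $ a)\<^sup>2)"
        by (simp add: mult_ac)
    qed
    finally show ?thesis by (simp add: sum_distrib_left)
  qed
  let ?E = "M - Q * (Q\<^sup>T * M)"
  have E: "?E \<in> carrier_mat m n" using M Q by (intro carrier_matI) auto
  have EV: "?E * V = N - Q * (Q\<^sup>T * N)"
    unfolding N_def using M Q(1) V(1)
    by (simp add: minus_mult_distrib_mat[of _ m n] assoc_mult_mat[of _ m p _ n _ n] assoc_mult_mat[of _ p m _ n _ n])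
  have colEV: "col (?E * V) j = r (col N j)" if "j < n" for j
  proof -
    have QN: "Q\<^sup>T * N \<in> carrier_mat p n" using Q N by simp
    have "col (N - X) j = col N j - col X j" if "X \<in> carrier_mat m n" for X
      using that N \<open>j < n\<close> by (intro eq_vecI) auto
    then have "col (?E * V) j = col N j - col (Q * (Q\<^sup>T * N)) j"
      unfolding EV using Q(1) QN by simp
    also have "col (Q * (Q\<^sup>T * N)) j = Q *\<^sub>v col (Q\<^sup>T * N) j"
      by (rule col_mult2[OF Q(1) QN that])
    also have "col (Q\<^sup>T * N) j = Q\<^sup>T *\<^sub>v col N j"
      by (rule col_mult2[OF _ N that]) (use Q in simp)
    finally show ?thesis by (simp add: r_def)
  qed
  have "fro ?E = fro (?E * V)"
    using fro_mult_right[of "V\<^sup>T" n n ?E m] V(1) E orthogonal_mat_right_inverse[OF V] by simp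
  also have "\<dots> = (\<Sum>j<n. r (col N j) \<bullet> r (col N j))"
    unfolding fro_cols using V(1) by (simp add: colEV)
  also have "\<dots> = (\<Sum>j=k..<n. r (col N j) \<bullet> r (col N j)) + (\<Sum>j<k. r (col N j) \<bullet> r (col N j))"
    using k by (simp add: sum_lessThan_split[of k n])
  also have "\<dots> \<le> (\<Sum>j=k..<n. (\<sigma> j)\<^sup>2) +
      (\<Sum>j<k. \<tau> ^ (4 * q) * (\<Sum>a=k..<n. (\<sigma> a)\<^sup>2 * ((\<Omega> *\<^sub>v x j) $ a)\<^sup>2))"
    by (intro add_mono sum_mono large small) auto
  also have "(\<Sum>j<k. \<tau> ^ (4 * q) * (\<Sum>a=k..<n. (\<sigma> a)\<^sup>2 * ((\<Omega> *\<^sub>v x j) $ a)\<^sup>2)) =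
      \<tau> ^ (4 * q) * (\<Sum>a=k..<n. \<Sum>i<k. (\<sigma> a)\<^sup>2 * ((\<Omega> *\<^sub>v x i) $ a)\<^sup>2)"
    by (subst sum.swap) (simp add: sum_distrib_left)
  finally show ?thesis by (simp add: \<tau>_def \<Omega>_def)
qed

text \<open>A total weight of at most \<open>k\<close>, at most 1 per item, is best spent on the
  \<open>k\<close> largest items. The threshold \<open>s (k - 1)\<close> prices the transfer: weight
  taken from behind it is worth at most this much, room left before it at least this much.\<close>

lemma weighted_sum_le_leading_sum:
  fixes s t :: "nat \<Rightarrow> real"
  assumes anti: "\<And>i j. i \<le> j \<Longrightarrow> j < r \<Longrightarrow> s j \<le> s i" and nonneg: "\<And>i. i < r \<Longrightarrow> 0 \<le> s i"
    and t: "\<And>i. i < r \<Longrightarrow> 0 \<le> t i" "\<And>i. i < r \<Longrightarrow> t i \<le> 1"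
    and sum_t: "(\<Sum>i<r. t i) \<le> real k" and k: "0 < k" "k \<le> r"
  shows "(\<Sum>i<r. s i * t i) \<le> (\<Sum>i<k. s i)"
proof -
  let ?c = "s (k - 1)"
  note split = sum_lessThan_split[OF k(2)]
  have "(\<Sum>i=k..<r. s i * t i) \<le> (\<Sum>i=k..<r. ?c * t i)"
    by (intro sum_mono mult_right_mono anti t) auto
  also have "\<dots> \<le> ?c * (\<Sum>i<k. 1 - t i)"
    using sum_t nonneg[of "k - 1"] k unfolding split sum_distrib_left[symmetric]
    by (intro mult_left_mono) (auto simp: sum_subtractf)
  also have "\<dots> \<le> (\<Sum>i<k. s i * (1 - t i))"
    unfolding sum_distrib_left using k t(2) by (intro sum_mono mult_right_mono anti) auto
  also have "\<dots> = (\<Sum>i<k. s i) - (\<Sum>i<k. s i * t i)"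
    by (simp add: algebra_simps sum_subtractf)
  finally show ?thesis unfolding split by simp
qed

text \<open>The matrix T = W^T V is orthogonal, and the squared length of column \<open>a\<close> of
  \<open>B * V\<close> is the sum of the squared singular values of \<open>B\<close> with weights
  T_ia^2. The first \<open>k\<close> columns hence collect at most the \<open>k\<close> largest
  squares. The total is the same for every basis, so the other columns carry at least the
  tail.\<close>

lemma svd_tail_le:
  fixes B V :: "real mat"
  assumes svd: "is_full_svd B U S W" and B: "B \<in> carrier_mat p n"
    and V: "V \<in> carrier_mat n n" "V\<^sup>T * V = 1\<^sub>m n"
    and k: "0 < k" "k \<le> min p n"
  shows "(\<Sum>i=k..<min p n. (S $$ (i, i))\<^sup>2) \<le> (\<Sum>a=k..<n. col (B * V) a \<bullet> col (B * V) a)"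
proof -
  let ?r = "min p n"
  have U: "U \<in> carrier_mat p p" "U\<^sup>T * U = 1\<^sub>m p"
    and W: "W \<in> carrier_mat n n" "W\<^sup>T * W = 1\<^sub>m n"
    and S: "S \<in> carrier_mat p n" "diagonal_mat S" "\<And>i. i < ?r \<Longrightarrow> 0 \<le> S $$ (i, i)"
      "\<And>i j. i \<le> j \<Longrightarrow> j < ?r \<Longrightarrow> S $$ (j, j) \<le> S $$ (i, i)"
    and BUSW: "B = U * S * W\<^sup>T"
    using svd B unfolding is_full_svd_def by auto
  define T where "T = W\<^sup>T * V"
  have T: "T \<in> carrier_mat n n" using W V by (simp add: T_def)
  have TT: "T\<^sup>T * T = 1\<^sub>m n"
  proof -
    have "T\<^sup>T * T = V\<^sup>T * ((W * W\<^sup>T) * V)"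
      unfolding T_def using W(1) V(1) by (simp add: transpose_mult[of _ n n] assoc_mult_mat[of _ n n _ n _ n])
    then show ?thesis using V orthogonal_mat_right_inverse[OF W] by simp
  qed
  have row_T: "(\<Sum>a<n. (T $$ (i, a))\<^sup>2) = 1" and col_T: "(\<Sum>a<n. (T $$ (a, i))\<^sup>2) = 1" if "i < n" for i
    using orthogonal_mat_sums[OF T TT that that] by (simp_all add: power2_eq_square)
  have BV: "B * V = U * (S * T)"
    unfolding BUSW T_def using U(1) S(1) W(1) V(1)
    by (simp add: assoc_mult_mat[of _ p p _ n _ n] assoc_mult_mat[of _ p n _ n _ n])
  have ST: "S * T \<in> carrier_mat p n" using S T by simp
  have S_entry: "S $$ (i, j) = 0" if "i < p" "j < n" "i \<noteq> j" for i j
    using S(1,2) that by (auto simp: diagonal_mat_def)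
  have ST_entry: "(S * T) $$ (i, a) = (if i < n then S $$ (i, i) * T $$ (i, a) else 0)" if "i < p" "a < n" for i a
  proof -
    have "(S * T) $$ (i, a) = (\<Sum>j<n. S $$ (i, j) * T $$ (j, a))"
      using that S T by (simp add: scalar_prod_def lessThan_atLeast0)
    also have "\<dots> = (\<Sum>j<n. if j = i then S $$ (i, i) * T $$ (i, a) else 0)"
      using that by (intro sum.cong) (auto simp: S_entry)
    finally show ?thesis by simp
  qed
  have col_norm: "col (B * V) a \<bullet> col (B * V) a = (\<Sum>i<?r. (S $$ (i, i))\<^sup>2 * (T $$ (i, a))\<^sup>2)" if a: "a < n" for a
  proof -
    have "(B * V)\<^sup>T * (B * V) = (S * T)\<^sup>T * (U\<^sup>T * (U * (S * T)))"
      unfolding BV using U(1) ST by (simp add: transpose_mult[of _ p p] assoc_mult_mat[of _ n p _ p _ n])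
    also have "U\<^sup>T * (U * (S * T)) = S * T"
      using U ST by (simp add: assoc_mult_mat[symmetric, of _ p p _ p _ n] left_mult_one_mat[OF ST])
    finally have "(B * V)\<^sup>T * (B * V) = (S * T)\<^sup>T * (S * T)" .
    moreover have "B * V \<in> carrier_mat p n" using B V by simp
    ultimately have "col (B * V) a \<bullet> col (B * V) a = col (S * T) a \<bullet> col (S * T) a"
      using gram_entry[of _ p n a a] a ST by metis
    also have "\<dots> = (\<Sum>i<p. ((S * T) $$ (i, a))\<^sup>2)"
      using a ST carrier_matD[OF ST]
      by (subst scalar_prod_self_sum[of _ p]) (auto simp: col_def simp del: index_mult_mat intro!: sum.cong)
    also have "\<dots> = (\<Sum>i<?r. ((S * T) $$ (i, a))\<^sup>2)"
      using a by (intro sum.mono_neutral_right) (auto simp: ST_entry)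
    also have "\<dots> = (\<Sum>i<?r. (S $$ (i, i))\<^sup>2 * (T $$ (i, a))\<^sup>2)"
      using a by (intro sum.cong) (auto simp: ST_entry power_mult_distrib)
    finally show ?thesis .
  qed
  have "(\<Sum>a<n. col (B * V) a \<bullet> col (B * V) a) = (\<Sum>i<?r. \<Sum>a<n. (S $$ (i, i))\<^sup>2 * (T $$ (i, a))\<^sup>2)"
    by (subst sum.swap) (simp add: col_norm)
  also have "\<dots> = (\<Sum>i<?r. (S $$ (i, i))\<^sup>2)"
    by (intro sum.cong refl) (simp add: sum_distrib_left[symmetric] row_T)
  finally have total: "(\<Sum>a<n. col (B * V) a \<bullet> col (B * V) a) = (\<Sum>i<?r. (S $$ (i, i))\<^sup>2)" .
  have "(\<Sum>a<k. col (B * V) a \<bullet> col (B * V) a) = (\<Sum>i<?r. \<Sum>a<k. (S $$ (i, i))\<^sup>2 * (T $$ (i, a))\<^sup>2)"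
    using k by (subst sum.swap) (simp add: col_norm)
  also have "\<dots> = (\<Sum>i<?r. (S $$ (i, i))\<^sup>2 * (\<Sum>a<k. (T $$ (i, a))\<^sup>2))"
    by (simp add: sum_distrib_left)
  also have "\<dots> \<le> (\<Sum>i<k. (S $$ (i, i))\<^sup>2)"
  proof (rule weighted_sum_le_leading_sum[OF _ _ _ _ _ k])
    show "(\<Sum>i<?r. \<Sum>a<k. (T $$ (i, a))\<^sup>2) \<le> real k"
    proof -
      have "(\<Sum>i<?r. \<Sum>a<k. (T $$ (i, a))\<^sup>2) \<le> (\<Sum>i<n. \<Sum>a<k. (T $$ (i, a))\<^sup>2)"
        by (intro sum_mono2) (auto intro: sum_nonneg)
      also have "\<dots> = (\<Sum>a<k. \<Sum>i<n. (T $$ (i, a))\<^sup>2)" by (rule sum.swap)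
      also have "\<dots> = real k" using k by (simp add: col_T)
      finally show ?thesis .
    qed
    show "(\<Sum>a<k. (T $$ (i, a))\<^sup>2) \<le> 1" if "i < ?r" for i
    proof -
      have "(\<Sum>a<k. (T $$ (i, a))\<^sup>2) \<le> (\<Sum>a<n. (T $$ (i, a))\<^sup>2)"
        using k by (intro sum_mono2) auto
      then show ?thesis using row_T[of i] that by simp
    qed
    show "(S $$ (j, j))\<^sup>2 \<le> (S $$ (i, i))\<^sup>2" if "i \<le> j" "j < ?r" for i j
      using S(3)[OF that(2)] S(4)[OF that] by (intro power_mono) auto
  qed (auto intro: sum_nonneg)
  finally show ?thesis
    using total sum_lessThan_split[of k n "\<lambda>a. col (B * V) a \<bullet> col (B * V) a"]
      sum_lessThan_split[of k ?r "\<lambda>i. (S $$ (i, i))\<^sup>2"] k by simp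
qed

text \<open>The error splits into \<open>M - Q * B\<close>, which is orthogonal to the range of
  \<open>Q\<close>, and \<open>Q * Z\<close>, where \<open>Z\<close> is the discarded part of the
  decomposition of \<open>B\<close>. The tail of \<open>B\<close> is compared with that of
  \<open>M\<close> in the basis \<open>V\<close> belonging to \<open>M\<close>: by Bessel the
  columns of B V = Q^T (M V) are no longer than those of \<open>M * V\<close>, whose lengths are
  known.\<close>

lemma truncated_svd_error:
  fixes M V G Q R U S W :: "real mat"
  assumes M: "M \<in> carrier_mat m n" and V: "V \<in> carrier_mat n n" "V\<^sup>T * V = 1\<^sub>m n"
    and gram: "(M * V)\<^sup>T * (M * V) = diagonal n (\<lambda>i. (\<sigma> i)\<^sup>2)"
    and nonneg: "\<And>i. i < n \<Longrightarrow> 0 \<le> \<sigma> i"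
    and anti: "\<And>i j. i \<le> j \<Longrightarrow> j < n \<Longrightarrow> \<sigma> j \<le> \<sigma> i"
    and k: "0 < k" "k < n" "k \<le> p" and pos: "0 < \<sigma> (k - 1)"
    and G: "G \<in> carrier_mat n p"
    and qr: "is_thin_qr ((M * M\<^sup>T) ^\<^sub>m q * M * G) Q R"
    and svd: "is_full_svd (Q\<^sup>T * M) U S W"
    and x: "\<And>i. i < k \<Longrightarrow> x i \<in> carrier_vec p"
    and right_inv: "\<And>a i. a < k \<Longrightarrow> i < k \<Longrightarrow> (V\<^sup>T * G *\<^sub>v x i) $ a = (if a = i then 1 else 0)"
  shows "fro (M - Matrix.mat m n (\<lambda>(a, b). \<Sum>i<k. S $$ (i, i) * (Q * U) $$ (a, i) * W $$ (b, i))) \<le>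
    2 * (\<Sum>a=k..<n. (\<sigma> a)\<^sup>2) +
    (\<sigma> k / \<sigma> (k - 1)) ^ (4 * q) * (\<Sum>a=k..<n. \<Sum>i<k. (\<sigma> a)\<^sup>2 * ((V\<^sup>T * G *\<^sub>v x i) $ a)\<^sup>2)"
proof -
  have MM: "(M * M\<^sup>T) ^\<^sub>m q \<in> carrier_mat m m" using M by (simp add: pow_carrier_mat)
  have Y: "(M * M\<^sup>T) ^\<^sub>m q * M * G \<in> carrier_mat m p"
    using MM M G by (intro mult_carrier_mat) auto
  have Q: "Q \<in> carrier_mat m p" "Q\<^sup>T * Q = 1\<^sub>m p"
    using qr carrier_matD[OF Y] unfolding is_thin_qr_def by auto
  define B where "B = Q\<^sup>T * M"
  have B: "B \<in> carrier_mat p n" using Q M by (simp add: B_def)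
  have svdB: "is_full_svd B U S W" using svd by (simp add: B_def)
  have U: "U \<in> carrier_mat p p" "U\<^sup>T * U = 1\<^sub>m p"
    and W: "W \<in> carrier_mat n n" "W\<^sup>T * W = 1\<^sub>m n"
    and S: "S \<in> carrier_mat p n" "diagonal_mat S"
    and BUSW: "B = U * S * W\<^sup>T"
    using svdB B unfolding is_full_svd_def by auto
  define S' where "S' = Matrix.mat p n (\<lambda>(i, j). if i = j \<and> k \<le> i then S $$ (i, i) else 0)"
  have S': "S' \<in> carrier_mat p n" by (simp add: S'_def)
  define Z where "Z = U * (S' * W\<^sup>T)"
  have Z: "Z \<in> carrier_mat p n" using U S' W by (simp add: Z_def)
  let ?A = "M - Q * B"
  have A: "?A \<in> carrier_mat m n" using M Q B by (intro carrier_matI) auto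
  let ?K = "Matrix.mat m n (\<lambda>(a, b). \<Sum>i<k. S $$ (i, i) * (Q * U) $$ (a, i) * W $$ (b, i))"
  have QU: "Q * U \<in> carrier_mat m p" using Q U by simp
  have diff: "M - ?K = ?A + Q * Z"
  proof -
    have QB: "(Q * B) $$ (a, b) = (Q * Z) $$ (a, b) + (\<Sum>i<k. S $$ (i, i) * (Q * U) $$ (a, i) * W $$ (b, i))"
      if ab: "a < m" "b < n" for a b
    proof -
      have entry: "(Q * (U * (D * W\<^sup>T))) $$ (a, b) = (\<Sum>i<p. (Q * U) $$ (a, i) * (if i < n then D $$ (i, i) * W $$ (b, i) else 0))"
        if D: "D \<in> carrier_mat p n" "diagonal_mat D" for D
      proof -
        have "Q * (U * (D * W\<^sup>T)) = (Q * U) * (D * W\<^sup>T)"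
          using Q(1) U(1) D W(1) by (simp add: assoc_mult_mat[of _ m p _ p _ n])
        moreover have "(D * W\<^sup>T) $$ (i, b) = (if i < n then D $$ (i, i) * W $$ (b, i) else 0)" if i: "i < p" for i
        proof -
          have "(D * W\<^sup>T) $$ (i, b) = (\<Sum>j<n. D $$ (i, j) * W $$ (b, j))"
            using i ab D W(1) by (simp add: scalar_prod_def lessThan_atLeast0)
          also have "\<dots> = (\<Sum>j<n. if j = i then D $$ (i, i) * W $$ (b, i) else 0)"
            using i D by (intro sum.cong) (auto simp: diagonal_mat_def)
          finally show ?thesis by simp
        qed
        moreover have "D * W\<^sup>T \<in> carrier_mat p n" using D W by simp
        ultimately show ?thesis
          using ab by (simp only: mult_mat_entry[OF QU _ ab]) simp
      qed
      have "Q * B = Q * (U * (S * W\<^sup>T))"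
        unfolding BUSW using U(1) S(1) W(1) by (simp add: assoc_mult_mat[of _ p p _ n _ n])
      then have "(Q * B) $$ (a, b) = (\<Sum>i<p. (Q * U) $$ (a, i) * (if i < n then S $$ (i, i) * W $$ (b, i) else 0))"
        by (simp add: entry S)
      also have "\<dots> = (\<Sum>i<p. (Q * U) $$ (a, i) * (if i < n then S' $$ (i, i) * W $$ (b, i) else 0)
          + (if i < k then S $$ (i, i) * (Q * U) $$ (a, i) * W $$ (b, i) else 0))"
        using k by (intro sum.cong) (auto simp: S'_def)
      also have "\<dots> = (Q * Z) $$ (a, b) + (\<Sum>i<p. if i < k then S $$ (i, i) * (Q * U) $$ (a, i) * W $$ (b, i) else 0)"
        unfolding Z_def sum.distrib by (subst entry) (auto simp: S'_def diagonal_mat_def)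
      also have "(\<Sum>i<p. if i < k then S $$ (i, i) * (Q * U) $$ (a, i) * W $$ (b, i) else 0)
          = (\<Sum>i<k. S $$ (i, i) * (Q * U) $$ (a, i) * W $$ (b, i))"
        using k(3) by (intro sum.mono_neutral_cong_right) auto
      finally show ?thesis .
    qed
    show ?thesis
      using M Q(1) B Z by (intro eq_matI) (auto simp: QB simp del: index_mult_mat(1))
  qed
  have "Q\<^sup>T * ?A = 0\<^sub>m p n"
  proof -
    have "Q\<^sup>T * (Q * B) = B"
      using Q B by (simp add: assoc_mult_mat[symmetric, of _ p m _ p _ n])
    then show ?thesis
      using Q(1) M B by (simp add: mult_minus_distrib_mat[of _ p m] B_def[symmetric])
  qed
  moreover have "?A\<^sup>T * (Q * Z) = (Q\<^sup>T * ?A)\<^sup>T * Z"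
    using Q(1) Z A by (simp add: transpose_mult[of _ p m] assoc_mult_mat[of _ n m _ p _ n])
  ultimately have "?A\<^sup>T * (Q * Z) = 0\<^sub>m n n" using Z by simp
  then have "fro (M - ?K) = fro ?A + fro (Q * Z)"
    unfolding diff by (rule fro_pythagoras[OF A, rotated]) (use Q Z in simp)
  also have "fro (Q * Z) = fro S'"
    unfolding Z_def
    using fro_mult_left[OF Q, of "U * (S' * W\<^sup>T)" n] fro_mult_left[OF U, of "S' * W\<^sup>T" n]
      fro_mult_right[OF W S'] U(1) S' W(1) by simp
  also have "fro S' = (\<Sum>i<p. \<Sum>j<n. if j = i then (if k \<le> i then (S $$ (i, i))\<^sup>2 else 0) else 0)"
    unfolding fro_def by (intro sum.cong) (auto simp: S'_def)
  also have "\<dots> = (\<Sum>i<p. if i < n \<and> k \<le> i then (S $$ (i, i))\<^sup>2 else 0)"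
    by (intro sum.cong) auto
  also have "\<dots> = (\<Sum>i=k..<min p n. (S $$ (i, i))\<^sup>2)"
    by (intro sum.mono_neutral_cong_right) auto
  also have "\<dots> \<le> (\<Sum>a=k..<n. col (B * V) a \<bullet> col (B * V) a)"
    using k by (intro svd_tail_le[OF svdB B V]) auto
  also have "\<dots> \<le> (\<Sum>a=k..<n. (\<sigma> a)\<^sup>2)"
  proof (rule sum_mono)
    fix a assume a: "a \<in> {k..<n}"
    have MV: "M * V \<in> carrier_mat m n" using M V by simp
    have "B * V = Q\<^sup>T * (M * V)"
      unfolding B_def using Q(1) M V(1) by (simp add: assoc_mult_mat[of _ p m _ n _ n])
    then have "col (B * V) a = Q\<^sup>T *\<^sub>v col (M * V) a"
      using a Q(1) MV by (simp only:) (rule col_mult2[of _ p m _ n], auto)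
    then have "col (B * V) a \<bullet> col (B * V) a \<le> col (M * V) a \<bullet> col (M * V) a"
      using bessel_inequality[OF Q col_carrier_vec[OF _ MV, of a]] a by simp
    also have "\<dots> = (\<sigma> a)\<^sup>2"
      using gram_entry[OF MV, of a a] a unfolding gram by simp
    finally show "col (B * V) a \<bullet> col (B * V) a \<le> (\<sigma> a)\<^sup>2" .
  qed
  finally have "fro (M - ?K) \<le> fro ?A + (\<Sum>a=k..<n. (\<sigma> a)\<^sup>2)" by simp
  then show ?thesis
    using range_finder_error[OF M V gram nonneg anti k(1,2) pos G qr x right_inv] unfolding B_def
    by simp
qed

section \<open>Standard Gaussian measures\<close>

definition std_normal :: "real measure" where
  "std_normal = density lborel (\<lambda>x. ennreal (std_normal_density x))"

definition gauss :: "'i set \<Rightarrow> ('i \<Rightarrow> real) measure" where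
  "gauss I = (\<Pi>\<^sub>M i\<in>I. std_normal)"

lemma prob_space_std_normal: "prob_space std_normal"
  unfolding std_normal_def by (rule prob_space_normal_density) simp

interpretation std_normal: prob_space std_normal
  by (rule prob_space_std_normal)

lemma sets_std_normal[simp, measurable_cong]: "sets std_normal = sets borel"
  by (simp add: std_normal_def)

lemma space_std_normal[simp]: "space std_normal = UNIV"
  by (simp add: std_normal_def)

interpretation gauss: product_prob_space "\<lambda>_. std_normal" UNIV
  by unfold_locales

interpretation lborels: product_sigma_finite "\<lambda>_. lborel :: real measure"
  by unfold_locales

lemma sets_gauss[simp, measurable_cong]: "sets (gauss I) = sets (\<Pi>\<^sub>M i\<in>I. borel)"
  unfolding gauss_def by (intro sets_PiM_cong) auto

lemma space_gauss[simp]: "space (gauss I) = extensional I"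
  by (simp add: gauss_def space_PiM PiE_UNIV_domain PiE_def)

lemma prob_space_gauss: "prob_space (gauss I)"
  unfolding gauss_def by (rule prob_space_PiM) (rule prob_space_std_normal)

lemma nn_integral_std_normal:
  assumes [measurable]: "f \<in> borel_measurable borel"
  shows "(\<integral>\<^sup>+x. f x \<partial>std_normal) = (\<integral>\<^sup>+x. ennreal (std_normal_density x) * f x \<partial>lborel)"
  unfolding std_normal_def by (subst nn_integral_density) auto

text \<open>The right-hand side depends on \<open>x\<close> only through its norm, which is the
  source of all rotation invariance below.\<close>

lemma prod_std_normal_density:
  assumes "finite I"
  shows "(\<Prod>i\<in>I. ennreal (std_normal_density (x i))) =
    ennreal ((1 / sqrt (2 * pi)) ^ card I * exp (- (\<Sum>i\<in>I. (x i)\<^sup>2) / 2))"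
  by (subst prod_ennreal) (auto simp: std_normal_density_def prod.distrib prod_constant
    exp_sum[OF assms, symmetric] sum_negf sum_divide_distrib prod_dividef power_one_over)

lemma gauss_eq_density:
  assumes I: "finite I"
  shows "gauss I = density (\<Pi>\<^sub>M i\<in>I. lborel) (\<lambda>x. \<Prod>i\<in>I. ennreal (std_normal_density (x i)))"
proof -
  let ?f = "\<lambda>x. \<Prod>i\<in>I. ennreal (std_normal_density (x i))"
  have "density (\<Pi>\<^sub>M i\<in>I. lborel) ?f = (\<Pi>\<^sub>M i\<in>I. std_normal)"
  proof (rule gauss.PiM_eqI[OF I])
    show "sets (density (\<Pi>\<^sub>M i\<in>I. lborel) ?f) = sets (\<Pi>\<^sub>M i\<in>I. std_normal)"
      by (simp, intro sets_PiM_cong) auto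
    fix A :: "'a \<Rightarrow> real set" assume "\<And>i. i \<in> I \<Longrightarrow> A i \<in> sets std_normal"
    then have A[measurable]: "\<And>i. i \<in> I \<Longrightarrow> A i \<in> sets borel" by simp
    have PA: "Pi\<^sub>E I A \<in> sets (\<Pi>\<^sub>M i\<in>I. lborel)" by (intro sets_PiM_I_finite I) (auto simp: A)
    have "emeasure (density (\<Pi>\<^sub>M i\<in>I. lborel) ?f) (Pi\<^sub>E I A) =
        (\<integral>\<^sup>+x. ?f x * indicator (Pi\<^sub>E I A) x \<partial>(\<Pi>\<^sub>M i\<in>I. lborel))"
      using PA by (subst emeasure_density) auto
    also have "\<dots> = (\<integral>\<^sup>+x. (\<Prod>i\<in>I. ennreal (std_normal_density (x i)) * indicator (A i) (x i)) \<partial>(\<Pi>\<^sub>M i\<in>I. lborel))"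
    proof (intro nn_integral_cong)
      fix x :: "'a \<Rightarrow> real" assume x: "x \<in> space (\<Pi>\<^sub>M i\<in>I. lborel)"
      have "indicator (Pi\<^sub>E I A) x = (\<Prod>i\<in>I. indicator (A i) (x i) :: ennreal)"
      proof (cases "x \<in> Pi\<^sub>E I A")
        case True
        then show ?thesis by (auto intro!: prod.neutral[symmetric] simp: PiE_mem)
      next
        case False
        then obtain i where "i \<in> I" "x i \<notin> A i" using x by (auto simp: space_PiM PiE_def)
        then have "(\<Prod>i\<in>I. indicator (A i) (x i) :: ennreal) = 0"
        using I by (intro prod_zero bexI[of _ i]) auto
      then show ?thesis using False by simp
      qed
      then show "?f x * indicator (Pi\<^sub>E I A) x = (\<Prod>i\<in>I. ennreal (std_normal_density (x i)) * indicator (A i) (x i))"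
        by (simp add: prod.distrib)
    qed
    also have "\<dots> = (\<Prod>i\<in>I. \<integral>\<^sup>+x. ennreal (std_normal_density x) * indicator (A i) x \<partial>lborel)"
      by (rule lborels.product_nn_integral_prod[OF I]) (auto simp: A)
    also have "\<dots> = (\<Prod>i\<in>I. emeasure std_normal (A i))"
      by (intro prod.cong refl) (simp add: std_normal_def emeasure_density A)
    finally show "emeasure (density (\<Pi>\<^sub>M i\<in>I. lborel) ?f) (Pi\<^sub>E I A) = (\<Prod>i\<in>I. emeasure std_normal (A i))" .
  qed
  then show ?thesis by (simp add: gauss_def)
qed

text \<open>Covers translations and reflections together, the two kinds of map that the rotation
  argument uses.\<close>

lemma PiM_lborel_map:
  fixes T :: "'i \<Rightarrow> real \<Rightarrow> real"
  assumes I: "finite I" and T: "\<And>i. i \<in> I \<Longrightarrow> T i \<in> borel_measurable borel"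
    "\<And>i. i \<in> I \<Longrightarrow> distr lborel borel (T i) = (lborel :: real measure)"
  shows "distr (\<Pi>\<^sub>M i\<in>I. lborel) (\<Pi>\<^sub>M i\<in>I. lborel) (\<lambda>x. \<lambda>i\<in>I. T i (x i)) = (\<Pi>\<^sub>M i\<in>I. lborel)"
proof (rule lborels.PiM_eqI[OF I])
  have m: "(\<lambda>x. \<lambda>i\<in>I. T i (x i)) \<in> measurable (\<Pi>\<^sub>M i\<in>I. lborel) (\<Pi>\<^sub>M i\<in>I. lborel)"
    using T(1) by (intro measurable_restrict) (auto intro: measurable_compose[OF measurable_component_singleton])
  fix A :: "'i \<Rightarrow> real set" assume A: "\<And>i. i \<in> I \<Longrightarrow> A i \<in> sets lborel"
  have "emeasure (distr (\<Pi>\<^sub>M i\<in>I. lborel) (\<Pi>\<^sub>M i\<in>I. lborel) (\<lambda>x. \<lambda>i\<in>I. T i (x i))) (Pi\<^sub>E I A)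
      = emeasure (\<Pi>\<^sub>M i\<in>I. lborel) (Pi\<^sub>E I (\<lambda>i. T i -` A i))"
    using I A by (subst emeasure_distr[OF m])
      (auto intro!: sets_PiM_I_finite arg_cong2[of _ _ _ _ emeasure] simp: space_PiM PiE_def Pi_iff)
  also have "\<dots> = (\<Prod>i\<in>I. emeasure lborel (T i -` A i))"
  proof (rule lborels.emeasure_PiM[OF I])
    show "T i -` A i \<in> sets lborel" if "i \<in> I" for i
      using measurable_sets[OF T(1)[OF that], of "A i"] A[OF that] by simp
  qed
  also have "\<dots> = (\<Prod>i\<in>I. emeasure (distr lborel borel (T i)) (A i))"
    using A T(1) by (intro prod.cong refl, subst emeasure_distr) auto
  finally show "emeasure (distr (\<Pi>\<^sub>M i\<in>I. lborel) (\<Pi>\<^sub>M i\<in>I. lborel) (\<lambda>x. \<lambda>i\<in>I. T i (x i))) (Pi\<^sub>E I A)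
      = (\<Prod>i\<in>I. emeasure lborel (A i))"
    using T(2) by simp
qed simp

lemma nn_integral_PiM_lborel_map:
  fixes T :: "'i \<Rightarrow> real \<Rightarrow> real"
  assumes "finite I" and T: "\<And>i. i \<in> I \<Longrightarrow> T i \<in> borel_measurable borel"
    "\<And>i. i \<in> I \<Longrightarrow> distr lborel borel (T i) = (lborel :: real measure)"
    and f: "f \<in> borel_measurable (\<Pi>\<^sub>M i\<in>I. lborel)"
  shows "(\<integral>\<^sup>+x. f (\<lambda>i\<in>I. T i (x i)) \<partial>(\<Pi>\<^sub>M i\<in>I. lborel)) = (\<integral>\<^sup>+x. f x \<partial>(\<Pi>\<^sub>M i\<in>I. lborel))"
proof -
  have m: "(\<lambda>x. \<lambda>i\<in>I. T i (x i)) \<in> measurable (\<Pi>\<^sub>M i\<in>I. lborel) (\<Pi>\<^sub>M i\<in>I. lborel)"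
    using T(1) by (intro measurable_restrict) (auto intro: measurable_compose[OF measurable_component_singleton])
  show ?thesis
    using nn_integral_distr[OF m, of f] f PiM_lborel_map[OF assms(1) T, simplified] by simp
qed

text \<open>The index set is arbitrary because rotations are applied both to a single row and to a
  whole matrix, whose entries are indexed by pairs.\<close>

definition lin :: "('i \<Rightarrow> 'i \<Rightarrow> real) \<Rightarrow> 'i set \<Rightarrow> ('i \<Rightarrow> real) \<Rightarrow> 'i \<Rightarrow> real" where
  "lin K I x = (\<lambda>i\<in>I. \<Sum>j\<in>I. K i j * x j)"

lemma measurable_lin[measurable]: "finite I \<Longrightarrow> lin K I \<in> measurable (\<Pi>\<^sub>M i\<in>I. borel) (\<Pi>\<^sub>M i\<in>I. borel)"
  unfolding lin_def[abs_def] by measurable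

text \<open>
  Rotation invariance of Lebesgue measure. Integrate \<open>f (K x) \<phi> y\<close> for a Gaussian density \<open>\<phi>\<close>: translating
  first \<open>x\<close> by the preimage of \<open>y\<close>, then \<open>y\<close> by \<open>- K x\<close>, moves \<open>K\<close> from \<open>f\<close> to the rotation
  invariant \<open>\<phi>\<close>.
\<close>

lemma nn_integral_lborel_orthogonal:
  fixes K :: "'i \<Rightarrow> 'i \<Rightarrow> real"
  assumes I: "finite I" and f: "f \<in> borel_measurable (\<Pi>\<^sub>M i\<in>I. lborel)"
    and rows: "\<And>i j. i \<in> I \<Longrightarrow> j \<in> I \<Longrightarrow> (\<Sum>k\<in>I. K i k * K j k) = (if i = j then 1 else 0)"
    and norm: "\<And>x. (\<Sum>i\<in>I. (lin K I x i)\<^sup>2) = (\<Sum>i\<in>I. (x i)\<^sup>2)"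
  shows "(\<integral>\<^sup>+x. f (lin K I x) \<partial>(\<Pi>\<^sub>M i\<in>I. lborel)) = (\<integral>\<^sup>+x. f x \<partial>(\<Pi>\<^sub>M i\<in>I. lborel))"
proof -
  let ?L = "\<Pi>\<^sub>M i\<in>I. lborel :: real measure"
  define \<phi> where "\<phi> x = (\<Prod>i\<in>I. ennreal (std_normal_density (x i)))" for x :: "'i \<Rightarrow> real"
  have sets_L: "sets ?L = sets (\<Pi>\<^sub>M i\<in>I. borel)" by (intro sets_PiM_cong) auto
  note [measurable_cong] = sets_L
  have fm[measurable]: "f \<in> borel_measurable (\<Pi>\<^sub>M i\<in>I. borel)" using f by simp
  have [measurable]: "lin K I \<in> measurable (\<Pi>\<^sub>M i\<in>I. borel) (\<Pi>\<^sub>M i\<in>I. borel)" using I by measurable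
  have [measurable]: "\<phi> \<in> borel_measurable (\<Pi>\<^sub>M i\<in>I. borel)" unfolding \<phi>_def by measurable
  have \<phi>_cong: "\<phi> x = \<phi> y" if "(\<Sum>i\<in>I. (x i)\<^sup>2) = (\<Sum>i\<in>I. (y i)\<^sup>2)" for x y
    using that by (simp add: \<phi>_def prod_std_normal_density[OF I])
  have \<phi>_1: "(\<integral>\<^sup>+x. \<phi> x \<partial>?L) = 1"
  proof -
    have "(\<integral>\<^sup>+x. \<phi> x \<partial>?L) = emeasure (gauss I) (space (gauss I))"
      unfolding gauss_eq_density[OF I] \<phi>_def by (subst emeasure_density) (auto intro!: nn_integral_cong)
    then show ?thesis using prob_space.emeasure_space_1[OF prob_space_gauss] by metis
  qed
  interpret L: finite_product_sigma_finite "\<lambda>_. lborel :: real measure" I by standard fact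
  interpret LL: pair_sigma_finite ?L ?L by standard
  have plus: "(\<integral>\<^sup>+x. g (\<lambda>i\<in>I. a i + x i) \<partial>?L) = (\<integral>\<^sup>+x. g x \<partial>?L)" if "g \<in> borel_measurable ?L" for g a
    using nn_integral_PiM_lborel_map[OF I _ _ that, of "\<lambda>i. (+) (a i)"] by (simp add: lborel_distr_plus)
  have minus: "(\<integral>\<^sup>+x. g (\<lambda>i\<in>I. a i - x i) \<partial>?L) = (\<integral>\<^sup>+x. g x \<partial>?L)" if "g \<in> borel_measurable ?L" for g a
  proof -
    have "distr lborel borel (\<lambda>x. a i - x) = (lborel :: real measure)" for i
    proof -
      have "distr lborel borel (\<lambda>x. a i - x) = distr (distr lborel borel uminus) borel ((+) (a i))"
        by (subst distr_distr) (auto simp: comp_def)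
      then show ?thesis by (simp add: lborel_distr_uminus lborel_distr_plus)
    qed
    then show ?thesis
      using nn_integral_PiM_lborel_map[OF I _ _ that, of "\<lambda>i x. a i - x"] by simp
  qed
  \<comment> \<open>The transpose of the kernel. Orthonormal rows make it a right inverse of
    \<open>lin K I\<close>, so \<open>Kt y\<close> is the preimage of \<open>y\<close> by which
    \<open>x\<close> is translated.\<close>
  define Kt where "Kt y = (\<lambda>j\<in>I. \<Sum>i\<in>I. K i j * y i)" for y :: "'i \<Rightarrow> real"
  have K_Kt: "lin K I (Kt y) i = y i" if i: "i \<in> I" for y i
  proof -
    have "lin K I (Kt y) i = (\<Sum>j\<in>I. \<Sum>k\<in>I. y k * (K i j * K k j))"
      using i by (simp add: lin_def Kt_def sum_distrib_left mult_ac)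
    also have "\<dots> = (\<Sum>k\<in>I. y k * (\<Sum>j\<in>I. K i j * K k j))"
      by (subst sum.swap) (simp add: sum_distrib_left)
    also have "\<dots> = (\<Sum>k\<in>I. if k = i then y i else 0)"
      using i by (intro sum.cong) (auto simp: rows)
    finally show ?thesis using i I by simp
  qed
  have lin_plus: "lin K I (\<lambda>i\<in>I. Kt y i + x i) = (\<lambda>i\<in>I. lin K I x i + y i)" for x y
  proof -
    have "lin K I (\<lambda>i\<in>I. Kt y i + x i) i = lin K I (Kt y) i + lin K I x i" if "i \<in> I" for i
      using that by (simp add: lin_def sum.distrib distrib_left)
    then show ?thesis by (auto simp: K_Kt fun_eq_iff lin_def[of K I "\<lambda>i\<in>I. _ i"] intro!: ext)
  qed
  \<comment> \<open>The map \<open>lin K I\<close> sends the argument on the right to the one on the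
    left and preserves norms, and \<open>\<phi>\<close> sees nothing but norms.\<close>
  have \<phi>_K: "\<phi> (\<lambda>i\<in>I. y i - lin K I x i) = \<phi> (\<lambda>i\<in>I. Kt y i - x i)" for x y
  proof (rule \<phi>_cong)
    have "lin K I (\<lambda>i\<in>I. Kt y i - x i) i = lin K I (Kt y) i - lin K I x i" if "i \<in> I" for i
      using that by (simp add: lin_def sum_subtractf right_diff_distrib)
    then show "(\<Sum>i\<in>I. ((\<lambda>i\<in>I. y i - lin K I x i) i)\<^sup>2) = (\<Sum>i\<in>I. ((\<lambda>i\<in>I. Kt y i - x i) i)\<^sup>2)"
      using norm[of "\<lambda>i\<in>I. Kt y i - x i"] by (simp add: K_Kt)
  qed
  have "(\<integral>\<^sup>+x. f (lin K I x) \<partial>?L) = (\<integral>\<^sup>+x. f (lin K I x) * (\<integral>\<^sup>+y. \<phi> y \<partial>?L) \<partial>?L)"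
    by (simp add: \<phi>_1)
  also have "\<dots> = (\<integral>\<^sup>+x. \<integral>\<^sup>+y. f (lin K I x) * \<phi> y \<partial>?L \<partial>?L)"
    by (subst nn_integral_cmult) auto
  also have "\<dots> = (\<integral>\<^sup>+y. \<integral>\<^sup>+x. f (lin K I x) * \<phi> y \<partial>?L \<partial>?L)"
    by (rule LL.Fubini') measurable
  also have "\<dots> = (\<integral>\<^sup>+y. \<integral>\<^sup>+x. f (\<lambda>i\<in>I. lin K I x i + y i) * \<phi> y \<partial>?L \<partial>?L)"
  proof (rule nn_integral_cong)
    fix y
    have "(\<integral>\<^sup>+x. f (lin K I x) * \<phi> y \<partial>?L) = (\<integral>\<^sup>+x. f (lin K I (\<lambda>i\<in>I. Kt y i + x i)) * \<phi> y \<partial>?L)"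
      by (rule plus[symmetric]) measurable
    then show "(\<integral>\<^sup>+x. f (lin K I x) * \<phi> y \<partial>?L) = (\<integral>\<^sup>+x. f (\<lambda>i\<in>I. lin K I x i + y i) * \<phi> y \<partial>?L)"
      by (simp only: lin_plus)
  qed
  also have "\<dots> = (\<integral>\<^sup>+x. \<integral>\<^sup>+y. f (\<lambda>i\<in>I. lin K I x i + y i) * \<phi> y \<partial>?L \<partial>?L)"
    by (rule LL.Fubini'[symmetric]) measurable
  also have "\<dots> = (\<integral>\<^sup>+x. \<integral>\<^sup>+y. f y * \<phi> (\<lambda>i\<in>I. y i - lin K I x i) \<partial>?L \<partial>?L)"
  proof (rule nn_integral_cong)
    fix x
    have "(\<integral>\<^sup>+y. f y * \<phi> (\<lambda>i\<in>I. y i - lin K I x i) \<partial>?L) =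
        (\<integral>\<^sup>+y. f (\<lambda>i\<in>I. lin K I x i + y i) * \<phi> (\<lambda>i\<in>I. (\<lambda>i\<in>I. lin K I x i + y i) i - lin K I x i) \<partial>?L)"
      by (rule plus[symmetric]) measurable
    also have "\<dots> = (\<integral>\<^sup>+y. f (\<lambda>i\<in>I. lin K I x i + y i) * \<phi> y \<partial>?L)"
      by (intro nn_integral_cong arg_cong2[of _ _ _ _ "(*)"] refl \<phi>_cong) simp
    finally show "(\<integral>\<^sup>+y. f (\<lambda>i\<in>I. lin K I x i + y i) * \<phi> y \<partial>?L) =
        (\<integral>\<^sup>+y. f y * \<phi> (\<lambda>i\<in>I. y i - lin K I x i) \<partial>?L)" by simp
  qed
  also have "\<dots> = (\<integral>\<^sup>+y. \<integral>\<^sup>+x. f y * \<phi> (\<lambda>i\<in>I. y i - lin K I x i) \<partial>?L \<partial>?L)"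
    by (rule LL.Fubini') measurable
  also have "\<dots> = (\<integral>\<^sup>+y. f y * (\<integral>\<^sup>+x. \<phi> (\<lambda>i\<in>I. Kt y i - x i) \<partial>?L) \<partial>?L)"
    unfolding \<phi>_K by (intro nn_integral_cong nn_integral_cmult) measurable
  also have "\<dots> = (\<integral>\<^sup>+y. f y \<partial>?L)"
    by (subst minus) (auto simp: \<phi>_1)
  finally show ?thesis .
qed

text \<open>Orthonormal columns make \<open>lin K I\<close> an isometry and leave the density
  unchanged; the rest is the invariance of Lebesgue measure.\<close>

lemma nn_integral_gauss_orthogonal:
  fixes K :: "'i \<Rightarrow> 'i \<Rightarrow> real"
  assumes I: "finite I" and f: "f \<in> borel_measurable (\<Pi>\<^sub>M i\<in>I. borel)"
    and rows: "\<And>i j. i \<in> I \<Longrightarrow> j \<in> I \<Longrightarrow> (\<Sum>k\<in>I. K i k * K j k) = (if i = j then 1 else 0)"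
    and cols: "\<And>i j. i \<in> I \<Longrightarrow> j \<in> I \<Longrightarrow> (\<Sum>k\<in>I. K k i * K k j) = (if i = j then 1 else 0)"
  shows "(\<integral>\<^sup>+x. f (lin K I x) \<partial>gauss I) = (\<integral>\<^sup>+x. f x \<partial>gauss I)"
proof -
  let ?L = "\<Pi>\<^sub>M i\<in>I. lborel :: real measure"
  let ?\<phi> = "\<lambda>x. \<Prod>i\<in>I. ennreal (std_normal_density (x i))"
  have sets_L: "sets ?L = sets (\<Pi>\<^sub>M i\<in>I. borel)" by (intro sets_PiM_cong) auto
  note [measurable_cong] = sets_L
  note [measurable] = f
  have [measurable]: "lin K I \<in> measurable (\<Pi>\<^sub>M i\<in>I. borel) (\<Pi>\<^sub>M i\<in>I. borel)" using I by measurable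
  have norm: "(\<Sum>i\<in>I. (lin K I x i)\<^sup>2) = (\<Sum>i\<in>I. (x i)\<^sup>2)" for x
  proof -
    have "(\<Sum>i\<in>I. (lin K I x i)\<^sup>2) = (\<Sum>i\<in>I. \<Sum>j\<in>I. \<Sum>k\<in>I. x j * x k * (K i j * K i k))"
      by (simp add: lin_def power2_eq_square sum_product mult_ac)
    also have "\<dots> = (\<Sum>j\<in>I. \<Sum>i\<in>I. \<Sum>k\<in>I. x j * x k * (K i j * K i k))"
      by (rule sum.swap)
    also have "\<dots> = (\<Sum>j\<in>I. \<Sum>k\<in>I. \<Sum>i\<in>I. x j * x k * (K i j * K i k))"
      by (intro sum.cong refl sum.swap)
    also have "\<dots> = (\<Sum>j\<in>I. \<Sum>k\<in>I. if k = j then x j * x k else 0)"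
      by (intro sum.cong refl) (simp add: sum_distrib_left[symmetric] cols)
    also have "\<dots> = (\<Sum>j\<in>I. (x j)\<^sup>2)"
      using I by (simp add: power2_eq_square)
    finally show ?thesis .
  qed
  have dens: "?\<phi> (lin K I x) = ?\<phi> x" for x
    by (simp add: prod_std_normal_density[OF I] norm)
  have "(\<integral>\<^sup>+x. f (lin K I x) \<partial>gauss I) = (\<integral>\<^sup>+x. ?\<phi> (lin K I x) * f (lin K I x) \<partial>?L)"
    unfolding gauss_eq_density[OF I] dens by (subst nn_integral_density) auto
  also have "\<dots> = (\<integral>\<^sup>+x. ?\<phi> x * f x \<partial>?L)"
    by (rule nn_integral_lborel_orthogonal[OF I _ rows norm]) measurable
  also have "\<dots> = (\<integral>\<^sup>+x. f x \<partial>gauss I)"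
    unfolding gauss_eq_density[OF I] by (subst nn_integral_density) auto
  finally show ?thesis .
qed

text \<open>This plays the role of conditioning: the inner integral runs over the entries in
  \<open>J\<close> while the remaining ones are frozen.\<close>

lemma nn_integral_gauss_fold:
  assumes "finite I" "J \<subseteq> I" and f: "f \<in> borel_measurable (\<Pi>\<^sub>M i\<in>I. borel)"
  shows "(\<integral>\<^sup>+x. f x \<partial>gauss I) = (\<integral>\<^sup>+x. \<integral>\<^sup>+y. f (merge (I - J) J (x, y)) \<partial>gauss J \<partial>gauss (I - J))"
proof -
  have I: "(I - J) \<union> J = I" using assms(2) by auto
  have "f \<in> borel_measurable (\<Pi>\<^sub>M i\<in>(I - J) \<union> J. std_normal)"
    using f sets_gauss[of I] unfolding I gauss_def by (simp cong: measurable_cong_sets)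
  from gauss.product_nn_integral_fold[OF _ _ _ this] show ?thesis
    using assms(1,2) finite_subset[OF assms(2,1)] unfolding I gauss_def by auto
qed

section \<open>Gaussian moments and the inverse chi-squared mean\<close>

lemma nn_integral_std_normal_shifted_square:
  "(\<integral>\<^sup>+g. ennreal ((c + g * x)\<^sup>2) \<partial>std_normal) = ennreal (c\<^sup>2 + x\<^sup>2)"
proof -
  have 0: "has_bochner_integral lborel (\<lambda>g. std_normal_density g) 1"
    using std_normal_moment_even[of 0] by simp
  have 1: "has_bochner_integral lborel (\<lambda>g. std_normal_density g * g) 0"
    using std_normal_moment_odd[of 0] by simp
  have 2: "has_bochner_integral lborel (\<lambda>g. std_normal_density g * g\<^sup>2) 1"
    using std_normal_moment_even[of 1] by (simp add: fact_numeral numeral_2_eq_2[symmetric])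
  have "has_bochner_integral lborel
      (\<lambda>g. c\<^sup>2 * std_normal_density g + (2 * c * x) * (std_normal_density g * g) + x\<^sup>2 * (std_normal_density g * g\<^sup>2))
      (c\<^sup>2 * 1 + (2 * c * x) * 0 + x\<^sup>2 * 1)"
    by (intro has_bochner_integral_add has_bochner_integral_mult_right 0 1 2)
  moreover have "(\<lambda>g. c\<^sup>2 * std_normal_density g + (2 * c * x) * (std_normal_density g * g) + x\<^sup>2 * (std_normal_density g * g\<^sup>2))
      = (\<lambda>g. std_normal_density g * (c + g * x)\<^sup>2)"
    by (auto simp: power2_eq_square algebra_simps)
  ultimately have "has_bochner_integral lborel (\<lambda>g. std_normal_density g * (c + g * x)\<^sup>2) (c\<^sup>2 + x\<^sup>2)"
    by simp
  then have "(\<integral>\<^sup>+g. ennreal (std_normal_density g * (c + g * x)\<^sup>2) \<partial>lborel) = ennreal (c\<^sup>2 + x\<^sup>2)"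
    by (subst nn_integral_eq_integral) (auto simp: has_bochner_integral_iff)
  then show ?thesis
    by (subst nn_integral_std_normal) (simp_all add: ennreal_mult'')
qed

lemma nn_integral_gauss_linear_square:
  assumes "finite J"
  shows "(\<integral>\<^sup>+g. ennreal ((c + (\<Sum>b\<in>J. g b * x b))\<^sup>2) \<partial>gauss J) = ennreal (c\<^sup>2 + (\<Sum>b\<in>J. (x b)\<^sup>2))"
  using assms
proof (induction J arbitrary: c rule: finite_induct)
  case empty
  then show ?case using prob_space.emeasure_space_1[OF prob_space_gauss, of "{} :: 'a set"] by simp
next
  case (insert b J)
  note [simp] = insert.hyps
  have m: "(\<lambda>g. ennreal ((c + (\<Sum>b\<in>insert b J. g b * x b))\<^sup>2)) \<in> borel_measurable (\<Pi>\<^sub>M i\<in>insert b J. std_normal)"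
    by measurable
  have "(\<integral>\<^sup>+g. ennreal ((c + (\<Sum>b\<in>insert b J. g b * x b))\<^sup>2) \<partial>gauss (insert b J)) =
      (\<integral>\<^sup>+g. \<integral>\<^sup>+y. ennreal ((c + (\<Sum>a\<in>insert b J. (g(b := y)) a * x a))\<^sup>2) \<partial>std_normal \<partial>gauss J)"
    unfolding gauss_def by (rule gauss.product_nn_integral_insert[OF _ _ m]) auto
  also have "\<dots> = (\<integral>\<^sup>+g. \<integral>\<^sup>+y. ennreal (((c + (\<Sum>a\<in>J. g a * x a)) + y * x b)\<^sup>2) \<partial>std_normal \<partial>gauss J)"
  proof (intro nn_integral_cong arg_cong[where f = ennreal] arg_cong[where f = "\<lambda>x. x\<^sup>2"])
    fix g :: "'a \<Rightarrow> real" and y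
    have "(\<Sum>a\<in>J. (g(b := y)) a * x a) = (\<Sum>a\<in>J. g a * x a)" by (intro sum.cong) auto
    then show "c + (\<Sum>a\<in>insert b J. (g(b := y)) a * x a) = (c + (\<Sum>a\<in>J. g a * x a)) + y * x b" by simp
  qed
  also have "\<dots> = (\<integral>\<^sup>+g. ennreal ((c + (\<Sum>a\<in>J. g a * x a))\<^sup>2) + ennreal ((x b)\<^sup>2) \<partial>gauss J)"
    by (simp add: nn_integral_std_normal_shifted_square)
  also have "\<dots> = ennreal (c\<^sup>2 + (\<Sum>a\<in>J. (x a)\<^sup>2)) + ennreal ((x b)\<^sup>2) * emeasure (gauss J) (space (gauss J))"
    by (subst nn_integral_add) (auto simp: insert.IH nn_integral_const)
  also have "\<dots> = ennreal (c\<^sup>2 + (\<Sum>a\<in>insert b J. (x a)\<^sup>2))"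
    unfolding prob_space.emeasure_space_1[OF prob_space_gauss] by (simp add: sum_nonneg add_ac flip: ennreal_plus)
  finally show ?case .
qed

lemma nn_integral_std_normal_exp_square:
  assumes "0 \<le> t"
  shows "(\<integral>\<^sup>+z. ennreal (exp (- t * z\<^sup>2)) \<partial>std_normal) = ennreal ((1 + 2 * t) powr (- 1 / 2))"
proof -
  \<comment> \<open>The standard normal density times exp(-t z^2) is \<open>\<sigma>\<close> times
    the centered normal density of variance 1 / (1 + 2 t).\<close>
  define \<sigma> where "\<sigma> = 1 / sqrt (1 + 2 * t)"
  have \<sigma>: "0 < \<sigma>" using assms by (simp add: \<sigma>_def)
  have s2: "\<sigma>\<^sup>2 = 1 / (1 + 2 * t)" using assms by (simp add: \<sigma>_def power_divide)
  have "std_normal_density z * exp (- t * z\<^sup>2) = \<sigma> * normal_density 0 \<sigma> z" for z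
  proof -
    have "- z\<^sup>2 / 2 + - t * z\<^sup>2 = - (z - 0)\<^sup>2 / (2 * \<sigma>\<^sup>2)"
      using assms by (simp add: s2 field_simps)
    moreover have "1 / sqrt (2 * pi) = \<sigma> * (1 / sqrt (2 * pi * \<sigma>\<^sup>2))"
      using \<sigma> by (simp add: real_sqrt_mult)
    ultimately show ?thesis
      unfolding std_normal_density_def normal_density_def by (simp add: mult_exp_exp)
  qed
  then have "(\<integral>\<^sup>+z. ennreal (exp (- t * z\<^sup>2)) \<partial>std_normal) = (\<integral>\<^sup>+z. ennreal (\<sigma> * normal_density 0 \<sigma> z) \<partial>lborel)"
    by (subst nn_integral_std_normal) (simp_all add: ennreal_mult''[symmetric])
  also have "\<dots> = ennreal (\<integral>z. \<sigma> * normal_density 0 \<sigma> z \<partial>lborel)"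
    using \<sigma> by (intro nn_integral_eq_integral) auto
  also have "\<dots> = ennreal \<sigma>" using \<sigma> by simp
  also have "\<sigma> = (1 + 2 * t) powr (- 1 / 2)"
    using assms by (simp add: \<sigma>_def powr_minus_divide powr_half_sqrt)
  finally show ?thesis .
qed

text \<open>Writes a reciprocal as a Laplace integral. At \<open>x = 0\<close> both sides are
  infinite, so a sum of squares may be inserted without first excluding that it vanishes.\<close>

lemma nn_integral_exp_neg_mult:
  assumes "0 \<le> x"
  shows "(\<integral>\<^sup>+t. ennreal (exp (- t * x)) * indicator {0..} t \<partial>lborel) = inverse (ennreal x)"
proof (cases "x = 0")
  case True
  have "(\<integral>\<^sup>+t. ennreal (exp (- t * x)) * indicator {0..} t \<partial>lborel) = emeasure lborel {0::real..}"
    using True by simp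
  also have "\<dots> = \<infinity>"
  proof (rule ccontr)
    assume "emeasure lborel {0::real..} \<noteq> \<infinity>"
    then obtain r where r: "0 \<le> r" "emeasure lborel {0::real..} = ennreal r"
      by (cases "emeasure lborel {0::real..}") auto
    have "emeasure lborel {0::real..r + 1} \<le> emeasure lborel {0::real..}"
      by (rule emeasure_mono) auto
    then show False using r by (simp add: ennreal_le_iff)
  qed
  finally show ?thesis using True by simp
next
  case False
  then have x: "0 < x" using assms by simp
  have "(\<integral>\<^sup>+t. ennreal (exp (- t * x)) * indicator {0..} t \<partial>lborel) = 0 - (- exp (- 0 * x) / x)"
  proof (rule nn_integral_FTC_atLeast)
    show "((\<lambda>t. - exp (- t * x) / x) has_real_derivative exp (- t * x)) (at t)" for t
      using x by (auto intro!: derivative_eq_intros)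
    have "filterlim (\<lambda>t. t * x) at_top at_top"
      using x by (intro filterlim_at_top_mult_tendsto_pos[OF tendsto_const] filterlim_ident)
    then have "filterlim (\<lambda>t. - t * x) at_bot at_top"
      by (simp add: filterlim_uminus_at_bot)
    then have "((\<lambda>t. exp (- t * x)) \<longlongrightarrow> 0) at_top"
      by (rule filterlim_compose[OF exp_at_bot])
    from tendsto_divide[OF tendsto_minus[OF this] tendsto_const[of x]]
    show "((\<lambda>t. - exp (- t * x) / x) \<longlongrightarrow> 0) at_top" using x by simp
  qed auto
  also have "\<dots> = inverse (ennreal x)"
    using x by (simp add: inverse_ennreal inverse_eq_divide)
  finally show ?thesis .
qed

text \<open>This is the mean of an inverse chi-squared variable with \<open>card A\<close> degrees of freedom.\<close>

lemma nn_integral_gauss_inverse_sum_squares: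
  assumes J: "finite J" "A \<subseteq> J" and A: "card A = s + 1" "2 \<le> s"
  shows "(\<integral>\<^sup>+x. inverse (ennreal (\<Sum>b\<in>A. (x b)\<^sup>2)) \<partial>gauss J) = ennreal (1 / (real s - 1))"
proof -
  interpret prob_space "gauss J" by (rule prob_space_gauss)
  interpret pair_sigma_finite "gauss J" lborel by standard
  \<comment> \<open>With the reciprocal written as a Laplace integral and the integrals exchanged,
    the exponential factorizes over the independent coordinates; each one in \<open>A\<close>
    contributes (1 + 2 t)^(-1/2).\<close>
  have "(\<integral>\<^sup>+x. inverse (ennreal (\<Sum>b\<in>A. (x b)\<^sup>2)) \<partial>gauss J) =
      (\<integral>\<^sup>+x. \<integral>\<^sup>+t. ennreal (exp (- t * (\<Sum>b\<in>A. (x b)\<^sup>2))) * indicator {0..} t \<partial>lborel \<partial>gauss J)"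
    by (intro nn_integral_cong nn_integral_exp_neg_mult[symmetric] sum_nonneg) simp
  also have "\<dots> = (\<integral>\<^sup>+t. \<integral>\<^sup>+x. ennreal (exp (- t * (\<Sum>b\<in>A. (x b)\<^sup>2))) * indicator {0..} t \<partial>gauss J \<partial>lborel)"
  proof (rule Fubini'[symmetric])
    have [measurable]: "(\<lambda>p. fst p b) \<in> borel_measurable (gauss J \<Otimes>\<^sub>M lborel)" if "b \<in> A" for b
    proof -
      have "b \<in> J" using that J by auto
      then show ?thesis by measurable
    qed
    show "(\<lambda>(x, t). ennreal (exp (- t * (\<Sum>b\<in>A. (x b)\<^sup>2))) * indicator {0..} t) \<in> borel_measurable (gauss J \<Otimes>\<^sub>M lborel)"
      unfolding split_beta' by measurable
  qed
  also have "\<dots> = (\<integral>\<^sup>+t. ennreal ((1 + 2 * t) powr (- (real s + 1) / 2)) * indicator {0..} t \<partial>lborel)"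
  proof (intro nn_integral_cong)
    fix t :: real
    show "(\<integral>\<^sup>+x. ennreal (exp (- t * (\<Sum>b\<in>A. (x b)\<^sup>2))) * indicator {0..} t \<partial>gauss J) =
        ennreal ((1 + 2 * t) powr (- (real s + 1) / 2)) * indicator {0..} t"
    proof (cases "0 \<le> t")
      case True
      have "(\<integral>\<^sup>+x. ennreal (exp (- t * (\<Sum>b\<in>A. (x b)\<^sup>2))) \<partial>gauss J) =
          (\<integral>\<^sup>+x. (\<Prod>b\<in>J. if b \<in> A then ennreal (exp (- t * (x b)\<^sup>2)) else 1) \<partial>gauss J)"
        using J by (intro nn_integral_cong)
          (simp add: prod.If_cases Int_absorb1 prod_ennreal exp_sum[OF finite_subset[OF J(2,1)], symmetric] sum_distrib_left)
      also have "\<dots> = (\<Prod>b\<in>J. \<integral>\<^sup>+z. (if b \<in> A then ennreal (exp (- t * z\<^sup>2)) else 1) \<partial>std_normal)"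
        unfolding gauss_def by (rule gauss.product_nn_integral_prod[OF J(1)]) measurable
      also have "\<dots> = (\<Prod>b\<in>J. if b \<in> A then ennreal ((1 + 2 * t) powr (- 1 / 2)) else 1)"
        using nn_integral_std_normal_exp_square[OF True] std_normal.emeasure_space_1
        by (intro prod.cong) auto
      also have "\<dots> = ennreal ((1 + 2 * t) powr (- 1 / 2)) ^ (s + 1)"
        using J A by (simp add: prod.If_cases Int_absorb1)
      also have "\<dots> = ennreal ((1 + 2 * t) powr (- (real s + 1) / 2))"
      proof -
        have "((1 + 2 * t) powr (- 1 / 2)) ^ (s + 1) = ((1 + 2 * t) powr (- 1 / 2)) powr real (s + 1)"
          using True by (intro powr_realpow[symmetric]) simp
        also have "\<dots> = (1 + 2 * t) powr (- (real s + 1) / 2)"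
          unfolding powr_powr by (intro arg_cong[where f = "(powr) (1 + 2 * t)"]) (simp add: field_simps)
        finally show ?thesis by (simp only: ennreal_power powr_ge_zero)
      qed
      finally show ?thesis using True by simp
    qed simp
  qed
  \<comment> \<open>The antiderivative is -(1 + 2 t)^(-(s - 1)/2) / (s - 1). It tends to 0 because
    \<open>s\<close> exceeds 1, and its value at 0 produces the constant 1 / (s - 1).\<close>
  also have "\<dots> = 0 - (- ((1 + 2 * 0) powr (- (real s - 1) / 2)) / (real s - 1))"
  proof (rule nn_integral_FTC_atLeast)
    show "((\<lambda>t. - ((1 + 2 * t) powr (- (real s - 1) / 2)) / (real s - 1)) has_real_derivative
        (1 + 2 * t) powr (- (real s + 1) / 2)) (at t)" if "0 \<le> t" for t
    proof -
      define a where "a = (real s - 1) / 2"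
      have a: "0 < a" "- (real s - 1) / 2 = - a" "- (real s + 1) / 2 = - a - 1" "real s - 1 = 2 * a"
        using A by (simp_all add: a_def field_simps)
      have "((\<lambda>t. (1 + 2 * t) powr - a) has_real_derivative - a * (1 + 2 * t) powr (- a - 1) * 2) (at t)"
        using that by (auto intro!: derivative_eq_intros)
      from DERIV_cdivide[OF DERIV_minus[OF this], of "2 * a"] show ?thesis
        unfolding a(2-4) using a(1) by simp
    qed
    have "((\<lambda>t::real. (1 + 2 * t) powr (- (real s - 1) / 2)) \<longlongrightarrow> 0) at_top"
    proof (rule tendsto_neg_powr)
      show "- (real s - 1) / 2 < 0" using A by simp
      have "filterlim (\<lambda>t::real. 2 * t) at_top at_top"
        by (rule filterlim_tendsto_pos_mult_at_top[OF tendsto_const _ filterlim_ident]) simp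
      then show "filterlim (\<lambda>t::real. 1 + 2 * t) at_top at_top"
        by (rule filterlim_tendsto_add_at_top[OF tendsto_const])
    qed
    from tendsto_divide[OF tendsto_minus[OF this] tendsto_const[of "real s - 1"]]
    show "((\<lambda>t. - ((1 + 2 * t) powr (- (real s - 1) / 2)) / (real s - 1)) \<longlongrightarrow> 0) at_top"
      using A by simp
  qed auto
  finally show ?thesis by simp
qed

section \<open>The pseudoinverse of a Gaussian matrix\<close>

definition gram_rows :: "nat \<Rightarrow> nat \<Rightarrow> (nat \<times> nat \<Rightarrow> real) \<Rightarrow> real mat" where
  "gram_rows k p \<omega> = Matrix.mat k k (\<lambda>(i, j). \<Sum>b<p. \<omega> (i, b) * \<omega> (j, b))"

text \<open>
  Column \<open>i\<close> of the Moore--Penrose inverse of the matrix formed by the rows \<open>0, \<dots>, k - 1\<close> of \<open>\<omega>\<close>.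
  Cramer's rule makes it a measurable function of \<open>\<omega>\<close>; if the rows are dependent it is \<open>0\<close>.
\<close>

definition pinv :: "nat \<Rightarrow> nat \<Rightarrow> (nat \<times> nat \<Rightarrow> real) \<Rightarrow> nat \<Rightarrow> nat \<Rightarrow> real" where
  "pinv k p \<omega> i b =
     (\<Sum>c<k. adj_mat (gram_rows k p \<omega>) $$ (c, i) / Determinant.det (gram_rows k p \<omega>) * \<omega> (c, b))"

lemma gram_rows_carrier[simp]: "gram_rows k p \<omega> \<in> carrier_mat k k"
  by (simp add: gram_rows_def)

lemma gram_rows_index:
  "i < k \<Longrightarrow> j < k \<Longrightarrow> gram_rows k p \<omega> $$ (i, j) = (\<Sum>b<p. \<omega> (i, b) * \<omega> (j, b))"
  by (simp add: gram_rows_def)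

lemma gram_rows_cong:
  assumes "\<And>c b. c < k \<Longrightarrow> b < p \<Longrightarrow> \<omega> (c, b) = \<omega>' (c, b)"
  shows "gram_rows k p \<omega> = gram_rows k p \<omega>'"
  unfolding gram_rows_def using assms by (intro cong_mat) auto

lemma pinv_cong:
  assumes "\<And>c b. c < k \<Longrightarrow> b < p \<Longrightarrow> \<omega> (c, b) = \<omega>' (c, b)" "b < p"
  shows "pinv k p \<omega> i b = pinv k p \<omega>' i b"
proof -
  have "gram_rows k p \<omega> = gram_rows k p \<omega>'" by (rule gram_rows_cong) (rule assms(1))
  then show ?thesis unfolding pinv_def using assms by (intro sum.cong) auto
qed

lemma pinv_right_inverse:
  assumes det: "Determinant.det (gram_rows k p \<omega>) \<noteq> 0" and a: "a < k" and i: "i < k"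
  shows "(\<Sum>b<p. \<omega> (a, b) * pinv k p \<omega> i b) = (if a = i then 1 else 0)"
proof -
  let ?\<Gamma> = "gram_rows k p \<omega>"
  have "(\<Sum>b<p. \<omega> (a, b) * pinv k p \<omega> i b) =
      (\<Sum>b<p. \<Sum>c<k. \<omega> (a, b) * \<omega> (c, b) * (adj_mat ?\<Gamma> $$ (c, i) / Determinant.det ?\<Gamma>))"
    by (simp add: pinv_def sum_distrib_left mult_ac)
  also have "\<dots> = (\<Sum>c<k. ?\<Gamma> $$ (a, c) * (adj_mat ?\<Gamma> $$ (c, i) / Determinant.det ?\<Gamma>))"
    using a by (subst sum.swap, intro sum.cong refl) (simp only: gram_rows_index sum_distrib_right lessThan_iff)
  also have "\<dots> = (?\<Gamma> * adj_mat ?\<Gamma>) $$ (a, i) / Determinant.det ?\<Gamma>"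
    using adj_mat(1)[of ?\<Gamma> k] a i by (subst mult_mat_entry[of _ k k _ k]) (auto simp: sum_divide_distrib)
  also have "\<dots> = (if a = i then 1 else 0)"
    using adj_mat(2)[of ?\<Gamma> k] a i det by simp
  finally show ?thesis .
qed

lemma measurable_det:
  assumes "\<And>\<omega>. A \<omega> \<in> carrier_mat n n" and "\<And>i j. i < n \<Longrightarrow> j < n \<Longrightarrow> (\<lambda>\<omega>. A \<omega> $$ (i, j)) \<in> borel_measurable N"
  shows "(\<lambda>\<omega>. Determinant.det (A \<omega>) :: real) \<in> borel_measurable N"
proof -
  have "(\<lambda>\<omega>. A \<omega> $$ (i, \<pi> i)) \<in> borel_measurable N" if "i \<in> {0..<n}" "\<pi> permutes {0..<n}" for i \<pi>
    using that permutes_in_image[OF that(2), of i] by (intro assms(2)) auto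
  then show ?thesis
    unfolding det_def'[OF assms(1)] by (intro borel_measurable_sum borel_measurable_times borel_measurable_prod) auto
qed

lemma measurable_pinv:
  assumes \<omega>: "\<And>c b. c < k \<Longrightarrow> b < p \<Longrightarrow> (\<lambda>\<omega>. \<omega> (c, b)) \<in> borel_measurable N" and i: "i < k" and b: "b < p"
  shows "(\<lambda>\<omega>. pinv k p \<omega> i b) \<in> borel_measurable N"
proof -
  have g: "(\<lambda>\<omega>. gram_rows k p \<omega> $$ (c, d)) \<in> borel_measurable N" if "c < k" "d < k" for c d
    using that \<omega> unfolding gram_rows_def by (auto intro!: borel_measurable_sum borel_measurable_times)
  have "(\<lambda>\<omega>. adj_mat (gram_rows k p \<omega>) $$ (c, i)) \<in> borel_measurable N" if c: "c < k" for c
  proof -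
    have "(\<lambda>\<omega>. Determinant.det (mat_delete (gram_rows k p \<omega>) i c)) \<in> borel_measurable N"
    proof (rule measurable_det[of _ "k - 1"])
      show "mat_delete (gram_rows k p \<omega>) i c \<in> carrier_mat (k - 1) (k - 1)" for \<omega> :: "nat \<times> nat \<Rightarrow> real"
        by (rule mat_delete_carrier) simp
      fix d e assume "d < k - 1" "e < k - 1"
      then have "(if d < i then d else Suc d) < k" "(if e < c then e else Suc e) < k"
        and eq: "mat_delete (gram_rows k p \<omega>) i c $$ (d, e) =
          gram_rows k p \<omega> $$ (if d < i then d else Suc d, if e < c then e else Suc e)" for \<omega>
        by (auto simp: mat_delete_def carrier_matD[OF gram_rows_carrier])
      from g[OF this(1,2)] show "(\<lambda>\<omega>. mat_delete (gram_rows k p \<omega>) i c $$ (d, e)) \<in> borel_measurable N"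
        unfolding eq .
    qed
    then show ?thesis
      using c i by (simp add: adj_mat_def cofactor_def carrier_matD[OF gram_rows_carrier])
  qed
  moreover have "(\<lambda>\<omega>. Determinant.det (gram_rows k p \<omega>)) \<in> borel_measurable N"
    using g by (intro measurable_det[of _ k]) auto
  ultimately show ?thesis
    unfolding pinv_def using \<omega> b by (intro borel_measurable_sum borel_measurable_times borel_measurable_divide) auto
qed

text \<open>
  The left factor is the squared length of the dual basis vector, the right one the squared length of
  the component of \<open>w i\<close> orthogonal to the other rows.
\<close>

lemma dual_vector_norm_mult_le:
  fixes w :: "nat \<Rightarrow> nat \<Rightarrow> real"
  assumes i: "i < k" and x: "\<And>b. b < p \<Longrightarrow> x b = (\<Sum>c<k. a c * w c b)"
    and dual: "\<And>c. c < k \<Longrightarrow> (\<Sum>b<p. w c b * x b) = (if c = i then 1 else 0)"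
    and orth: "\<And>c t. c < k \<Longrightarrow> c \<noteq> i \<Longrightarrow> t \<in> A \<Longrightarrow> (\<Sum>b<p. w c b * u t b) = 0"
    and bessel: "(\<Sum>t\<in>A. (\<Sum>b<p. x b * u t b)\<^sup>2) \<le> (\<Sum>b<p. (x b)\<^sup>2)"
  shows "(\<Sum>b<p. (x b)\<^sup>2) * (\<Sum>t\<in>A. (\<Sum>b<p. w i b * u t b)\<^sup>2) \<le> 1"
proof -
  let ?X = "\<Sum>b<p. (x b)\<^sup>2"
  have expand: "(\<Sum>b<p. x b * y b) = (\<Sum>c<k. a c * (\<Sum>b<p. w c b * y b))" for y
  proof -
    have "(\<Sum>b<p. x b * y b) = (\<Sum>b<p. \<Sum>c<k. a c * (w c b * y b))"
      by (intro sum.cong) (auto simp: x sum_distrib_right mult.assoc)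
    then show ?thesis by (subst (asm) sum.swap) (simp add: sum_distrib_left)
  qed
  have "?X = (\<Sum>c<k. if c = i then a i else 0)"
    unfolding power2_eq_square expand by (intro sum.cong) (auto simp: dual)
  \<comment> \<open>Pairing \<open>x\<close> with its own expansion, duality leaves only the
    coefficient of \<open>w i\<close>, which is therefore the squared length of
    \<open>x\<close>.\<close>
  then have X: "?X = a i" using i by simp
  have key: "(\<Sum>b<p. x b * u t b) = ?X * (\<Sum>b<p. w i b * u t b)" if t: "t \<in> A" for t
  proof -
    have "(\<Sum>b<p. x b * u t b) = (\<Sum>c<k. if c = i then a i * (\<Sum>b<p. w i b * u t b) else 0)"
      unfolding expand by (intro sum.cong) (auto simp: orth t)
    then show ?thesis using i by (simp add: X)
  qed
  \<comment> \<open>By \<open>key\<close>, Bessel's inequality becomes X^2 P <= X, with X the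
    squared length of \<open>x\<close> and P the second factor of the claim. Cancelling X gives the
    claim, and for X = 0 it is trivial.\<close>
  have "(\<Sum>t\<in>A. (\<Sum>b<p. x b * u t b)\<^sup>2) = (\<Sum>t\<in>A. ?X\<^sup>2 * (\<Sum>b<p. w i b * u t b)\<^sup>2)"
    by (intro sum.cong refl) (simp only: key power_mult_distrib)
  then have "?X * (?X * (\<Sum>t\<in>A. (\<Sum>b<p. w i b * u t b)\<^sup>2)) \<le> ?X"
    using bessel by (simp only: sum_distrib_left[symmetric] power2_eq_square[of ?X] mult.assoc)
  moreover have "0 \<le> ?X" by (simp add: sum_nonneg)
  ultimately show ?thesis
    by (cases "?X = 0") (auto intro: mult_left_le_imp_le[of ?X])
qed

text \<open>Freeze all rows but the \<open>i\<close>-th and choose an orthogonal \<open>V\<close>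
  whose last \<open>s + 1\<close> columns are orthogonal to the other \<open>k - 1\<close> leading
  rows. The squared length of the pseudoinverse column is at most the reciprocal of the sum of
  squares of the coordinates of row \<open>i\<close> along these columns. As \<open>V\<close> does
  not depend on row \<open>i\<close>, rotation invariance replaces these coordinates by independent
  standard normals. Working with an inequality keeps the estimate valid for degenerate rows
  too.\<close>

lemma nn_integral_pinv_norm:
  assumes n: "k \<le> n" and i: "i < k" and s: "2 \<le> s"
  defines "p \<equiv> k + s"
  shows "(\<integral>\<^sup>+\<omega>. ennreal (\<Sum>b<p. (pinv k p \<omega> i b)\<^sup>2) \<partial>gauss ({..<n} \<times> {..<p})) \<le> ennreal (1 / (real s - 1))"
proof -
  let ?I = "{..<n} \<times> {..<p}"
  let ?J = "{i} \<times> {..<p}"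
  have JI: "?J \<subseteq> ?I" using i n by auto
  have meas: "(\<lambda>\<omega>. ennreal (\<Sum>b<p. (pinv k p \<omega> i b)\<^sup>2)) \<in> borel_measurable (\<Pi>\<^sub>M i\<in>?I. borel)"
    using i n by (auto intro!: measurable_compose[OF _ measurable_ennreal] borel_measurable_sum borel_measurable_power measurable_pinv)
  have "(\<integral>\<^sup>+\<omega>. ennreal (\<Sum>b<p. (pinv k p \<omega> i b)\<^sup>2) \<partial>gauss ?I) =
      (\<integral>\<^sup>+x. \<integral>\<^sup>+y. ennreal (\<Sum>b<p. (pinv k p (merge (?I - ?J) ?J (x, y)) i b)\<^sup>2) \<partial>gauss ?J \<partial>gauss (?I - ?J))"
    by (rule nn_integral_gauss_fold[OF _ JI meas]) simp
  also have "\<dots> \<le> (\<integral>\<^sup>+x. ennreal (1 / (real s - 1)) \<partial>gauss (?I - ?J))"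
  proof (rule nn_integral_mono)
    fix x :: "nat \<times> nat \<Rightarrow> real"
    \<comment> \<open>The leading rows with the \<open>i\<close>-th removed; the conditional skips
      that index.\<close>
    define R where "R = Matrix.mat (k - 1) p (\<lambda>(j, b). x (if j < i then j else Suc j, b))"
    have R: "R \<in> carrier_mat (k - 1) p" by (simp add: R_def)
    let ?\<sigma> = "\<lambda>i. singular_value R (Suc i)"
    \<comment> \<open>As \<open>R\<close> has \<open>k - 1\<close> rows, its singular values vanish
      from index \<open>k - 1\<close> on, so the columns of \<open>V\<close> from there on lie in
      the kernel of \<open>R\<close>.\<close>
    obtain V where V: "V \<in> carrier_mat p p" "V\<^sup>T * V = 1\<^sub>m p"
      and gram: "(R * V)\<^sup>T * (R * V) = diagonal p (\<lambda>i. (?\<sigma> i)\<^sup>2)"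
      and zero: "\<And>t. k - 1 \<le> t \<Longrightarrow> t < p \<Longrightarrow> ?\<sigma> t = 0"
      by (rule right_singular_basis[OF R]) (rule that)
    \<comment> \<open>There are p - (k - 1) = s + 1 of these columns, the number of degrees of
      freedom.\<close>
    define A where "A = {k - 1..<p}"
    have RV: "R * V \<in> carrier_mat (k - 1) p" using R V by simp
    have orthV: "(\<Sum>b<p. R $$ (c, b) * V $$ (b, t)) = 0" if t: "t \<in> A" and c: "c < k - 1" for c t
    proof -
      have tp: "t < p" using t by (simp add: A_def)
      have "col (R * V) t \<bullet> col (R * V) t = 0"
        using gram_entry[OF RV tp tp] zero[of t] t unfolding gram by (simp add: A_def)
      then have "(\<Sum>c<k - 1. (col (R * V) t $ c)\<^sup>2) = 0"
        using scalar_prod_self_sum[OF col_carrier_vec[OF tp RV]] by simp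
      then have "(col (R * V) t $ c)\<^sup>2 = 0"
        using c by (subst (asm) sum_nonneg_eq_0_iff) auto
      moreover have "col (R * V) t $ c = (R * V) $$ (c, t)"
        using c tp carrier_matD[OF RV] unfolding col_def by (simp del: index_mult_mat)
      ultimately show ?thesis using mult_mat_entry[OF R V(1) c tp] by simp
    qed
    let ?K = "\<lambda>r r'. V $$ (snd r', snd r)"
    note VV = orthogonal_mat_sums[OF V]
    have sum_J: "(\<Sum>r\<in>?J. f r) = (\<Sum>b<p. f (i, b))" for f :: "nat \<times> nat \<Rightarrow> real"
      by (rule sum.reindex_bij_witness[of _ "\<lambda>b. (i, b)" snd]) auto
    have pointwise: "ennreal (\<Sum>b<p. (pinv k p (merge (?I - ?J) ?J (x, y)) i b)\<^sup>2)
        \<le> inverse (ennreal (\<Sum>r\<in>{i} \<times> A. (lin ?K ?J y r)\<^sup>2))" for y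
    proof -
      define \<omega> where "\<omega> = merge (?I - ?J) ?J (x, y)"
      have \<omega>i: "\<omega> (i, b) = y (i, b)" if "b < p" for b
        using that by (simp add: \<omega>_def merge_def)
      have \<omega>c: "\<omega> (c, b) = x (c, b)" if "b < p" "c < k" "c \<noteq> i" for b c
        using that n by (simp add: \<omega>_def merge_def)
      let ?X = "\<Sum>b<p. (pinv k p \<omega> i b)\<^sup>2"
      let ?P = "\<Sum>t\<in>A. (\<Sum>b<p. \<omega> (i, b) * V $$ (b, t))\<^sup>2"
      have P: "(\<Sum>r\<in>{i} \<times> A. (lin ?K ?J y r)\<^sup>2) = ?P"
      proof -
        have "(\<Sum>r\<in>{i} \<times> A. (lin ?K ?J y r)\<^sup>2) = (\<Sum>t\<in>A. (lin ?K ?J y (i, t))\<^sup>2)"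
          by (rule sum.reindex_bij_witness[of _ "\<lambda>b. (i, b)" snd]) auto
        also have "\<dots> = ?P"
        proof (intro sum.cong refl arg_cong[where f = "\<lambda>x. x\<^sup>2"])
          fix t assume "t \<in> A"
          then have "lin ?K ?J y (i, t) = (\<Sum>b<p. V $$ (b, t) * y (i, b))"
            unfolding lin_def sum_J by (simp add: A_def)
          also have "\<dots> = (\<Sum>b<p. \<omega> (i, b) * V $$ (b, t))"
            by (intro sum.cong refl) (simp add: \<omega>i)
          finally show "lin ?K ?J y (i, t) = (\<Sum>b<p. \<omega> (i, b) * V $$ (b, t))" .
        qed
        finally show ?thesis .
      qed
      have "?X * ?P \<le> 1"
      proof (cases "Determinant.det (gram_rows k p \<omega>) = 0")
        \<comment> \<open>Division by zero turns \<open>pinv\<close> into the zero vector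
          here.\<close>
        case True
        then show ?thesis by (simp add: pinv_def)
      next
        case False
        show ?thesis
        proof (rule dual_vector_norm_mult_le[OF i])
          show "pinv k p \<omega> i b = (\<Sum>c<k. adj_mat (gram_rows k p \<omega>) $$ (c, i) / Determinant.det (gram_rows k p \<omega>) * \<omega> (c, b))" for b
            by (simp add: pinv_def)
          show "(\<Sum>b<p. \<omega> (c, b) * pinv k p \<omega> i b) = (if c = i then 1 else 0)" if "c < k" for c
            by (rule pinv_right_inverse[OF False that i])
          show "(\<Sum>b<p. \<omega> (c, b) * V $$ (b, t)) = 0" if c: "c < k" "c \<noteq> i" and t: "t \<in> A" for c t
          proof -
            define c' where "c' = (if c < i then c else c - 1)"
            have c': "c' < k - 1" "(if c' < i then c' else Suc c') = c" using c i by (auto simp: c'_def)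
            have "(\<Sum>b<p. \<omega> (c, b) * V $$ (b, t)) = (\<Sum>b<p. R $$ (c', b) * V $$ (b, t))"
              using c c' by (intro sum.cong) (auto simp: R_def \<omega>c)
            then show ?thesis using orthV[OF t c'(1)] by simp
          qed
          let ?x = "pinv k p \<omega> i"
          define z where "z = Matrix.vec p ?x"
          have z: "z \<in> carrier_vec p" by (simp add: z_def)
          have "(\<Sum>t\<in>A. (\<Sum>b<p. ?x b * V $$ (b, t))\<^sup>2) \<le> (\<Sum>t<p. (\<Sum>b<p. ?x b * V $$ (b, t))\<^sup>2)"
            by (intro sum_mono2) (auto simp: A_def)
          also have "\<dots> = (V\<^sup>T *\<^sub>v z) \<bullet> (V\<^sup>T *\<^sub>v z)"
          proof -
            have "(V\<^sup>T *\<^sub>v z) $ t = (\<Sum>b<p. V $$ (b, t) * ?x b)" if "t < p" for t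
              using that V(1) by (simp add: z_def scalar_prod_def lessThan_atLeast0)
            moreover have "V\<^sup>T *\<^sub>v z \<in> carrier_vec p" using V(1) z by (intro mult_mat_vec_carrier) auto
            ultimately show ?thesis by (simp only: scalar_prod_self_sum mult.commute[of "?x _"]) simp
          qed
          also have "\<dots> \<le> z \<bullet> z" by (rule bessel_inequality[OF V z])
          also have "\<dots> = (\<Sum>b<p. (?x b)\<^sup>2)" using z by (subst scalar_prod_self_sum) (auto simp: z_def)
          finally show "(\<Sum>t\<in>A. (\<Sum>b<p. ?x b * V $$ (b, t))\<^sup>2) \<le> (\<Sum>b<p. (?x b)\<^sup>2)" .
        qed
      qed
      \<comment> \<open>If \<open>?P\<close> vanishes, the reciprocal on the right is infinite and
        nothing is claimed.\<close>
      then show ?thesis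
        unfolding P \<omega>_def[symmetric]
      proof (cases "?P = 0")
        case False
        then have "0 < ?P" using sum_nonneg[of A "\<lambda>t. (\<Sum>b<p. \<omega> (i, b) * V $$ (b, t))\<^sup>2"] by simp
        then show "ennreal ?X \<le> inverse (ennreal ?P)"
          using \<open>?X * ?P \<le> 1\<close> by (simp only: inverse_ennreal inverse_eq_divide pos_le_divide_eq ennreal_leI)
      qed simp
    qed
    have "(\<integral>\<^sup>+y. ennreal (\<Sum>b<p. (pinv k p (merge (?I - ?J) ?J (x, y)) i b)\<^sup>2) \<partial>gauss ?J) \<le>
        (\<integral>\<^sup>+y. inverse (ennreal (\<Sum>r\<in>{i} \<times> A. (lin ?K ?J y r)\<^sup>2)) \<partial>gauss ?J)"
      by (intro nn_integral_mono pointwise)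
    also have "\<dots> = (\<integral>\<^sup>+y. inverse (ennreal (\<Sum>r\<in>{i} \<times> A. (y r)\<^sup>2)) \<partial>gauss ?J)"
    proof (rule nn_integral_gauss_orthogonal)
      show "(\<lambda>y. inverse (ennreal (\<Sum>r\<in>{i} \<times> A. (y r)\<^sup>2))) \<in> borel_measurable (\<Pi>\<^sub>M i\<in>?J. borel)"
        by (intro borel_measurable_inverse_ennreal measurable_compose[OF _ measurable_ennreal]
            borel_measurable_sum borel_measurable_power measurable_component_singleton) (auto simp: A_def)
      show "(\<Sum>r\<in>?J. ?K r1 r * ?K r2 r) = (if r1 = r2 then 1 else 0)" if "r1 \<in> ?J" "r2 \<in> ?J" for r1 r2
        unfolding sum_J using that VV(1)[of "snd r1" "snd r2"] by (auto split: if_splits)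
      show "(\<Sum>r\<in>?J. ?K r r1 * ?K r r2) = (if r1 = r2 then 1 else 0)" if "r1 \<in> ?J" "r2 \<in> ?J" for r1 r2
        unfolding sum_J using that VV(2)[of "snd r1" "snd r2"] by (auto split: if_splits)
    qed simp
    also have "\<dots> = ennreal (1 / (real s - 1))"
    proof (rule nn_integral_gauss_inverse_sum_squares[OF _ _ _ s])
      show "card ({i} \<times> A) = s + 1" using i by (simp add: A_def p_def card_cartesian_product)
    qed (auto simp: A_def)
    finally show "(\<integral>\<^sup>+y. ennreal (\<Sum>b<p. (pinv k p (merge (?I - ?J) ?J (x, y)) i b)\<^sup>2) \<partial>gauss ?J) \<le>
        ennreal (1 / (real s - 1))" .
  qed
  also have "\<dots> = ennreal (1 / (real s - 1))"
    using prob_space.emeasure_space_1[OF prob_space_gauss, of "?I - ?J"] by simp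
  finally show ?thesis .
qed

text \<open>The pseudoinverse involves only rows below \<open>k\<close>, so row \<open>a\<close> is
  independent of it. With everything else frozen the sum is a linear form in standard normals, and
  its second moment is the squared length of the coefficient vector.\<close>

lemma nn_integral_row_pinv:
  assumes a: "k \<le> a" "a < n" and i: "i < k" and s: "2 \<le> s"
  defines "p \<equiv> k + s"
  shows "(\<integral>\<^sup>+\<omega>. ennreal ((\<Sum>b<p. \<omega> (a, b) * pinv k p \<omega> i b)\<^sup>2) \<partial>gauss ({..<n} \<times> {..<p})) \<le> ennreal (1 / (real s - 1))"
proof -
  let ?I = "{..<n} \<times> {..<p}"
  let ?B = "\<Pi>\<^sub>M i\<in>?I. borel :: real measure"
  let ?J = "{a} \<times> {..<p}"
  have JI: "?J \<subseteq> ?I" using a by auto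
  have m1: "(\<lambda>\<omega>. pinv k p \<omega> i b) \<in> borel_measurable ?B" if "b < p" for b
    using i a that by (intro measurable_pinv) (auto intro!: measurable_component_singleton)
  have m2: "(\<lambda>\<omega>. \<omega> (a, b)) \<in> borel_measurable ?B" if "b < p" for b
    using a that by (intro measurable_component_singleton) auto
  have meas: "(\<lambda>\<omega>. ennreal ((\<Sum>b<p. \<omega> (a, b) * pinv k p \<omega> i b)\<^sup>2)) \<in> borel_measurable ?B"
    by (intro measurable_compose[OF _ measurable_ennreal] borel_measurable_power borel_measurable_sum borel_measurable_times m1 m2) auto
  have meas': "(\<lambda>\<omega>. ennreal (\<Sum>b<p. (pinv k p \<omega> i b)\<^sup>2)) \<in> borel_measurable ?B"
    by (intro measurable_compose[OF _ measurable_ennreal] borel_measurable_power borel_measurable_sum m1) auto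
  have sum_J: "(\<Sum>r\<in>?J. f r) = (\<Sum>b<p. f (a, b))" for f :: "nat \<times> nat \<Rightarrow> real"
    by (rule sum.reindex_bij_witness[of _ "\<lambda>b. (a, b)" snd]) auto
  have pinv_merge: "pinv k p (merge (?I - ?J) ?J (x, y)) i b = pinv k p x i b" if "b < p" for x y b
    using that a by (intro pinv_cong) (auto simp: merge_def)
  have "(\<integral>\<^sup>+\<omega>. ennreal ((\<Sum>b<p. \<omega> (a, b) * pinv k p \<omega> i b)\<^sup>2) \<partial>gauss ?I) =
      (\<integral>\<^sup>+x. \<integral>\<^sup>+y. ennreal ((\<Sum>b<p. merge (?I - ?J) ?J (x, y) (a, b) * pinv k p (merge (?I - ?J) ?J (x, y)) i b)\<^sup>2)
        \<partial>gauss ?J \<partial>gauss (?I - ?J))"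
    by (rule nn_integral_gauss_fold[OF _ JI meas]) simp
  also have "\<dots> = (\<integral>\<^sup>+x. \<integral>\<^sup>+y. ennreal ((0 + (\<Sum>r\<in>?J. y r * pinv k p x i (snd r)))\<^sup>2) \<partial>gauss ?J \<partial>gauss (?I - ?J))"
  proof (intro nn_integral_cong arg_cong[where f = ennreal] arg_cong[where f = "\<lambda>x. x\<^sup>2"])
    fix x y :: "nat \<times> nat \<Rightarrow> real"
    have "merge (?I - ?J) ?J (x, y) (a, b) = y (a, b)" if "b < p" for b
      using that by (simp add: merge_def)
    then show "(\<Sum>b<p. merge (?I - ?J) ?J (x, y) (a, b) * pinv k p (merge (?I - ?J) ?J (x, y)) i b) =
        0 + (\<Sum>r\<in>?J. y r * pinv k p x i (snd r))"
      unfolding sum_J by (simp add: pinv_merge)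
  qed
  also have "\<dots> = (\<integral>\<^sup>+x. ennreal (\<Sum>b<p. (pinv k p x i b)\<^sup>2) \<partial>gauss (?I - ?J))"
    by (subst nn_integral_gauss_linear_square) (simp_all add: sum_J)
  \<comment> \<open>The integrand is constant in \<open>y\<close> and \<open>gauss ?J\<close> is a
    probability measure; restoring the inner integral allows the splitting to be undone.\<close>
  also have "\<dots> = (\<integral>\<^sup>+x. \<integral>\<^sup>+y. ennreal (\<Sum>b<p. (pinv k p (merge (?I - ?J) ?J (x, y)) i b)\<^sup>2) \<partial>gauss ?J \<partial>gauss (?I - ?J))"
    using prob_space.emeasure_space_1[OF prob_space_gauss, of ?J] by (simp add: pinv_merge)
  also have "\<dots> = (\<integral>\<^sup>+\<omega>. ennreal (\<Sum>b<p. (pinv k p \<omega> i b)\<^sup>2) \<partial>gauss ?I)"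
    by (rule nn_integral_gauss_fold[OF _ JI meas', symmetric]) simp
  also have "\<dots> \<le> ennreal (1 / (real s - 1))"
    unfolding p_def by (rule nn_integral_pinv_norm) (use a i s in auto)
  finally show ?thesis .
qed

text \<open>Expansion along the last row: the determinant is affine in the corner entry, with the
  next smaller leading minor as slope.\<close>

lemma det_leading_minor_affine:
  fixes \<omega> \<omega>' :: "nat \<times> nat \<Rightarrow> real"
  assumes "\<And>a b. (a, b) \<noteq> (j, j) \<Longrightarrow> \<omega> (a, b) = \<omega>' (a, b)"
  shows "Determinant.det (Matrix.mat (Suc j) (Suc j) \<omega>) - Determinant.det (Matrix.mat (Suc j) (Suc j) \<omega>') =
    (\<omega> (j, j) - \<omega>' (j, j)) * Determinant.det (Matrix.mat j j \<omega>)"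
proof -
  let ?A = "\<lambda>\<omega>. Matrix.mat (Suc j) (Suc j) \<omega>"
  have cof: "cofactor (?A \<omega>) j b = cofactor (?A \<omega>') j b" if "b < Suc j" for b
  proof -
    have "mat_delete (?A \<omega>) j b = mat_delete (?A \<omega>') j b"
      unfolding mat_delete_def using assms by (intro cong_mat) auto
    then show ?thesis by (simp add: cofactor_def)
  qed
  have jj: "cofactor (?A \<omega>') j j = Determinant.det (Matrix.mat j j \<omega>)"
  proof -
    have "mat_delete (?A \<omega>') j j = Matrix.mat j j \<omega>"
      unfolding mat_delete_def using assms by (intro eq_matI) auto
    then show ?thesis by (simp add: cofactor_def)
  qed
  have "Determinant.det (?A \<omega>) - Determinant.det (?A \<omega>') =
      (\<Sum>b<Suc j. ?A \<omega> $$ (j, b) * cofactor (?A \<omega>') j b - ?A \<omega>' $$ (j, b) * cofactor (?A \<omega>') j b)"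
    by (subst (1 2) laplace_expansion_row[of _ "Suc j" j]) (auto simp: cof sum_subtractf[symmetric] intro!: sum.cong)
  also have "\<dots> = (\<Sum>b<Suc j. if b = j then (\<omega> (j, j) - \<omega>' (j, j)) * cofactor (?A \<omega>') j j else 0)"
    using assms by (intro sum.cong) (auto simp: left_diff_distrib)
  also have "\<dots> = (\<omega> (j, j) - \<omega>' (j, j)) * Determinant.det (Matrix.mat j j \<omega>)"
    unfolding jj[symmetric] by (subst sum.delta) auto
  finally show ?thesis .
qed

text \<open>Freeze all entries except the new corner. If the smaller minor is nonzero, the affine
  dependence leaves at most one corner value with vanishing determinant, and a single point has
  measure zero.\<close>

lemma AE_det_leading_minor_nonzero:
  assumes "k \<le> n" "k \<le> p"
  shows "AE \<omega> :: nat \<times> nat \<Rightarrow> real in gauss ({..<n} \<times> {..<p}). Determinant.det (Matrix.mat k k \<omega>) \<noteq> 0"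
  using assms
proof (induction k)
  case 0
  then show ?case by (auto simp: det_dim_zero)
next
  case (Suc j)
  let ?I = "{..<n} \<times> {..<p}"
  let ?B = "\<Pi>\<^sub>M i\<in>?I. borel :: real measure"
  let ?d = "\<lambda>j (\<omega> :: nat \<times> nat \<Rightarrow> real). Determinant.det (Matrix.mat j j \<omega>)"
  have I: "(j, j) \<in> ?I" using Suc.prems by auto
  have d_meas: "?d i \<in> borel_measurable ?B" if "i \<le> Suc j" for i
    using that Suc.prems by (intro measurable_det[of _ i]) (auto intro!: measurable_component_singleton)
  define N where "N = {\<omega> \<in> extensional ?I. ?d j \<omega> \<noteq> 0 \<and> ?d (Suc j) \<omega> = 0}"
  have N: "N \<in> sets ?B"
  proof -
    have "N = {\<omega> \<in> space ?B. ?d j \<omega> \<noteq> 0} \<inter> {\<omega> \<in> space ?B. ?d (Suc j) \<omega> = 0}"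
      by (auto simp: N_def space_PiM PiE_def)
    then show ?thesis using d_meas[of j] d_meas[of "Suc j"] by simp
  qed
  have "emeasure (gauss ?I) N = (\<integral>\<^sup>+\<omega>. indicator N \<omega> \<partial>gauss ?I)"
    using N by simp
  also have "\<dots> = (\<integral>\<^sup>+x. \<integral>\<^sup>+y. indicator N (merge (?I - {(j, j)}) {(j, j)} (x, y)) \<partial>gauss {(j, j)} \<partial>gauss (?I - {(j, j)}))"
    using I N by (intro nn_integral_gauss_fold) auto
  also have "\<dots> = (\<integral>\<^sup>+x. 0 \<partial>gauss (?I - {(j, j)}))"
  proof (rule nn_integral_cong)
    fix x :: "nat \<times> nat \<Rightarrow> real"
    let ?m = "\<lambda>z. merge (?I - {(j, j)}) {(j, j)} (x, \<lambda>i\<in>{(j, j)}. z)"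
    define S where "S = {z. ?m z \<in> N}"
    have "\<exists>z0. S \<subseteq> {z0 :: real}"
    proof (cases "S = {}")
      case False
      then obtain z0 where z0: "z0 \<in> S" by auto
      have "z = z0" if z: "z \<in> S" for z
      proof -
        have "?d (Suc j) (?m z) - ?d (Suc j) (?m z0) = (?m z (j, j) - ?m z0 (j, j)) * ?d j (?m z)"
          by (rule det_leading_minor_affine) (auto simp: merge_def)
        moreover have "?m z (j, j) = z" "?m z0 (j, j) = z0" by (simp_all add: merge_def)
        ultimately show ?thesis using z z0 by (simp add: S_def N_def)
      qed
      then show ?thesis by auto
    qed auto
    then obtain z0 where S: "S \<subseteq> {z0}" by auto
    then have S_borel: "S \<in> sets borel" by (meson finite.emptyI finite_insert finite_subset borel_closed finite_imp_closed)
    have "(\<integral>\<^sup>+y. indicator N (merge (?I - {(j, j)}) {(j, j)} (x, y)) \<partial>gauss {(j, j)}) = (\<integral>\<^sup>+y. indicator S (y (j, j)) \<partial>gauss {(j, j)})"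
    proof (rule nn_integral_cong)
      fix y :: "nat \<times> nat \<Rightarrow> real" assume "y \<in> space (gauss {(j, j)})"
      then have "y = (\<lambda>i\<in>{(j, j)}. y (j, j))" by (auto simp: extensional_def)
      then show "(indicator N (merge (?I - {(j, j)}) {(j, j)} (x, y)) :: ennreal) = indicator S (y (j, j))"
        by (simp add: S_def indicator_def)
    qed
    also have "\<dots> = (\<integral>\<^sup>+z. indicator S z \<partial>std_normal)"
      unfolding gauss_def using S_borel by (intro gauss.product_nn_integral_singleton) simp
    also have "\<dots> = (\<integral>\<^sup>+z. ennreal (std_normal_density z) * indicator S z \<partial>lborel)"
      using S_borel by (intro nn_integral_std_normal) simp
    also have "\<dots> = (\<integral>\<^sup>+z. 0 \<partial>(lborel :: real measure))"
    proof (rule nn_integral_cong_AE)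
      show "AE z in lborel. ennreal (std_normal_density z) * indicator S z = 0"
        using AE_lborel_singleton[of z0] by eventually_elim (use S in \<open>auto simp: indicator_def\<close>)
    qed
    finally show "(\<integral>\<^sup>+y. indicator N (merge (?I - {(j, j)}) {(j, j)} (x, y)) \<partial>gauss {(j, j)}) = 0" by simp
  qed
  finally have "emeasure (gauss ?I) N = 0" by simp
  then have "AE \<omega> in gauss ?I. \<omega> \<notin> N" using N by (intro AE_not_in null_setsI) auto
  moreover have "AE \<omega> in gauss ?I. ?d j \<omega> \<noteq> 0" using Suc by simp
  moreover have "AE \<omega> in gauss ?I. \<omega> \<in> space (gauss ?I)" by (rule AE_space)
  ultimately show ?case by eventually_elim (auto simp: N_def)
qed

text \<open>For a kernel vector \<open>v\<close> of the Gram matrix the quadratic form is the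
  squared length of the combination of rows with coefficients \<open>v\<close>. So that combination
  vanishes, in particular in the first \<open>k\<close> columns, against the regularity of the
  leading minor.\<close>

lemma det_gram_rows_nonzero:
  assumes det: "Determinant.det (Matrix.mat k k \<omega>) \<noteq> 0" and p: "k \<le> p"
  shows "Determinant.det (gram_rows k p \<omega>) \<noteq> 0"
proof
  assume "Determinant.det (gram_rows k p \<omega>) = 0"
  then obtain v where v: "v \<in> carrier_vec k" "v \<noteq> 0\<^sub>v k" "gram_rows k p \<omega> *\<^sub>v v = 0\<^sub>v k"
    using det_0_iff_vec_prod_zero[OF gram_rows_carrier] by auto
  have row: "(\<Sum>c<k. gram_rows k p \<omega> $$ (a, c) * v $ c) = 0" if "a < k" for a
    using arg_cong[OF v(3), of "\<lambda>w. w $ a"] that v(1) carrier_matD[OF gram_rows_carrier, of k p \<omega>]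
    by (simp add: scalar_prod_def lessThan_atLeast0)
  have "(\<Sum>b<p. (\<Sum>c<k. v $ c * \<omega> (c, b))\<^sup>2) = (\<Sum>b<p. \<Sum>a<k. \<Sum>c<k. v $ a * (\<omega> (a, b) * \<omega> (c, b) * v $ c))"
    by (simp add: power2_eq_square sum_product mult_ac)
  also have "\<dots> = (\<Sum>a<k. \<Sum>b<p. \<Sum>c<k. v $ a * (\<omega> (a, b) * \<omega> (c, b) * v $ c))"
    by (rule sum.swap)
  also have "\<dots> = (\<Sum>a<k. \<Sum>c<k. \<Sum>b<p. v $ a * (\<omega> (a, b) * \<omega> (c, b) * v $ c))"
    by (intro sum.cong refl sum.swap)
  also have "\<dots> = (\<Sum>a<k. v $ a * (\<Sum>c<k. gram_rows k p \<omega> $$ (a, c) * v $ c))"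
    by (intro sum.cong refl) (simp add: gram_rows_index sum_distrib_left sum_distrib_right mult.assoc)
  also have "\<dots> = 0" by (simp add: row)
  finally have "(\<Sum>c<k. v $ c * \<omega> (c, b)) = 0" if "b < p" for b
    using that by (subst (asm) sum_nonneg_eq_0_iff) auto
  then have "(Matrix.mat k k \<omega>)\<^sup>T *\<^sub>v v = 0\<^sub>v k"
    using v(1) p by (intro eq_vecI) (auto simp: scalar_prod_def lessThan_atLeast0 mult.commute)
  then have "Determinant.det ((Matrix.mat k k \<omega>)\<^sup>T) = 0"
    using v(1,2) det_0_iff_vec_prod_zero[of "(Matrix.mat k k \<omega>)\<^sup>T" k] by auto
  then show False using det by (simp add: det_transpose[of _ k])
qed

text \<open>Each of the \<open>k\<close> columns of the pseudoinverse contributes 1 / (s - 1) to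
  every trailing row; this is the origin of the factor k / (s - 1).\<close>

lemma nn_integral_weighted_rows_pinv:
  fixes c :: "nat \<Rightarrow> real"
  assumes c: "\<And>a. 0 \<le> c a" and k: "k \<le> n" and s: "2 \<le> s"
  defines "p \<equiv> k + s"
  shows "(\<lambda>\<omega>. \<Sum>a=k..<n. \<Sum>i<k. c a * (\<Sum>b<p. \<omega> (a, b) * pinv k p \<omega> i b)\<^sup>2)
      \<in> borel_measurable (\<Pi>\<^sub>M i\<in>{..<n} \<times> {..<p}. borel)" (is "?f \<in> _")
    and "(\<integral>\<^sup>+\<omega>. ennreal (\<Sum>a=k..<n. \<Sum>i<k. c a * (\<Sum>b<p. \<omega> (a, b) * pinv k p \<omega> i b)\<^sup>2)
      \<partial>gauss ({..<n} \<times> {..<p})) \<le> ennreal (real k / (real s - 1) * (\<Sum>a=k..<n. c a))"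
proof -
  let ?I = "{..<n} \<times> {..<p}"
  let ?g = "\<lambda>a i \<omega>. (\<Sum>b<p. \<omega> (a, b) * pinv k p \<omega> i b)\<^sup>2"
  have g: "?g a i \<in> borel_measurable (\<Pi>\<^sub>M i\<in>?I. borel)" if "a < n" "i < k" for a i
    using that k
    by (intro borel_measurable_power borel_measurable_sum borel_measurable_times measurable_pinv measurable_component_singleton) auto
  then show "?f \<in> borel_measurable (\<Pi>\<^sub>M i\<in>?I. borel)"
    by (intro borel_measurable_sum borel_measurable_times) auto
  have "(\<integral>\<^sup>+\<omega>. ennreal (?f \<omega>) \<partial>gauss ?I) = (\<integral>\<^sup>+\<omega>. (\<Sum>a=k..<n. \<Sum>i<k. ennreal (c a) * ennreal (?g a i \<omega>)) \<partial>gauss ?I)"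
    by (intro nn_integral_cong) (simp add: c sum_nonneg ennreal_mult'[symmetric] flip: sum_ennreal)
  also have "\<dots> = (\<Sum>a=k..<n. \<Sum>i<k. ennreal (c a) * (\<integral>\<^sup>+\<omega>. ennreal (?g a i \<omega>) \<partial>gauss ?I))"
  proof -
    have gm: "(\<lambda>\<omega>. ennreal (?g a i \<omega>)) \<in> borel_measurable (gauss ?I)" if "a \<in> {k..<n}" "i \<in> {..<k}" for a i
      using measurable_compose[OF g measurable_ennreal, of a i] that by (simp cong: measurable_cong_sets)
    have "(\<integral>\<^sup>+\<omega>. (\<Sum>a=k..<n. \<Sum>i<k. ennreal (c a) * ennreal (?g a i \<omega>)) \<partial>gauss ?I) =
        (\<Sum>a=k..<n. \<integral>\<^sup>+\<omega>. (\<Sum>i<k. ennreal (c a) * ennreal (?g a i \<omega>)) \<partial>gauss ?I)"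
      by (intro nn_integral_sum borel_measurable_sum borel_measurable_times_ennreal borel_measurable_const gm)
    also have "\<dots> = (\<Sum>a=k..<n. \<Sum>i<k. \<integral>\<^sup>+\<omega>. ennreal (c a) * ennreal (?g a i \<omega>) \<partial>gauss ?I)"
      by (intro sum.cong refl nn_integral_sum borel_measurable_times_ennreal borel_measurable_const gm)
    also have "\<dots> = (\<Sum>a=k..<n. \<Sum>i<k. ennreal (c a) * (\<integral>\<^sup>+\<omega>. ennreal (?g a i \<omega>) \<partial>gauss ?I))"
      by (intro sum.cong refl nn_integral_cmult gm)
    finally show ?thesis .
  qed
  also have "\<dots> \<le> (\<Sum>a=k..<n. \<Sum>i<k. ennreal (c a) * ennreal (1 / (real s - 1)))"
    unfolding p_def using k s by (intro sum_mono mult_left_mono nn_integral_row_pinv) auto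
  also have "\<dots> = ennreal (\<Sum>a=k..<n. \<Sum>i<k. c a * (1 / (real s - 1)))"
  proof -
    have "ennreal (c a) * ennreal (1 / (real s - 1)) = ennreal (c a * (1 / (real s - 1)))" for a
      using c s by (intro ennreal_mult[symmetric]) auto
    then show ?thesis using c s by (simp add: sum_ennreal sum_nonneg del: sum_constant times_divide_eq_right)
  qed
  also have "(\<Sum>a=k..<n. \<Sum>i<k. c a * (1 / (real s - 1))) = real k / (real s - 1) * (\<Sum>a=k..<n. c a)"
    by (simp add: sum_distrib_left sum_divide_distrib)
  finally show "(\<integral>\<^sup>+\<omega>. ennreal (?f \<omega>) \<partial>gauss ?I) \<le> ennreal (real k / (real s - 1) * (\<Sum>a=k..<n. c a))" .
qed

section \<open>The law of a rotated Gaussian matrix\<close>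

lemma distr_gauss_orthogonal:
  fixes K :: "'i \<Rightarrow> 'i \<Rightarrow> real"
  assumes I: "finite I"
    and rows: "\<And>i j. i \<in> I \<Longrightarrow> j \<in> I \<Longrightarrow> (\<Sum>k\<in>I. K i k * K j k) = (if i = j then 1 else 0)"
    and cols: "\<And>i j. i \<in> I \<Longrightarrow> j \<in> I \<Longrightarrow> (\<Sum>k\<in>I. K k i * K k j) = (if i = j then 1 else 0)"
  shows "distr (gauss I) (\<Pi>\<^sub>M i\<in>I. borel) (lin K I) = gauss I"
proof (rule measure_eqI)
  fix A assume "A \<in> sets (distr (gauss I) (\<Pi>\<^sub>M i\<in>I. borel) (lin K I))"
  then have A: "A \<in> sets (\<Pi>\<^sub>M i\<in>I. borel)" by simp
  have m: "lin K I \<in> measurable (gauss I) (\<Pi>\<^sub>M i\<in>I. borel)" using I by measurable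
  have "emeasure (distr (gauss I) (\<Pi>\<^sub>M i\<in>I. borel) (lin K I)) A = (\<integral>\<^sup>+x. indicator A (lin K I x) \<partial>gauss I)"
    using A m by (subst nn_integral_distr[OF m, symmetric]) auto
  also have "\<dots> = (\<integral>\<^sup>+x. indicator A x \<partial>gauss I)"
    using A by (intro nn_integral_gauss_orthogonal[OF I _ rows cols]) auto
  finally show "emeasure (distr (gauss I) (\<Pi>\<^sub>M i\<in>I. borel) (lin K I)) A = emeasure (gauss I) A"
    using A by simp
qed simp

lemma (in prob_space) distr_indep_std_normal:
  assumes indep: "indep_vars (\<lambda>_. borel) X I" and I: "I \<noteq> {}"
    and X: "\<And>i. i \<in> I \<Longrightarrow> distributed M lborel (X i) std_normal_density"
  shows "distr M (\<Pi>\<^sub>M i\<in>I. borel) (\<lambda>\<omega>. \<lambda>i\<in>I. X i \<omega>) = gauss I"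
proof -
  have rv: "random_variable borel (X i)" if "i \<in> I" for i
    using indep that by (auto simp: indep_vars_def)
  have "distr M (\<Pi>\<^sub>M i\<in>I. borel) (\<lambda>\<omega>. \<lambda>i\<in>I. X i \<omega>) = (\<Pi>\<^sub>M i\<in>I. distr M borel (X i))"
    using indep_vars_iff_distr_eq_PiM'[OF I rv] indep by simp
  also have "\<dots> = gauss I"
    unfolding gauss_def
  proof (rule PiM_cong[OF refl])
    fix i assume "i \<in> I"
    have "distr M borel (X i) = distr M lborel (X i)" by (rule distr_cong) auto
    also have "\<dots> = std_normal"
      using distributed_distr_eq_density[OF X[OF \<open>i \<in> I\<close>]] by (simp add: std_normal_def)
    finally show "distr M borel (X i) = std_normal" .
  qed
  finally show ?thesis .
qed

lemma (in prob_space) distr_rotated_gaussian_matrix: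
  fixes V :: "real mat" and X :: "nat \<times> nat \<Rightarrow> 'a \<Rightarrow> real"
  assumes V: "V \<in> carrier_mat n n" "V\<^sup>T * V = 1\<^sub>m n" and np: "0 < n" "0 < p"
    and indep: "indep_vars (\<lambda>_. borel) X ({..<n} \<times> {..<p})"
    and X: "\<And>i. i \<in> {..<n} \<times> {..<p} \<Longrightarrow> distributed M lborel (X i) std_normal_density"
  defines "\<Phi> \<equiv> \<lambda>\<omega>. \<lambda>(a, b)\<in>{..<n} \<times> {..<p}. \<Sum>c<n. V $$ (c, a) * X (c, b) \<omega>"
  shows "\<Phi> \<in> measurable M (\<Pi>\<^sub>M i\<in>{..<n} \<times> {..<p}. borel)"
    and "distr M (\<Pi>\<^sub>M i\<in>{..<n} \<times> {..<p}. borel) \<Phi> = gauss ({..<n} \<times> {..<p})"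
proof -
  let ?I = "{..<n} \<times> {..<p}"
  let ?B = "\<Pi>\<^sub>M i\<in>?I. borel :: real measure"
  \<comment> \<open>Multiplication by V^T from the left, seen as a kernel on pairs of indices. It
    mixes only entries of one column and is orthogonal because \<open>V\<close> is.\<close>
  let ?K = "\<lambda>(a, b) (c, d). if b = d then V $$ (c, a) else 0"
  let ?X = "\<lambda>\<omega>. \<lambda>i\<in>?I. X i \<omega>"
  have rv: "random_variable borel (X i)" if "i \<in> ?I" for i
    using indep that by (auto simp: indep_vars_def)
  have mX: "?X \<in> measurable M ?B" using rv by (intro measurable_restrict) auto
  have sum_I: "(\<Sum>i\<in>?I. f i) = (\<Sum>c<n. \<Sum>d<p. f (c, d))" for f :: "nat \<times> nat \<Rightarrow> real"
    by (simp add: sum.cartesian_product)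
  have \<Phi>: "\<Phi> = (\<lambda>\<omega>. lin ?K ?I (?X \<omega>))"
  proof (intro ext)
    fix \<omega> and i :: "nat \<times> nat"
    obtain a b where i: "i = (a, b)" by (cases i)
    show "\<Phi> \<omega> i = lin ?K ?I (?X \<omega>) i"
    proof (cases "i \<in> ?I")
      case True
      then have "(\<Sum>c<n. \<Sum>d<p. ?K (a, b) (c, d) * ?X \<omega> (c, d)) = (\<Sum>c<n. \<Sum>d<p. if d = b then V $$ (c, a) * X (c, b) \<omega> else 0)"
        by (intro sum.cong) auto
      then show ?thesis
        using True unfolding \<Phi>_def lin_def sum_I by (simp add: i)
    qed (simp add: \<Phi>_def lin_def)
  qed
  have rot: "distr (gauss ?I) ?B (lin ?K ?I) = gauss ?I"
  proof (rule distr_gauss_orthogonal)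
    fix i j assume ij: "i \<in> ?I" "j \<in> ?I"
    obtain a b a' b' where e: "i = (a, b)" "j = (a', b')" by (cases i, cases j)
    have lt: "a < n" "b < p" "a' < n" "b' < p" using ij e by auto
    have "(\<Sum>k\<in>?I. ?K i k * ?K j k) = (\<Sum>c<n. \<Sum>d<p. if d = b then (if b = b' then V $$ (c, a) * V $$ (c, a') else 0) else 0)"
      unfolding sum_I e by (intro sum.cong) auto
    also have "\<dots> = (if b = b' then \<Sum>c<n. V $$ (c, a) * V $$ (c, a') else 0)"
      using lt by simp
    finally show "(\<Sum>k\<in>?I. ?K i k * ?K j k) = (if i = j then 1 else 0)"
      using lt by (simp add: orthogonal_mat_sums(1)[OF V] e)
    have "(\<Sum>k\<in>?I. ?K k i * ?K k j) = (\<Sum>c<n. \<Sum>d<p. if d = b then (if b = b' then V $$ (a, c) * V $$ (a', c) else 0) else 0)"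
      unfolding sum_I e by (intro sum.cong) auto
    also have "\<dots> = (if b = b' then \<Sum>c<n. V $$ (a, c) * V $$ (a', c) else 0)"
      using lt by simp
    finally show "(\<Sum>k\<in>?I. ?K k i * ?K k j) = (if i = j then 1 else 0)"
      using lt by (simp add: orthogonal_mat_sums(2)[OF V] e)
  qed simp
  have ml: "lin ?K ?I \<in> measurable ?B ?B" by measurable
  show "\<Phi> \<in> measurable M ?B"
    unfolding \<Phi> by (rule measurable_compose[OF mX ml])
  have "distr M ?B \<Phi> = distr (distr M ?B ?X) ?B (lin ?K ?I)"
    unfolding \<Phi> by (subst distr_distr[OF ml mX]) (simp add: comp_def)
  also have "distr M ?B ?X = gauss ?I"
    using np by (intro distr_indep_std_normal[OF indep _ X]) auto
  finally show "distr M ?B \<Phi> = gauss ?I" unfolding rot .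
qed

section \<open>Tensors and the transform\<close>

lemma mult_add_less: "x * q + y < p * q" if "x < p" "y < q" for x y p q :: nat
proof -
  have "x * q + y < Suc x * q" using that(2) by simp
  also have "\<dots> \<le> p * q" using that(1) by (intro mult_le_mono1) simp
  finally show ?thesis .
qed

text \<open>Kronecker products, stacked columns and blocks all address flat indices by quotient and
  remainder; this converts such sums into double sums.\<close>

lemma sum_div_mod: "(\<Sum>i<p * q. g (i div q) (i mod q)) = (\<Sum>a<p. \<Sum>b<q. g a b)" for g :: "nat \<Rightarrow> nat \<Rightarrow> real"
proof -
  have "0 < q" if "i < p * q" for i using that by (cases q) auto
  then show ?thesis
    unfolding sum.cartesian_product
    by (intro sum.reindex_bij_witness[of _ "\<lambda>(a, b). a * q + b" "\<lambda>i. (i div q, i mod q)"])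
      (auto simp: less_mult_imp_div_less mult_add_less)
qed

lemma tensorsD:
  assumes "X \<in> tensors p r l"
  shows "length X = l" and "j < l \<Longrightarrow> X ! j \<in> carrier_mat p r"
    and "0 < l \<Longrightarrow> t_rows X = p" and "0 < l \<Longrightarrow> t_cols X = r"
proof -
  show l: "length X = l" using assms by (simp add: tensors_def)
  show *: "X ! j \<in> carrier_mat p r" if "j < l" for j using assms that by (auto simp: tensors_def)
  have "hd X = X ! 0" if "0 < l" using that l by (intro hd_conv_nth) auto
  then show "t_rows X = p" "t_cols X = r" if "0 < l" using *[OF that] that by simp_all
qed

lemma tensorsI:
  assumes "length X = l" "\<And>j. j < l \<Longrightarrow> X ! j \<in> carrier_mat p r"
  shows "X \<in> tensors p r l"
  using assms by (auto simp: tensors_def in_set_conv_nth)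

lemma tensor_eqI:
  assumes "X \<in> tensors p r l" "Y \<in> tensors p r l"
    and "\<And>j a b. j < l \<Longrightarrow> a < p \<Longrightarrow> b < r \<Longrightarrow> X ! j $$ (a, b) = Y ! j $$ (a, b)"
  shows "X = Y"
proof (rule nth_equalityI)
  fix j assume "j < length X"
  then have j: "j < l" using tensorsD(1)[OF assms(1)] by simp
  show "X ! j = Y ! j"
    using tensorsD(2)[OF assms(1) j] tensorsD(2)[OF assms(2) j] assms(3)[OF j] by (intro eq_matI) auto
qed (use tensorsD(1)[OF assms(1)] tensorsD(1)[OF assms(2)] in simp)

lemma t_complex_dims:
  assumes "X \<in> tensors p r l" "0 < l"
  shows "t_rows (t_complex X) = p" "t_cols (t_complex X) = r"
  using tensorsD[OF assms(1)] assms(2) by (auto simp: t_complex_def hd_map)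

lemma transform_tensors:
  assumes "X \<in> tensors p r l" "L \<in> carrier_mat l l" "0 < l"
  shows "transform L X \<in> tensors p r l"
  using assms(2) t_complex_dims[OF assms(1,3)]
  by (intro tensorsI) (auto simp: transform_def mode3_product_def)

lemma transform_index:
  assumes X: "X \<in> tensors p r l" and L: "L \<in> carrier_mat l l" and "j < l" "a < p" "b < r"
  shows "transform L X ! j $$ (a, b) = (\<Sum>j'<l. Re (L $$ (j, j')) * X ! j' $$ (a, b))"
proof -
  have "t_rows (t_complex X) = p" "t_cols (t_complex X) = r"
    using t_complex_dims[OF X] assms(3) by auto
  moreover have "t_complex X ! j' $$ (a, b) = complex_of_real (X ! j' $$ (a, b))" if "j' < l" for j'
    using tensorsD(2)[OF X that] tensorsD(1)[OF X] that assms(4,5) by (simp add: t_complex_def)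
  ultimately show ?thesis
    using assms tensorsD(1)[OF X] by (simp add: transform_def mode3_product_def t_complex_def)
qed

text \<open>The columns of \<open>L\<close> are the images of tubes with a single 1, which are real
  tensors.\<close>

lemma maps_real_to_real_imp_real:
  assumes "maps_real_to_real L" and L: "L \<in> carrier_mat l l" and j: "j < l" "j' < l"
  shows "Im (L $$ (j, j')) = 0"
proof -
  define X where "X = map (\<lambda>i. Matrix.mat 1 1 (\<lambda>_. if i = j' then 1 else 0 :: real)) [0..<l]"
  have "X \<in> tensors 1 1 (dim_col L)" using L by (auto simp: X_def tensors_def)
  then obtain Y where Y: "Y \<in> tensors 1 1 (dim_row L)" "t_complex X \<times>\<^sub>3 L = t_complex Y"
    using assms(1) unfolding maps_real_to_real_def by blast
  have "(t_complex X \<times>\<^sub>3 L) ! j $$ (0, 0) = (\<Sum>i<l. L $$ (j, i) * complex_of_real (if i = j' then 1 else 0))"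
    using j L by (simp add: mode3_product_def t_complex_def X_def hd_map)
  also have "\<dots> = L $$ (j, j')" using j by (simp add: if_distrib[of complex_of_real] if_distrib[of "\<lambda>x. _ * x"] cong: if_cong)
  finally have "L $$ (j, j') = t_complex Y ! j $$ (0, 0)" by (simp add: Y(2))
  also have "\<dots> = complex_of_real (Y ! j $$ (0, 0))"
    using tensorsD(1)[OF Y(1)] tensorsD(2)[OF Y(1), of j] j L by (simp add: t_complex_def)
  finally show ?thesis by simp
qed

lemma mat_adjoint_index:
  fixes A :: "complex mat"
  assumes "A \<in> carrier_mat m n" "i < n" "j < m"
  shows "mat_adjoint A $$ (i, j) = cnj (A $$ (j, i))"
  using assms by (simp add: mat_adjoint_def mat_of_rows_def)

text \<open>With \<open>l\<close> positive there is a first slice, from which \<open>t_rows\<close>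
  and \<open>t_cols\<close> read the dimensions. The last assumption pins down the value hidden in
  the option type of \<open>mat_inverse\<close>.\<close>

locale scaled_unitary_transform =
  fixes L :: "complex mat" and l :: nat and \<rho> :: real
  assumes L: "L \<in> carrier_mat l l" and l: "0 < l" and real: "maps_real_to_real L" and \<rho>: "0 < \<rho>"
    and adj_L: "mat_adjoint L * L = complex_of_real \<rho> \<cdot>\<^sub>m 1\<^sub>m l"
    and L_adj: "L * mat_adjoint L = complex_of_real \<rho> \<cdot>\<^sub>m 1\<^sub>m l"
    and inv: "the (mat_inverse L) = complex_of_real (1 / \<rho>) \<cdot>\<^sub>m mat_adjoint L"
begin

definition re_L :: "nat \<Rightarrow> nat \<Rightarrow> real" where "re_L i j = Re (L $$ (i, j))"

lemma L_index: "i < l \<Longrightarrow> j < l \<Longrightarrow> L $$ (i, j) = complex_of_real (re_L i j)"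
  using maps_real_to_real_imp_real[OF real L] by (simp add: re_L_def complex_eq_iff)

lemma adjoint_carrier: "mat_adjoint L \<in> carrier_mat l l"
  using L by (auto simp: mat_adjoint_def mat_of_rows_def)

lemma columns_orthogonal:
  assumes "i < l" "j < l"
  shows "(\<Sum>k<l. re_L k i * re_L k j) = (if i = j then \<rho> else 0)"
proof -
  have "complex_of_real (\<Sum>k<l. re_L k i * re_L k j) = (mat_adjoint L * L) $$ (i, j)"
    using assms by (subst mult_mat_entry[OF adjoint_carrier L]) (simp_all add: mat_adjoint_index[OF L] L_index)
  then show ?thesis using assms unfolding adj_L by (simp add: complex_eq_iff split: if_splits)
qed

lemma rows_orthogonal:
  assumes "i < l" "j < l"
  shows "(\<Sum>k<l. re_L i k * re_L j k) = (if i = j then \<rho> else 0)"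
proof -
  have "complex_of_real (\<Sum>k<l. re_L i k * re_L j k) = (L * mat_adjoint L) $$ (i, j)"
    using assms by (subst mult_mat_entry[OF L adjoint_carrier]) (simp_all add: mat_adjoint_index[OF L] L_index)
  then show ?thesis using assms unfolding L_adj by (simp add: complex_eq_iff split: if_splits)
qed

lemma transform_entry:
  "X \<in> tensors p r l \<Longrightarrow> j < l \<Longrightarrow> a < p \<Longrightarrow> b < r \<Longrightarrow>
    transform L X ! j $$ (a, b) = (\<Sum>j'<l. re_L j j' * X ! j' $$ (a, b))"
  by (simp add: transform_index[OF _ L] re_L_def)

lemma transform_carrier: "X \<in> tensors p r l \<Longrightarrow> transform L X \<in> tensors p r l"
  by (rule transform_tensors[OF _ L l])

lemma inverse_carrier: "the (mat_inverse L) \<in> carrier_mat l l"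
  using adjoint_carrier by (simp add: inv)

lemma inv_transform_carrier: "X \<in> tensors p r l \<Longrightarrow> inv_transform L X \<in> tensors p r l"
  unfolding inv_transform_def by (rule transform_tensors[OF _ inverse_carrier l])

lemma inv_transform_entry:
  assumes "X \<in> tensors p r l" "j < l" "a < p" "b < r"
  shows "inv_transform L X ! j $$ (a, b) = (\<Sum>j'<l. re_L j' j / \<rho> * X ! j' $$ (a, b))"
  unfolding inv_transform_def transform_index[OF assms(1) inverse_carrier assms(2-4)]
  using assms(2) adjoint_carrier
  by (intro sum.cong refl) (simp add: inv mat_adjoint_index[OF L] L_index)

lemma transform_inv_transform:
  assumes X: "X \<in> tensors p r l"
  shows "transform L (inv_transform L X) = X"
proof (rule tensor_eqI[OF transform_carrier[OF inv_transform_carrier[OF X]] X])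
  fix j a b assume j: "j < l" and ab: "a < p" "b < r"
  have "transform L (inv_transform L X) ! j $$ (a, b) =
      (\<Sum>j'<l. \<Sum>i<l. re_L j j' * (re_L i j' / \<rho> * X ! i $$ (a, b)))"
    using j ab by (simp add: transform_entry[OF inv_transform_carrier[OF X]] inv_transform_entry[OF X] sum_distrib_left)
  also have "\<dots> = (\<Sum>i<l. (\<Sum>j'<l. re_L j j' * re_L i j') / \<rho> * X ! i $$ (a, b))"
    by (subst sum.swap, intro sum.cong refl) (simp add: sum_distrib_right sum_divide_distrib mult.assoc)
  also have "\<dots> = (\<Sum>i<l. if i = j then X ! j $$ (a, b) else 0)"
    using j \<rho> by (intro sum.cong) (auto simp: rows_orthogonal)
  finally show "transform L (inv_transform L X) ! j $$ (a, b) = X ! j $$ (a, b)" using j by simp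
qed

text \<open>Parseval's identity on every tube, the columns of \<open>L\<close> being orthogonal of
  squared length \<rho>. This is the only source of the factor 1 / \<rho> in the error
  bound.\<close>

lemma frobenius_norm_transform:
  assumes X: "X \<in> tensors p r l"
  shows "(frobenius_norm X)\<^sup>2 = (\<Sum>j<l. fro (transform L X ! j)) / \<rho>"
proof -
  note TX = transform_carrier[OF X]
  have "(\<Sum>j<l. fro (transform L X ! j)) = (\<Sum>j<l. \<Sum>a<p. \<Sum>b<r. (transform L X ! j $$ (a, b))\<^sup>2)"
  proof (rule sum.cong[OF refl])
    fix j assume "j \<in> {..<l}"
    then have "transform L X ! j \<in> carrier_mat p r" using tensorsD(2)[OF TX] by simp
    then show "fro (transform L X ! j) = (\<Sum>a<p. \<Sum>b<r. (transform L X ! j $$ (a, b))\<^sup>2)"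
      by (simp add: fro_def)
  qed
  also have "\<dots> = (\<Sum>a<p. \<Sum>j<l. \<Sum>b<r. (transform L X ! j $$ (a, b))\<^sup>2)"
    by (rule sum.swap)
  also have "\<dots> = (\<Sum>a<p. \<Sum>b<r. \<Sum>j<l. (transform L X ! j $$ (a, b))\<^sup>2)"
    by (intro sum.cong refl sum.swap)
  also have "\<dots> = (\<Sum>a<p. \<Sum>b<r. \<Sum>j<l. \<rho> * (X ! j $$ (a, b))\<^sup>2)"
  proof (rule sum.cong[OF refl], rule sum.cong[OF refl])
    fix a b assume ab: "a \<in> {..<p}" "b \<in> {..<r}"
    let ?x = "\<lambda>j. X ! j $$ (a, b)"
    have "(\<Sum>j<l. (transform L X ! j $$ (a, b))\<^sup>2) = (\<Sum>j<l. \<Sum>i<l. \<Sum>i'<l. re_L j i * re_L j i' * (?x i * ?x i'))"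
      using ab by (simp add: transform_entry[OF X] power2_eq_square sum_product mult_ac)
    also have "\<dots> = (\<Sum>i<l. \<Sum>j<l. \<Sum>i'<l. re_L j i * re_L j i' * (?x i * ?x i'))"
      by (rule sum.swap)
    also have "\<dots> = (\<Sum>i<l. \<Sum>i'<l. \<Sum>j<l. re_L j i * re_L j i' * (?x i * ?x i'))"
      by (intro sum.cong refl sum.swap)
    also have "\<dots> = (\<Sum>i<l. \<Sum>i'<l. if i' = i then \<rho> * (?x i)\<^sup>2 else 0)"
      by (intro sum.cong refl) (auto simp: sum_distrib_right[symmetric] columns_orthogonal power2_eq_square)
    finally show "(\<Sum>j<l. (transform L X ! j $$ (a, b))\<^sup>2) = (\<Sum>j<l. \<rho> * (?x j)\<^sup>2)" by simp
  qed
  also have "\<dots> = \<rho> * (\<Sum>a<p. \<Sum>b<r. \<Sum>j<l. (X ! j $$ (a, b))\<^sup>2)"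
    by (simp add: sum_distrib_left)
  also have "(\<Sum>a<p. \<Sum>b<r. \<Sum>j<l. (X ! j $$ (a, b))\<^sup>2) = (\<Sum>a<p. \<Sum>j<l. \<Sum>b<r. (X ! j $$ (a, b))\<^sup>2)"
    by (intro sum.cong refl sum.swap)
  also have "\<dots> = (\<Sum>j<l. \<Sum>a<p. \<Sum>b<r. (X ! j $$ (a, b))\<^sup>2)"
    by (rule sum.swap)
  also have "\<dots> = (frobenius_norm X)\<^sup>2"
    using tensorsD[OF X] l unfolding frobenius_norm_def by (subst real_sqrt_pow2) (auto intro!: sum_nonneg)
  finally have "(\<Sum>j<l. fro (transform L X ! j)) = \<rho> * (frobenius_norm X)\<^sup>2" .
  then show ?thesis using \<rho> by simp
qed

end

section \<open>Block diagonal matrices, Kronecker products and tensor products\<close>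

lemma diag_block_mat_carrier:
  assumes "set As \<subseteq> carrier_mat p r"
  shows "diag_block_mat As \<in> carrier_mat (length As * p) (length As * r)"
  using assms by (induction As) (auto simp: Let_def)

lemma diag_block_mat_mult:
  fixes As Bs :: "'a :: comm_semiring_1 mat list"
  assumes "length As = length Bs" "set As \<subseteq> carrier_mat p r" "set Bs \<subseteq> carrier_mat r w"
  shows "diag_block_mat As * diag_block_mat Bs = diag_block_mat (map2 (*) As Bs)"
  using assms
proof (induction As Bs rule: list_induct2)
  case (Cons A As B Bs)
  let ?n = "length As"
  have A: "A \<in> carrier_mat p r" and B: "B \<in> carrier_mat r w" using Cons.prems by auto
  have As: "diag_block_mat As \<in> carrier_mat (?n * p) (?n * r)"
    using Cons.prems by (intro diag_block_mat_carrier) auto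
  have Bs: "diag_block_mat Bs \<in> carrier_mat (?n * r) (?n * w)"
    using Cons.prems Cons.hyps diag_block_mat_carrier[of Bs r w] by auto
  have AB: "diag_block_mat As * diag_block_mat Bs = diag_block_mat (map2 (*) As Bs)"
    using Cons by auto
  have "diag_block_mat (A # As) * diag_block_mat (B # Bs) =
      four_block_mat (A * B) (0\<^sub>m p (?n * w)) (0\<^sub>m (?n * p) w) (diag_block_mat As * diag_block_mat Bs)"
    using A B As Bs unfolding diag_block_mat.simps Let_def
    by (subst mult_four_block_mat[of _ p r _ "?n * r" _ "?n * p" _ _ w _ "?n * w"]) auto
  also have "\<dots> = diag_block_mat (map2 (*) (A # As) (B # Bs))"
    using A B As Bs unfolding AB[symmetric] by (simp add: Let_def AB[symmetric])
  finally show ?case .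
qed simp

lemma diag_block_mat_index:
  assumes "set As \<subseteq> carrier_mat p r" "j < length As" "a < p" "b < r"
  shows "diag_block_mat As $$ (j * p + a, j * r + b) = As ! j $$ (a, b)"
  using assms
proof (induction As arbitrary: j)
  case (Cons A As)
  have A: "A \<in> carrier_mat p r" using Cons.prems by auto
  have As: "diag_block_mat As \<in> carrier_mat (length As * p) (length As * r)"
    using Cons.prems by (intro diag_block_mat_carrier) auto
  show ?case
  proof (cases j)
    case 0
    then show ?thesis using A As Cons.prems by (simp add: Let_def)
  next
    case (Suc j')
    then have "diag_block_mat As $$ (j' * p + a, j' * r + b) = As ! j' $$ (a, b)"
      using Cons.prems by (intro Cons.IH) auto
    then show ?thesis
      using Suc A As Cons.prems mult_add_less[of j' "length As" a p] mult_add_less[of j' "length As" b r]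
      by (simp add: Let_def add.assoc)
  qed
qed simp

lemma t_fold_diag_block_mat:
  assumes X: "X \<in> tensors p r l" and l: "0 < l"
  shows "t_fold l (diag_block_mat X) = X"
proof -
  have sX: "set X \<subseteq> carrier_mat p r" "length X = l" using X by (auto simp: tensors_def)
  have "dim_row (diag_block_mat X) div l = p" "dim_col (diag_block_mat X) div l = r"
    using diag_block_mat_carrier[OF sX(1)] l sX(2) by auto
  then show ?thesis
    unfolding t_fold_def Let_def block_def using sX l tensorsD[OF X]
    by (intro tensor_eqI[of _ p r l]) (auto intro!: tensorsI simp: diag_block_mat_index)
qed

lemma kronecker_carrier:
  "A \<in> carrier_mat m n \<Longrightarrow> B \<in> carrier_mat m' n' \<Longrightarrow> A \<otimes>\<^sub>K B \<in> carrier_mat (m * m') (n * n')"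
  by (auto simp: kronecker_def)

lemma kronecker_index:
  "A \<in> carrier_mat m n \<Longrightarrow> B \<in> carrier_mat m' n' \<Longrightarrow> i < m * m' \<Longrightarrow> j < n * n' \<Longrightarrow>
    (A \<otimes>\<^sub>K B) $$ (i, j) = A $$ (i div m', j div n') * B $$ (i mod m', j mod n')"
  by (auto simp: kronecker_def)

lemma kronecker_one: "A \<otimes>\<^sub>K 1\<^sub>m (Suc 0) = A" for A :: "real mat"
  by (rule eq_matI) (auto simp: kronecker_def)

lemma kronecker_mult:
  fixes A B C D :: "real mat"
  assumes A: "A \<in> carrier_mat m n" and B: "B \<in> carrier_mat m' n'"
    and C: "C \<in> carrier_mat n r" and D: "D \<in> carrier_mat n' r'"
  shows "(A \<otimes>\<^sub>K B) * (C \<otimes>\<^sub>K D) = (A * C) \<otimes>\<^sub>K (B * D)"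
proof (rule eq_matI)
  note AB = kronecker_carrier[OF A B] and CD = kronecker_carrier[OF C D]
  have AC: "A * C \<in> carrier_mat m r" and BD: "B * D \<in> carrier_mat m' r'" using A B C D by auto
  note K = kronecker_carrier[OF AC BD]
  fix i j assume "i < dim_row ((A * C) \<otimes>\<^sub>K (B * D))" "j < dim_col ((A * C) \<otimes>\<^sub>K (B * D))"
  then have ij: "i < m * m'" "j < r * r'" using carrier_matD[OF K] by auto
  then have "0 < m'" "0 < r'" by (cases m'; cases r'; simp)+
  then have dm: "i div m' < m" "i mod m' < m'" "j div r' < r" "j mod r' < r'"
    using ij by (auto simp: less_mult_imp_div_less)
  have "((A \<otimes>\<^sub>K B) * (C \<otimes>\<^sub>K D)) $$ (i, j) = (\<Sum>k<n * n'. (A \<otimes>\<^sub>K B) $$ (i, k) * (C \<otimes>\<^sub>K D) $$ (k, j))"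
    by (rule mult_mat_entry[OF AB CD ij])
  also have "\<dots> = (\<Sum>k<n * n'. (A $$ (i div m', k div n') * B $$ (i mod m', k mod n')) *
      (C $$ (k div n', j div r') * D $$ (k mod n', j mod r')))"
    using ij by (intro sum.cong refl) (simp add: kronecker_index[OF A B] kronecker_index[OF C D])
  also have "\<dots> = (\<Sum>x<n. \<Sum>y<n'. (A $$ (i div m', x) * B $$ (i mod m', y)) * (C $$ (x, j div r') * D $$ (y, j mod r')))"
    by (rule sum_div_mod)
  also have "\<dots> = (\<Sum>x<n. A $$ (i div m', x) * C $$ (x, j div r')) * (\<Sum>y<n'. B $$ (i mod m', y) * D $$ (y, j mod r'))"
    unfolding sum_product by (intro sum.cong refl) (simp only: mult_ac)
  also have "\<dots> = ((A * C) \<otimes>\<^sub>K (B * D)) $$ (i, j)"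
    unfolding kronecker_index[OF AC BD ij] mult_mat_entry[OF A C dm(1,3)] mult_mat_entry[OF B D dm(2,4)] ..
  finally show "((A \<otimes>\<^sub>K B) * (C \<otimes>\<^sub>K D)) $$ (i, j) = ((A * C) \<otimes>\<^sub>K (B * D)) $$ (i, j)" .
qed (use assms in \<open>auto simp: kronecker_def\<close>)

context scaled_unitary_transform
begin

lemma t_product_carrier:
  assumes X: "X \<in> tensors p r l" and Y: "Y \<in> tensors r w l"
  shows "t_product L X Y \<in> tensors p w l"
    and "transform L (t_product L X Y) = map2 (*) (transform L X) (transform L Y)"
proof -
  note TX = transform_carrier[OF X] and TY = transform_carrier[OF Y]
  have Z: "map2 (*) (transform L X) (transform L Y) \<in> tensors p w l"
    using tensorsD(1)[OF TX] tensorsD(1)[OF TY] tensorsD(2)[OF TX] tensorsD(2)[OF TY]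
    by (intro tensorsI) (auto intro!: mult_carrier_mat)
  have "diag_block_mat (transform L X) * diag_block_mat (transform L Y) =
      diag_block_mat (map2 (*) (transform L X) (transform L Y))"
    using TX TY by (intro diag_block_mat_mult[of _ _ p r w]) (auto simp: tensors_def)
  then have *: "t_product L X Y = inv_transform L (map2 (*) (transform L X) (transform L Y))"
    unfolding t_product_def using L by (simp add: t_fold_diag_block_mat[OF Z l])
  show "t_product L X Y \<in> tensors p w l"
    unfolding * by (rule inv_transform_carrier[OF Z])
  show "transform L (t_product L X Y) = map2 (*) (transform L X) (transform L Y)"
    unfolding * by (rule transform_inv_transform[OF Z])
qed

lemma transform_kronecker_one:
  assumes X: "X \<in> tensors p r l"
  shows "map (\<lambda>M. M \<otimes>\<^sub>K 1\<^sub>m d) X \<in> tensors (p * d) (r * d) l"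
    and "transform L (map (\<lambda>M. M \<otimes>\<^sub>K 1\<^sub>m d) X) = map (\<lambda>M. M \<otimes>\<^sub>K 1\<^sub>m d) (transform L X)"
proof -
  have K: "map (\<lambda>M. M \<otimes>\<^sub>K 1\<^sub>m d) Z \<in> tensors (p * d) (r * d) l" if "Z \<in> tensors p r l" for Z :: "real tensor"
    using tensorsD(1,2)[OF that] by (intro tensorsI) (auto intro!: kronecker_carrier)
  show XK: "map (\<lambda>M. M \<otimes>\<^sub>K 1\<^sub>m d) X \<in> tensors (p * d) (r * d) l" by (rule K[OF X])
  show "transform L (map (\<lambda>M. M \<otimes>\<^sub>K 1\<^sub>m d) X) = map (\<lambda>M. M \<otimes>\<^sub>K 1\<^sub>m d) (transform L X)"
  proof (rule tensor_eqI[OF transform_carrier[OF XK] K[OF transform_carrier[OF X]]])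
    fix j a b assume j: "j < l" and ab: "a < p * d" "b < r * d"
    then have "0 < d" by (cases d) auto
    then have dm: "a div d < p" "b div d < r" "a mod d < d" "b mod d < d"
      using ab by (auto simp: less_mult_imp_div_less)
    have "transform L (map (\<lambda>M. M \<otimes>\<^sub>K 1\<^sub>m d) X) ! j $$ (a, b) =
        (\<Sum>j'<l. re_L j j' * (X ! j' $$ (a div d, b div d) * 1\<^sub>m d $$ (a mod d, b mod d)))"
      unfolding transform_entry[OF XK j ab]
      using tensorsD(1)[OF X] kronecker_index[OF tensorsD(2)[OF X] one_carrier_mat ab] by (intro sum.cong refl) simp
    also have "\<dots> = transform L X ! j $$ (a div d, b div d) * 1\<^sub>m d $$ (a mod d, b mod d)"
      unfolding transform_entry[OF X j dm(1,2)] by (simp only: sum_distrib_right mult.assoc)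
    also have "\<dots> = map (\<lambda>M. M \<otimes>\<^sub>K 1\<^sub>m d) (transform L X) ! j $$ (a, b)"
      using tensorsD(1)[OF transform_carrier[OF X]] j
        kronecker_index[OF tensorsD(2)[OF transform_carrier[OF X] j] one_carrier_mat ab] by simp
    finally show "transform L (map (\<lambda>M. M \<otimes>\<^sub>K 1\<^sub>m d) X) ! j $$ (a, b) =
        map (\<lambda>M. M \<otimes>\<^sub>K 1\<^sub>m d) (transform L X) ! j $$ (a, b)" .
  qed
qed

lemma semi_tensor_product_transform:
  assumes X: "X \<in> tensors p r l" and Y: "Y \<in> tensors u w l" and ru: "0 < r" "0 < u"
  defines "t \<equiv> lcm r u"
  shows "semi_tensor_product L X Y \<in> tensors (p * (t div r)) (w * (t div u)) l"
    and "j < l \<Longrightarrow> transform L (semi_tensor_product L X Y) ! j =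
      (transform L X ! j \<otimes>\<^sub>K 1\<^sub>m (t div r)) * (transform L Y ! j \<otimes>\<^sub>K 1\<^sub>m (t div u))"
proof -
  have S: "semi_tensor_product L X Y =
      t_product L (map (\<lambda>M. M \<otimes>\<^sub>K 1\<^sub>m (t div r)) X) (map (\<lambda>M. M \<otimes>\<^sub>K 1\<^sub>m (t div u)) Y)"
    using tensorsD(4)[OF X l] tensorsD(3)[OF Y l] by (simp add: semi_tensor_product_def Let_def t_def)
  note XK = transform_kronecker_one[OF X, of "t div r"] and YK = transform_kronecker_one[OF Y, of "t div u"]
  have "r * (t div r) = u * (t div u)" by (simp add: t_def)
  then have YK': "map (\<lambda>M. M \<otimes>\<^sub>K 1\<^sub>m (t div u)) Y \<in> tensors (r * (t div r)) (w * (t div u)) l"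
    using YK(1) by simp
  show "semi_tensor_product L X Y \<in> tensors (p * (t div r)) (w * (t div u)) l"
    unfolding S by (rule t_product_carrier(1)[OF XK(1) YK'])
  show "transform L (semi_tensor_product L X Y) ! j =
      (transform L X ! j \<otimes>\<^sub>K 1\<^sub>m (t div r)) * (transform L Y ! j \<otimes>\<^sub>K 1\<^sub>m (t div u))" if "j < l"
    unfolding S t_product_carrier(2)[OF XK(1) YK'] XK(2) YK(2)
    using that tensorsD(1)[OF transform_carrier[OF X]] tensorsD(1)[OF transform_carrier[OF Y]] by simp
qed

lemma t_transpose_transform:
  assumes X: "X \<in> tensors p r l"
  shows "t_transpose L X \<in> tensors r p l"
    and "transform L (t_transpose L X) = map transpose_mat (transform L X)"
proof -
  have Z: "map transpose_mat (transform L X) \<in> tensors r p l"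
    using tensorsD(1,2)[OF transform_carrier[OF X]] by (intro tensorsI) auto
  show "t_transpose L X \<in> tensors r p l" "transform L (t_transpose L X) = map transpose_mat (transform L X)"
    unfolding t_transpose_def using inv_transform_carrier[OF Z] transform_inv_transform[OF Z] by simp_all
qed

text \<open>In both semi-tensor products one inner dimension divides the other. Hence
  \<open>S\<close> is never padded: only \<open>U\<close> and the transpose of \<open>V\<close>
  receive identity factors, of sizes \<open>m2\<close> and \<open>n2\<close>.\<close>

lemma transform_stp_svd:
  assumes U: "U \<in> tensors m1 m1 l" and S: "S \<in> tensors (m1 * m2) (n1 * n2) l" and V: "V \<in> tensors n1 n1 l"
    and pos: "0 < m1" "0 < m2" "0 < n1" "0 < n2"
  defines "T \<equiv> semi_tensor_product L (semi_tensor_product L U S) (t_transpose L V)"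
  shows "T \<in> tensors (m1 * m2) (n1 * n2) l"
    and "j < l \<Longrightarrow> transform L T ! j =
      (transform L U ! j \<otimes>\<^sub>K 1\<^sub>m m2) * transform L S ! j * ((transform L V ! j)\<^sup>T \<otimes>\<^sub>K 1\<^sub>m n2)"
proof -
  have l1: "lcm m1 (m1 * m2) = m1 * m2" by (simp add: lcm_proj2_if_dvd_nat)
  have l2: "lcm (n1 * n2) n1 = n1 * n2" by (simp add: lcm_proj1_if_dvd_nat)
  have d: "m1 * m2 div m1 = m2" "m1 * m2 div (m1 * m2) = 1" "n1 * n2 div n1 = n2" "n1 * n2 div (n1 * n2) = 1"
    using pos by auto
  have p1: "0 < m1 * m2" "0 < n1 * n2" using pos by auto
  note US = semi_tensor_product_transform[OF U S pos(1) p1(1), unfolded l1 d]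
  note Vt = t_transpose_transform[OF V]
  have US': "semi_tensor_product L U S \<in> tensors (m1 * m2) (n1 * n2) l" using US(1) by simp
  note R = semi_tensor_product_transform[OF US' Vt(1) p1(2) pos(3), unfolded l2 d]
  show "T \<in> tensors (m1 * m2) (n1 * n2) l" unfolding T_def using R(1) by simp
  show "transform L T ! j =
      (transform L U ! j \<otimes>\<^sub>K 1\<^sub>m m2) * transform L S ! j * ((transform L V ! j)\<^sup>T \<otimes>\<^sub>K 1\<^sub>m n2)"
    if "j < l"
    unfolding T_def R(2)[OF that] US(2)[OF that] Vt(2)
    using that tensorsD(1)[OF transform_carrier[OF V]] by (simp add: kronecker_one)
qed

lemma transform_minus_sum:
  assumes X: "X \<in> tensors p r l" and T: "\<And>i. i \<in> I \<Longrightarrow> T i \<in> tensors p r l"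
  shows "t_minus X (t_sum p r l T I) \<in> tensors p r l"
    and "j < l \<Longrightarrow> a < p \<Longrightarrow> b < r \<Longrightarrow> transform L (t_minus X (t_sum p r l T I)) ! j $$ (a, b) =
      transform L X ! j $$ (a, b) - (\<Sum>i\<in>I. transform L (T i) ! j $$ (a, b))"
proof -
  let ?D = "t_minus X (t_sum p r l T I)"
  show D: "?D \<in> tensors p r l"
    using tensorsD(1,2)[OF X] by (intro tensorsI) (auto simp: t_minus_def t_sum_def intro!: minus_carrier_mat)
  have entry: "?D ! j $$ (a, b) = X ! j $$ (a, b) - (\<Sum>i\<in>I. T i ! j $$ (a, b))" if "j < l" "a < p" "b < r" for j a b
    using that tensorsD(1)[OF X] tensorsD(2)[OF X] by (simp add: t_minus_def t_sum_def)
  show "transform L ?D ! j $$ (a, b) = transform L X ! j $$ (a, b) - (\<Sum>i\<in>I. transform L (T i) ! j $$ (a, b))"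
    if jab: "j < l" "a < p" "b < r"
  proof -
    have "transform L ?D ! j $$ (a, b) = (\<Sum>j'<l. re_L j j' * X ! j' $$ (a, b) - (\<Sum>i\<in>I. re_L j j' * T i ! j' $$ (a, b)))"
      unfolding transform_entry[OF D jab] using jab by (intro sum.cong refl) (simp add: entry right_diff_distrib sum_distrib_left)
    also have "\<dots> = transform L X ! j $$ (a, b) - (\<Sum>j'<l. \<Sum>i\<in>I. re_L j j' * T i ! j' $$ (a, b))"
      by (simp add: sum_subtractf transform_entry[OF X jab])
    also have "(\<Sum>j'<l. \<Sum>i\<in>I. re_L j j' * T i ! j' $$ (a, b)) = (\<Sum>i\<in>I. \<Sum>j'<l. re_L j j' * T i ! j' $$ (a, b))"
      by (rule sum.swap)
    also have "\<dots> = (\<Sum>i\<in>I. transform L (T i) ! j $$ (a, b))"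
      by (intro sum.cong refl) (simp add: transform_entry[OF T jab])
    finally show ?thesis .
  qed
qed

end

text \<open>Two applications of the mixed product rule reassemble \<open>B\<close> from its factors,
  so the particular decomposition of \<open>B\<close> chosen by the algorithm leaves no trace in the
  approximation.\<close>

lemma svd_kronecker:
  fixes B C :: "real mat"
  assumes svd: "is_full_svd B U \<Sigma> V" and B: "B \<in> carrier_mat m1 n1" and C: "C \<in> carrier_mat m2 n2"
  shows "(U \<otimes>\<^sub>K 1\<^sub>m m2) * (\<Sigma> \<otimes>\<^sub>K C) * (V\<^sup>T \<otimes>\<^sub>K 1\<^sub>m n2) = B \<otimes>\<^sub>K C"
proof -
  have U: "U \<in> carrier_mat m1 m1" and S: "\<Sigma> \<in> carrier_mat m1 n1" and "V \<in> carrier_mat n1 n1"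
    and B_eq: "B = U * \<Sigma> * V\<^sup>T"
    using svd carrier_matD[OF B] unfolding is_full_svd_def by blast+
  then have V: "V\<^sup>T \<in> carrier_mat n1 n1" by simp
  have US: "U * \<Sigma> \<in> carrier_mat m1 n1" using U S by simp
  show ?thesis
    unfolding kronecker_mult[OF U one_carrier_mat S C] left_mult_one_mat[OF C]
      kronecker_mult[OF US C V one_carrier_mat] right_mult_one_mat[OF C] B_eq[symmetric] ..
qed

section \<open>The rearrangement operator\<close>

lemma rearrange_carrier: "rearrange m1 m2 n1 n2 A \<in> carrier_mat (m1 * n1) (m2 * n2)"
proof -
  have "length (concat (map (\<lambda>b. map (\<lambda>a. stack_cols (block m2 n2 A a b)) [0..<m1]) [0..<n1])) = m1 * n1"
    by (simp add: length_concat comp_def sum_list_triv)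
  then show ?thesis unfolding rearrange_def by (metis mat_of_rows_carrier(1))
qed

lemma concat_map_nth:
  assumes "i < m * n"
  shows "concat (map (\<lambda>b. map (\<lambda>a. f a b) [0..<m]) [0..<n]) ! i = f (i mod m) (i div m)"
  using assms
proof (induction n)
  case (Suc n)
  let ?xs = "concat (map (\<lambda>b. map (\<lambda>a. f a b) [0..<m]) [0..<n])"
  have len: "length ?xs = m * n"
    by (simp add: length_concat comp_def sum_list_triv)
  show ?case
  proof (cases "i < m * n")
    case True
    then show ?thesis using Suc.IH len by (simp add: nth_append)
  next
    case False
    have "i div m = n"
      using False Suc.prems by (intro div_nat_eqI) (auto simp: mult.commute)
    moreover from this have "i mod m = i - m * n"
      using minus_mult_div_eq_mod[of i m] by metis
    moreover have "i - m * n < m" using False Suc.prems by simp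
    ultimately show ?thesis using False len by (simp add: nth_append)
  qed
qed simp

text \<open>Rows run through the blocks, and columns through the entries of a block, in both cases
  column by column. This is the order of \<open>stack_cols\<close>, which is why a Kronecker product
  becomes an outer product.\<close>

lemma rearrange_index:
  assumes "i < m1 * n1" "j < m2 * n2"
  shows "rearrange m1 m2 n1 n2 A $$ (i, j) =
    A $$ ((i mod m1) * m2 + j mod m2, (i div m1) * n2 + j div m2)"
proof -
  have "0 < m2" using assms(2) by (cases m2) auto
  then have "j mod m2 < m2" "j div m2 < n2" using assms(2) by (auto simp: less_mult_imp_div_less mult.commute)
  moreover have "i < length (concat (map (\<lambda>b. map (\<lambda>a. stack_cols (block m2 n2 A a b)) [0..<m1]) [0..<n1]))"
    using assms(1) by (simp add: length_concat comp_def sum_list_triv mult.commute)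
  ultimately show ?thesis
    unfolding rearrange_def using assms
    by (simp add: mat_of_rows_def concat_map_nth stack_cols_def block_def)
qed

text \<open>The operator permutes entries; the chain below only reorders the four indices of block
  and position.\<close>

lemma fro_rearrange:
  assumes A: "A \<in> carrier_mat (m1 * m2) (n1 * n2)"
  shows "fro (rearrange m1 m2 n1 n2 A) = fro A"
proof -
  let ?g = "\<lambda>a x b y. (A $$ (a * m2 + x, b * n2 + y))\<^sup>2"
  have "fro (rearrange m1 m2 n1 n2 A) =
      (\<Sum>i<n1 * m1. \<Sum>j<n2 * m2. ?g (i mod m1) (j mod m2) (i div m1) (j div m2))"
    unfolding fro_def carrier_matD[OF rearrange_carrier]
    by (intro sum.cong) (auto simp: rearrange_index mult.commute)
  also have "\<dots> = (\<Sum>i<n1 * m1. \<Sum>y<n2. \<Sum>x<m2. ?g (i mod m1) x (i div m1) y)"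
    by (intro sum.cong refl sum_div_mod)
  also have "\<dots> = (\<Sum>b<n1. \<Sum>a<m1. \<Sum>y<n2. \<Sum>x<m2. ?g a x b y)"
    by (rule sum_div_mod)
  also have "\<dots> = (\<Sum>a<m1. \<Sum>b<n1. \<Sum>y<n2. \<Sum>x<m2. ?g a x b y)"
    by (rule sum.swap)
  also have "\<dots> = (\<Sum>a<m1. \<Sum>b<n1. \<Sum>x<m2. \<Sum>y<n2. ?g a x b y)"
    by (rule sum.cong[OF refl], rule sum.cong[OF refl], rule sum.swap)
  also have "\<dots> = (\<Sum>a<m1. \<Sum>x<m2. \<Sum>b<n1. \<Sum>y<n2. ?g a x b y)"
    by (rule sum.cong[OF refl], rule sum.swap)
  also have "\<dots> = (\<Sum>i<m1 * m2. \<Sum>b<n1. \<Sum>y<n2. ?g (i div m2) (i mod m2) b y)"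
    by (rule sum_div_mod[symmetric])
  also have "\<dots> = (\<Sum>i<m1 * m2. \<Sum>j<n1 * n2. ?g (i div m2) (i mod m2) (j div n2) (j mod n2))"
    by (rule sum.cong[OF refl], rule sum_div_mod[symmetric])
  also have "\<dots> = fro A" using A by (simp add: fro_def)
  finally show ?thesis .
qed

lemma rearrange_kronecker_index:
  assumes B: "B \<in> carrier_mat m1 n1" and C: "C \<in> carrier_mat m2 n2"
    and ij: "i < m1 * n1" "j < m2 * n2"
  shows "(B \<otimes>\<^sub>K C) $$ ((i mod m1) * m2 + j mod m2, (i div m1) * n2 + j div m2) =
    stack_cols B $ i * stack_cols C $ j"
proof -
  have pos: "0 < m1" "0 < m2" using ij by (cases m1; cases m2; simp)+
  have dm: "i mod m1 < m1" "i div m1 < n1" "j mod m2 < m2" "j div m2 < n2"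
    using ij pos by (auto simp: less_mult_imp_div_less mult.commute)
  show ?thesis
    using dm ij B C by (simp add: kronecker_index[OF B C mult_add_less mult_add_less] stack_cols_def)
qed

section \<open>The expected error\<close>

definition truncated_factors :: "nat \<Rightarrow> real mat \<Rightarrow> real mat \<Rightarrow> real mat \<Rightarrow> real mat" where
  "truncated_factors k P S W =
     Matrix.mat (dim_row P) (dim_row W) (\<lambda>(a, b). \<Sum>i<k. S $$ (i, i) * P $$ (a, i) * W $$ (b, i))"

text \<open>Quantifying over all factorizations makes the bound \<open>e\<close> independent of
  those actually picked, so that it can be a measurable function of the random matrix.\<close>

definition randomized_svd_error_le :: "nat \<Rightarrow> nat \<Rightarrow> real mat \<Rightarrow> real mat \<Rightarrow> real \<Rightarrow> bool" where
  "randomized_svd_error_le q k M G e \<longleftrightarrow>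
     (\<forall>Q R U S W. is_thin_qr ((M * M\<^sup>T) ^\<^sub>m q * M * G) Q R \<longrightarrow>
       is_full_svd (Q\<^sup>T * M) U S W \<longrightarrow> fro (M - truncated_factors k (Q * U) S W) \<le> e)"

lemma expected_truncated_svd_error:
  fixes M :: "real mat" and X :: "nat \<times> nat \<Rightarrow> 'w \<Rightarrow> real"
  assumes P: "prob_space P" and M: "M \<in> carrier_mat m n" and k: "0 < k" and s: "2 \<le> s"
    and p: "k + s \<le> min m n" and pos: "0 < singular_value M k"
    and indep: "prob_space.indep_vars P (\<lambda>_. borel) X ({..<n} \<times> {..<k + s})"
    and X: "\<And>i. i \<in> {..<n} \<times> {..<k + s} \<Longrightarrow> distributed P lborel (X i) std_normal_density"
  defines "\<tau> \<equiv> singular_value M (k + 1) / singular_value M k"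
    and "tail \<equiv> \<Sum>i=k + 1..min m n. (singular_value M i)\<^sup>2"
  obtains g where "g \<in> borel_measurable P"
    and "(\<integral>\<^sup>+\<omega>. ennreal (g \<omega>) \<partial>P) \<le> ennreal ((2 + real k / (real s - 1) * \<tau> ^ (4 * q)) * tail)"
    and "AE \<omega> in P. 0 \<le> g \<omega> \<and> randomized_svd_error_le q k M (Matrix.mat n (k + s) (\<lambda>i. X i \<omega>)) (g \<omega>)"
proof -
  interpret prob_space P by (rule P)
  let ?\<sigma> = "\<lambda>i. singular_value M (Suc i)"
  let ?p = "k + s"
  let ?I = "{..<n} \<times> {..<?p}"
  let ?B = "\<Pi>\<^sub>M i\<in>?I. borel :: real measure"
  have kn: "k < n" "k \<le> n" "k < min m n" using p s by auto
  obtain V where V: "V \<in> carrier_mat n n" "V\<^sup>T * V = 1\<^sub>m n"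
    and gram: "(M * V)\<^sup>T * (M * V) = diagonal n (\<lambda>i. (?\<sigma> i)\<^sup>2)"
    and nonneg: "\<And>i. i < n \<Longrightarrow> 0 \<le> ?\<sigma> i" and anti: "\<And>i j. i \<le> j \<Longrightarrow> j < n \<Longrightarrow> ?\<sigma> j \<le> ?\<sigma> i"
    and zero: "\<And>i. m \<le> i \<Longrightarrow> i < n \<Longrightarrow> ?\<sigma> i = 0"
    by (rule right_singular_basis[OF M]) (rule that)
  have pos': "0 < ?\<sigma> (k - 1)" using pos k by simp
  have \<tau>: "\<tau> = ?\<sigma> k / ?\<sigma> (k - 1)" using k by (simp add: \<tau>_def)
  have \<tau>_nonneg: "0 \<le> \<tau>" unfolding \<tau> using pos' nonneg[OF kn(1)] by simp
  \<comment> \<open>The sum up to \<open>n\<close> is natural for the columns of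
    \<open>M * V\<close>; beyond \<open>min m n\<close> the terms vanish. The indices shift by one
    because \<open>singular_value\<close> counts from 1.\<close>
  have tail: "(\<Sum>a=k..<n. (?\<sigma> a)\<^sup>2) = tail"
  proof -
    have "(\<Sum>a=k..<n. (?\<sigma> a)\<^sup>2) = (\<Sum>a=k..<min m n. (?\<sigma> a)\<^sup>2)"
      by (rule sum.mono_neutral_right) (auto simp: zero)
    also have "\<dots> = tail"
      unfolding tail_def by (rule sum.reindex_bij_witness[of _ "\<lambda>i. i - 1" Suc]) auto
    finally show ?thesis .
  qed
  define \<Phi> where "\<Phi> \<omega> = (\<lambda>(a, b)\<in>?I. \<Sum>c<n. V $$ (c, a) * X (c, b) \<omega>)" for \<omega>
  have np: "0 < n" "0 < ?p" using kn k by auto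
  have \<Phi>_meas: "\<Phi> \<in> measurable P ?B"
    and \<Phi>_distr: "distr P ?B \<Phi> = gauss ?I"
    using distr_rotated_gaussian_matrix[OF V np indep X] unfolding \<Phi>_def[abs_def] by auto
  define H where "H \<omega> = (\<Sum>a=k..<n. \<Sum>i<k. (?\<sigma> a)\<^sup>2 * (\<Sum>b<?p. \<omega> (a, b) * pinv k ?p \<omega> i b)\<^sup>2)" for \<omega>
  have H_meas: "H \<in> borel_measurable ?B"
    and H_int: "(\<integral>\<^sup>+\<omega>. ennreal (H \<omega>) \<partial>gauss ?I) \<le> ennreal (real k / (real s - 1) * tail)"
    using nn_integral_weighted_rows_pinv[of "\<lambda>a. (?\<sigma> a)\<^sup>2" k n s] kn s unfolding H_def[abs_def] tail by auto
  have H_nonneg: "0 \<le> H \<omega>" for \<omega> by (simp add: H_def sum_nonneg)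
  have tail_nonneg: "0 \<le> tail" by (simp add: tail_def sum_nonneg)
  \<comment> \<open>One tail comes from the range finder and one from the truncation to rank
    \<open>k\<close>.\<close>
  define g where "g \<omega> = 2 * tail + \<tau> ^ (4 * q) * H (\<Phi> \<omega>)" for \<omega>
  have H\<Phi>: "(\<lambda>\<omega>. H (\<Phi> \<omega>)) \<in> borel_measurable P" by (rule measurable_compose[OF \<Phi>_meas H_meas])
  show thesis
  proof (rule that)
    show "g \<in> borel_measurable P"
      unfolding g_def[abs_def] by (intro borel_measurable_add borel_measurable_times borel_measurable_const H\<Phi>)
    have "(\<integral>\<^sup>+\<omega>. ennreal (g \<omega>) \<partial>P) = (\<integral>\<^sup>+\<omega>. ennreal (2 * tail) + ennreal (\<tau> ^ (4 * q)) * ennreal (H (\<Phi> \<omega>)) \<partial>P)"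
      unfolding g_def using \<tau>_nonneg H_nonneg tail_nonneg
      by (intro nn_integral_cong) (simp add: ennreal_plus ennreal_mult)
    also have "\<dots> = ennreal (2 * tail) + ennreal (\<tau> ^ (4 * q)) * (\<integral>\<^sup>+\<omega>. ennreal (H (\<Phi> \<omega>)) \<partial>P)"
      using H\<Phi> emeasure_space_1 by (subst nn_integral_add) (auto simp: nn_integral_cmult)
    also have "(\<integral>\<^sup>+\<omega>. ennreal (H (\<Phi> \<omega>)) \<partial>P) = (\<integral>\<^sup>+\<omega>. ennreal (H \<omega>) \<partial>gauss ?I)"
      unfolding \<Phi>_distr[symmetric] using H_meas by (intro nn_integral_distr[symmetric, OF \<Phi>_meas]) auto
    also have "ennreal (2 * tail) + ennreal (\<tau> ^ (4 * q)) * (\<integral>\<^sup>+\<omega>. ennreal (H \<omega>) \<partial>gauss ?I) \<le>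
        ennreal (2 * tail) + ennreal (\<tau> ^ (4 * q)) * ennreal (real k / (real s - 1) * tail)"
      by (intro add_mono mult_left_mono H_int) auto
    also have "\<dots> = ennreal ((2 + real k / (real s - 1) * \<tau> ^ (4 * q)) * tail)"
      using s \<tau>_nonneg tail_nonneg
      by (subst ennreal_mult[symmetric], simp, simp, subst ennreal_plus[symmetric]) (auto simp: field_simps)
    finally show "(\<integral>\<^sup>+\<omega>. ennreal (g \<omega>) \<partial>P) \<le> ennreal ((2 + real k / (real s - 1) * \<tau> ^ (4 * q)) * tail)" .
    \<comment> \<open>Off this null set the Gram matrix is regular and \<open>pinv\<close> really is
      a right inverse, as the deterministic bound demands.\<close>
    have "AE \<omega> in distr P ?B \<Phi>. Determinant.det (Matrix.mat k k \<omega>) \<noteq> 0"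
      unfolding \<Phi>_distr using kn by (intro AE_det_leading_minor_nonzero) auto
    then have "AE \<omega> in P. Determinant.det (Matrix.mat k k (\<Phi> \<omega>)) \<noteq> 0"
      by (rule AE_distrD[OF \<Phi>_meas])
    then show "AE \<omega> in P. 0 \<le> g \<omega> \<and> randomized_svd_error_le q k M (Matrix.mat n (k + s) (\<lambda>i. X i \<omega>)) (g \<omega>)"
    proof eventually_elim
      fix \<omega> assume "Determinant.det (Matrix.mat k k (\<Phi> \<omega>)) \<noteq> 0"
      then have det: "Determinant.det (gram_rows k ?p (\<Phi> \<omega>)) \<noteq> 0"
        by (rule det_gram_rows_nonzero) simp
      let ?G = "Matrix.mat n ?p (\<lambda>i. X i \<omega>)"
      have G: "?G \<in> carrier_mat n ?p" by simp
      have bound: "fro (M - truncated_factors k (Q * U) S W) \<le> g \<omega>"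
        if qr: "is_thin_qr ((M * M\<^sup>T) ^\<^sub>m q * M * ?G) Q R"
          and svd: "is_full_svd (Q\<^sup>T * M) U S W" for Q R U S W
      proof -
        have dims: "dim_row Q = m" "dim_row W = n"
          using qr svd M by (auto simp: is_thin_qr_def is_full_svd_def pow_mat_dim)
        define x where "x i = Matrix.vec ?p (pinv k ?p (\<Phi> \<omega>) i)" for i
        have x: "x i \<in> carrier_vec ?p" for i by (simp add: x_def)
        have VG: "V\<^sup>T * ?G \<in> carrier_mat n ?p" using V by simp
        have entry: "(V\<^sup>T * ?G) $$ (a, b) = \<Phi> \<omega> (a, b)" if "a < n" "b < ?p" for a b
          using that V(1) by (subst mult_mat_entry[of _ n n _ ?p]) (auto simp: \<Phi>_def)
        have Vx: "(V\<^sup>T * ?G *\<^sub>v x i) $ a = (\<Sum>b<?p. \<Phi> \<omega> (a, b) * pinv k ?p (\<Phi> \<omega>) i b)" if a: "a < n" for a i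
        proof -
          have "(V\<^sup>T * ?G *\<^sub>v x i) $ a = (\<Sum>b<?p. (V\<^sup>T * ?G) $$ (a, b) * x i $ b)"
            using a carrier_matD[OF VG] by (simp add: scalar_prod_def lessThan_atLeast0 x_def del: index_mult_mat(1))
          then show ?thesis using a by (simp add: entry x_def)
        qed
        have "fro (M - truncated_factors k (Q * U) S W) \<le>
          2 * (\<Sum>a=k..<n. (?\<sigma> a)\<^sup>2) + (?\<sigma> k / ?\<sigma> (k - 1)) ^ (4 * q) *
            (\<Sum>a=k..<n. \<Sum>i<k. (?\<sigma> a)\<^sup>2 * ((V\<^sup>T * ?G *\<^sub>v x i) $ a)\<^sup>2)"
        unfolding truncated_factors_def index_mult_mat(2) dims
        proof (rule truncated_svd_error[OF M V gram nonneg anti k kn(1) _ pos' G qr svd x])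
          fix a i assume "a < k" "i < k"
          then show "(V\<^sup>T * ?G *\<^sub>v x i) $ a = (if a = i then 1 else 0)"
            using Vx[of a i] pinv_right_inverse[OF det, of a i] kn by simp
        qed auto
        also have "\<dots> = g \<omega>"
          unfolding g_def H_def tail \<tau> by (simp add: Vx)
        finally show ?thesis .
      qed
      have "0 \<le> g \<omega>" unfolding g_def using tail_nonneg \<tau>_nonneg H_nonneg by simp
      then show "0 \<le> g \<omega> \<and> randomized_svd_error_le q k M (Matrix.mat n (k + s) (\<lambda>i. X i \<omega>)) (g \<omega>)"
        using bound unfolding randomized_svd_error_le_def by blast
    qed
  qed
qed

section \<open>From the matrix bound to a slice of the tensor\<close>

lemma mrstp_svd_slice_carrier:
  assumes "mrstp_svd_slice m1 m2 n1 n2 k q A G Us Ss Vs" "i < k"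
  shows "Us i \<in> carrier_mat m1 m1" "Ss i \<in> carrier_mat (m1 * m2) (n1 * n2)" "Vs i \<in> carrier_mat n1 n1"
proof -
  obtain B C \<Sigma> where B: "B \<in> carrier_mat m1 n1" and C: "C \<in> carrier_mat m2 n2"
    and svd: "is_full_svd B (Us i) \<Sigma> (Vs i)" and S: "Ss i = \<Sigma> \<otimes>\<^sub>K C"
    using assms unfolding mrstp_svd_slice_def by blast
  have "\<Sigma> \<in> carrier_mat m1 n1"
    using svd carrier_matD[OF B] unfolding is_full_svd_def by blast
  then show "Ss i \<in> carrier_mat (m1 * m2) (n1 * n2)"
    unfolding S using C by (rule kronecker_carrier)
  show "Us i \<in> carrier_mat m1 m1" "Vs i \<in> carrier_mat n1 n1"
    using svd carrier_matD[OF B] unfolding is_full_svd_def by blast+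
qed

lemma mrstp_svd_slice_error:
  fixes A G :: "real mat"
  assumes slice: "mrstp_svd_slice m1 m2 n1 n2 k q A G Us Ss Vs"
    and A: "A \<in> carrier_mat (m1 * m2) (n1 * n2)" and G: "G \<in> carrier_mat (m2 * n2) p"
    and k: "k \<le> p" "k \<le> m2 * n2"
    and D: "D \<in> carrier_mat (m1 * m2) (n1 * n2)"
    and D_index: "\<And>a b. a < m1 * m2 \<Longrightarrow> b < n1 * n2 \<Longrightarrow> D $$ (a, b) = A $$ (a, b) -
      (\<Sum>i<k. ((Us i \<otimes>\<^sub>K 1\<^sub>m m2) * Ss i * ((Vs i)\<^sup>T \<otimes>\<^sub>K 1\<^sub>m n2)) $$ (a, b))"
    and e: "randomized_svd_error_le q k (rearrange m1 m2 n1 n2 A) G e"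
  shows "fro D \<le> e"
proof -
  define M where "M = rearrange m1 m2 n1 n2 A"
  note e = e[folded M_def]
  let ?m = "m1 * n1" and ?n = "m2 * n2"
  have M: "M \<in> carrier_mat ?m ?n" unfolding M_def by (rule rearrange_carrier)
  obtain Q R U S W where qr: "is_thin_qr ((M * M\<^sup>T) ^\<^sub>m q * M * G) Q R"
    and svd: "is_full_svd (Q\<^sup>T * M) U S W"
    and out: "\<And>i. i < k \<Longrightarrow> \<exists>B \<in> carrier_mat m1 n1. \<exists>C \<in> carrier_mat m2 n2. \<exists>\<Sigma>.
           stack_cols B = sqrt (S $$ (i, i)) \<cdot>\<^sub>v col (Q * U) i \<and>
           stack_cols C = sqrt (S $$ (i, i)) \<cdot>\<^sub>v col W i \<and>
           is_full_svd B (Us i) \<Sigma> (Vs i) \<and> Ss i = \<Sigma> \<otimes>\<^sub>K C"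
    using slice unfolding mrstp_svd_slice_def M_def[symmetric] by blast
  have "(M * M\<^sup>T) ^\<^sub>m q \<in> carrier_mat ?m ?m" using M by (simp add: pow_carrier_mat)
  then have Y: "(M * M\<^sup>T) ^\<^sub>m q * M * G \<in> carrier_mat ?m p"
    using M G by (intro mult_carrier_mat) auto
  have Q: "Q \<in> carrier_mat ?m p"
    using qr carrier_matD[OF Y] unfolding is_thin_qr_def by auto
  have B: "Q\<^sup>T * M \<in> carrier_mat p ?n" using Q M by simp
  have U: "U \<in> carrier_mat p p" and W: "W \<in> carrier_mat ?n ?n"
    and S_nonneg: "\<And>i. i < min p ?n \<Longrightarrow> 0 \<le> S $$ (i, i)"
    using svd carrier_matD[OF B] unfolding is_full_svd_def by auto
  have QU: "Q * U \<in> carrier_mat ?m p" using Q U by simp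
  let ?T = "\<lambda>i. (Us i \<otimes>\<^sub>K 1\<^sub>m m2) * Ss i * ((Vs i)\<^sup>T \<otimes>\<^sub>K 1\<^sub>m n2)"
  have T: "?T i $$ ((a mod m1) * m2 + b mod m2, (a div m1) * n2 + b div m2) =
      S $$ (i, i) * (Q * U) $$ (a, i) * W $$ (b, i)" if i: "i < k" and a: "a < ?m" and b: "b < ?n" for i a b
  proof -
    obtain B C \<Sigma> where BC: "B \<in> carrier_mat m1 n1" "C \<in> carrier_mat m2 n2"
      and stack: "stack_cols B = sqrt (S $$ (i, i)) \<cdot>\<^sub>v col (Q * U) i" "stack_cols C = sqrt (S $$ (i, i)) \<cdot>\<^sub>v col W i"
      and svdB: "is_full_svd B (Us i) \<Sigma> (Vs i)" and Ss: "Ss i = \<Sigma> \<otimes>\<^sub>K C"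
      using out[OF i] by blast
    have "?T i = B \<otimes>\<^sub>K C" unfolding Ss by (rule svd_kronecker[OF svdB BC])
    then have "?T i $$ ((a mod m1) * m2 + b mod m2, (a div m1) * n2 + b div m2) = stack_cols B $ a * stack_cols C $ b"
      using rearrange_kronecker_index[OF BC a b] by simp
    also have "\<dots> = (sqrt (S $$ (i, i)) * sqrt (S $$ (i, i))) * (Q * U) $$ (a, i) * W $$ (b, i)"
      using i k a b carrier_matD[OF QU] carrier_matD[OF W]
      unfolding stack by (simp add: col_def mult_ac del: index_mult_mat real_sqrt_mult_self)
    \<comment> \<open>The square roots shared between \<open>B\<close> and \<open>C\<close>
      recombine; \<open>k\<close> is at most \<open>min p ?n\<close>, so this diagonal entry is
      known to be nonnegative.\<close>
    also have "sqrt (S $$ (i, i)) * sqrt (S $$ (i, i)) = S $$ (i, i)"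
      using S_nonneg[of i] i k by simp
    finally show ?thesis .
  qed
  let ?K = "Matrix.mat ?m ?n (\<lambda>(a, b). \<Sum>i<k. S $$ (i, i) * (Q * U) $$ (a, i) * W $$ (b, i))"
  have "rearrange m1 m2 n1 n2 D = M - ?K"
  proof (rule eq_matI)
    fix a b assume "a < dim_row (M - ?K)" "b < dim_col (M - ?K)"
    then have ab: "a < ?m" "b < ?n" by auto
    have pos: "0 < m1" "0 < m2" using ab by (cases m1; cases m2; simp)+
    have "(a mod m1) * m2 + b mod m2 < m1 * m2" using pos by (intro mult_add_less) auto
    moreover have "(a div m1) * n2 + b div m2 < n1 * n2"
      using ab pos by (intro mult_add_less) (auto simp: less_mult_imp_div_less mult.commute)
    ultimately show "rearrange m1 m2 n1 n2 D $$ (a, b) = (M - ?K) $$ (a, b)"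
      using ab M by (simp add: rearrange_index D_index T M_def)
  qed (use M carrier_matD[OF rearrange_carrier, of m1 m2 n1 n2 D] in auto)
  then have "fro D = fro (M - ?K)" using fro_rearrange[OF D] by simp
  moreover have "?K = truncated_factors k (Q * U) S W"
    using carrier_matD[OF Q] W unfolding truncated_factors_def by simp
  ultimately show ?thesis using e qr svd unfolding randomized_svd_error_le_def by metis
qed

theorem theorem5p1:
  fixes m\<^sub>1 m\<^sub>2 n\<^sub>1 n\<^sub>2 l k s q v :: nat
    and L :: "complex mat" and \<rho> :: real
    and P :: "'w measure"
    and \<A> :: "real tensor" and \<G> \<A>' :: "'w \<Rightarrow> real tensor"
    and \<U> \<S> \<V> :: "'w \<Rightarrow> nat \<Rightarrow> real tensor"
    and \<sigma> :: "nat \<Rightarrow> nat \<Rightarrow> real" and \<tau> :: "nat \<Rightarrow> real"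
  assumes "m\<^sub>1 > 0" "m\<^sub>2 > 0" "n\<^sub>1 > 0" "n\<^sub>2 > 0" "l > 0" "k > 0" "s \<ge> 2"
    and "v = min (m\<^sub>1 * n\<^sub>1) (m\<^sub>2 * n\<^sub>2)" and "k + s \<le> v"
    and "L \<in> carrier_mat l l" and "invertible_mat L" and "maps_real_to_real L"
    and "\<rho> > 0"
    and "mat_adjoint L * L = complex_of_real \<rho> \<cdot>\<^sub>m 1\<^sub>m l"
    and "L * mat_adjoint L = complex_of_real \<rho> \<cdot>\<^sub>m 1\<^sub>m l"
    and "the (mat_inverse L) = complex_of_real (1 / \<rho>) \<cdot>\<^sub>m mat_adjoint L"
    and "\<A> \<in> tensors (m\<^sub>1 * m\<^sub>2) (n\<^sub>1 * n\<^sub>2) l"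
    and "prob_space P"
    and "gaussian_random_tensor P L (m\<^sub>2 * n\<^sub>2) (k + s) \<G>"
    and "\<And>j i. j < l \<Longrightarrow> i \<in> {1..v} \<Longrightarrow>
           \<sigma> j i = singular_value (rearrange m\<^sub>1 m\<^sub>2 n\<^sub>1 n\<^sub>2 (transform L \<A> ! j)) i"
    and "\<And>j. j < l \<Longrightarrow> \<sigma> j k > 0"
    and "\<And>j. j < l \<Longrightarrow> \<tau> j = \<sigma> j (k + 1) / \<sigma> j k"
    and "\<And>j. j < l \<Longrightarrow> \<tau> j < 1"
    and "\<And>\<omega>. \<omega> \<in> space P \<Longrightarrow> mrstp_svd L m\<^sub>1 m\<^sub>2 n\<^sub>1 n\<^sub>2 k s q \<A> (\<G> \<omega>) (\<U> \<omega>) (\<S> \<omega>) (\<V> \<omega>)"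
    and "\<And>\<omega>. \<omega> \<in> space P \<Longrightarrow>
           \<A>' \<omega> = mrstp_approx L (m\<^sub>1 * m\<^sub>2) (n\<^sub>1 * n\<^sub>2) k (\<U> \<omega>) (\<S> \<omega>) (\<V> \<omega>)"
  shows "(\<integral>\<^sup>+ \<omega>. ennreal ((frobenius_norm (t_minus \<A> (\<A>' \<omega>)))\<^sup>2) \<partial>P) \<le>
    ennreal (2 / \<rho> * (\<Sum>j<l. (2 + real k / (real s - 1) * \<tau> j ^ (4 * q)) * (\<Sum>i = k + 1..v. (\<sigma> j i)\<^sup>2)))"
proof -
  interpret scaled_unitary_transform L l \<rho>
    by unfold_locales (use assms(5,10,12-16) in auto)
  let ?m = "m\<^sub>1 * n\<^sub>1" and ?n = "m\<^sub>2 * n\<^sub>2"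
  let ?M = "\<lambda>j. rearrange m\<^sub>1 m\<^sub>2 n\<^sub>1 n\<^sub>2 (transform L \<A> ! j)"
  let ?X = "\<lambda>j (a, b) \<omega>. transform L (\<G> \<omega>) ! j $$ (a, b)"
  let ?error_le = "\<lambda>j \<omega>. randomized_svd_error_le q k (?M j) (Matrix.mat ?n (k + s) (\<lambda>i. ?X j i \<omega>))"
  note A = assms(17) and P = assms(18)
  have dimL: "dim_row L = l" using assms(10) by simp
  have v: "v = min ?m ?n" and ks: "k + s \<le> min ?m ?n" using assms(8,9) by auto
  have \<sigma>: "\<sigma> j i = singular_value (?M j) i" if "j < l" "i \<in> {1..v}" for j i
    by (rule assms(20)[OF that])
  have gaussian: "prob_space.indep_vars P (\<lambda>_. borel) (?X j) ({..<?n} \<times> {..<k + s})"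
    "\<And>i. i \<in> {..<?n} \<times> {..<k + s} \<Longrightarrow> distributed P lborel (?X j i) std_normal_density" if "j < l" for j
    using assms(19) that unfolding gaussian_random_tensor_def dimL by auto
  define bound where "bound j = (2 + real k / (real s - 1) * \<tau> j ^ (4 * q)) * (\<Sum>i = k + 1..v. (\<sigma> j i)\<^sup>2)" for j
  have bound_nonneg: "0 \<le> bound j" if "j \<in> {..<l}" for j
    unfolding bound_def using assms(7) by (intro mult_nonneg_nonneg add_nonneg_nonneg sum_nonneg zero_le_even_power) auto
  \<comment> \<open>Slices are handled one by one, since only the law within a slice enters;
    \<open>bchoice\<close> then collects the majorants.\<close>
  have "\<forall>j\<in>{..<l}. \<exists>g. g \<in> borel_measurable P \<and> (\<integral>\<^sup>+\<omega>. ennreal (g \<omega>) \<partial>P) \<le> ennreal (bound j) \<and>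
    (AE \<omega> in P. 0 \<le> g \<omega> \<and> ?error_le j \<omega> (g \<omega>))"
  proof
    fix j assume "j \<in> {..<l}"
    then have j: "j < l" by simp
    have k_range: "k \<in> {1..v}" "k + 1 \<in> {1..v}" using assms(6,7) ks v by auto
    have \<sigma>k: "0 < singular_value (?M j) k" using assms(21)[OF j] \<sigma>[OF j k_range(1)] by simp
    have \<tau>: "\<tau> j = singular_value (?M j) (k + 1) / singular_value (?M j) k"
      using assms(22)[OF j] \<sigma>[OF j k_range(1)] \<sigma>[OF j k_range(2)] by simp
    have "(\<Sum>i = k + 1..v. (\<sigma> j i)\<^sup>2) = (\<Sum>i = k + 1..min ?m ?n. (singular_value (?M j) i)\<^sup>2)"
      using \<sigma>[OF j] by (intro sum.cong) (auto simp: v)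
    then have bound: "bound j = (2 + real k / (real s - 1) * (singular_value (?M j) (k + 1) / singular_value (?M j) k) ^ (4 * q)) *
        (\<Sum>i = k + 1..min ?m ?n. (singular_value (?M j) i)\<^sup>2)"
      by (simp only: bound_def \<tau>)
    show "\<exists>g. g \<in> borel_measurable P \<and> (\<integral>\<^sup>+\<omega>. ennreal (g \<omega>) \<partial>P) \<le> ennreal (bound j) \<and>
    (AE \<omega> in P. 0 \<le> g \<omega> \<and> ?error_le j \<omega> (g \<omega>))"
      unfolding bound
      by (rule expected_truncated_svd_error[OF P rearrange_carrier assms(6,7) ks \<sigma>k gaussian[OF j], of q]) blast+
  qed
  from bchoice[OF this] obtain g where g_meas: "\<And>j. j < l \<Longrightarrow> g j \<in> borel_measurable P"
    and g_int: "\<And>j. j < l \<Longrightarrow> (\<integral>\<^sup>+\<omega>. ennreal (g j \<omega>) \<partial>P) \<le> ennreal (bound j)"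
    and g_bound: "\<And>j. j < l \<Longrightarrow> AE \<omega> in P. 0 \<le> g j \<omega> \<and> ?error_le j \<omega> (g j \<omega>)"
    by blast
  have pointwise: "(frobenius_norm (t_minus \<A> (\<A>' \<omega>)))\<^sup>2 \<le> (\<Sum>j<l. g j \<omega>) / \<rho>"
    if \<omega>: "\<omega> \<in> space P" and g: "\<And>j. j < l \<Longrightarrow> ?error_le j \<omega> (g j \<omega>)" for \<omega>
  proof -
    obtain Us Ss Vs :: "nat \<Rightarrow> nat \<Rightarrow> real mat" where G: "\<G> \<omega> \<in> tensors ?n (k + s) l"
      and slice: "\<And>j. j < l \<Longrightarrow> mrstp_svd_slice m\<^sub>1 m\<^sub>2 n\<^sub>1 n\<^sub>2 k q (transform L \<A> ! j) (transform L (\<G> \<omega>) ! j)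
           (\<lambda>i. Us i j) (\<lambda>i. Ss i j) (\<lambda>i. Vs i j)"
      and out: "\<And>i. i < k \<Longrightarrow> \<U> \<omega> i = inv_transform L (map (Us i) [0..<l])"
        "\<And>i. i < k \<Longrightarrow> \<S> \<omega> i = inv_transform L (map (Ss i) [0..<l])"
        "\<And>i. i < k \<Longrightarrow> \<V> \<omega> i = inv_transform L (map (Vs i) [0..<l])"
      using assms(24)[OF \<omega>] unfolding mrstp_svd_def dimL by blast
    let ?T = "\<lambda>i. semi_tensor_product L (semi_tensor_product L (\<U> \<omega> i) (\<S> \<omega> i)) (t_transpose L (\<V> \<omega> i))"
    let ?D = "t_minus \<A> (\<A>' \<omega>)"
    have approx: "\<A>' \<omega> = t_sum (m\<^sub>1 * m\<^sub>2) (n\<^sub>1 * n\<^sub>2) l ?T {..<k}"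
      using assms(25)[OF \<omega>] by (simp add: mrstp_approx_def dimL)
    have out_tensors: "map (Us i) [0..<l] \<in> tensors m\<^sub>1 m\<^sub>1 l" "map (Ss i) [0..<l] \<in> tensors (m\<^sub>1 * m\<^sub>2) (n\<^sub>1 * n\<^sub>2) l"
      "map (Vs i) [0..<l] \<in> tensors n\<^sub>1 n\<^sub>1 l" if "i < k" for i
      using mrstp_svd_slice_carrier[OF slice that] by (auto intro!: tensorsI)
    have T: "?T i \<in> tensors (m\<^sub>1 * m\<^sub>2) (n\<^sub>1 * n\<^sub>2) l"
      "j < l \<Longrightarrow> transform L (?T i) ! j = (Us i j \<otimes>\<^sub>K 1\<^sub>m m\<^sub>2) * Ss i j * ((Vs i j)\<^sup>T \<otimes>\<^sub>K 1\<^sub>m n\<^sub>2)"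
      if i: "i < k" for i j
    proof -
      note R = transform_stp_svd[OF inv_transform_carrier[OF out_tensors(1)[OF i]]
          inv_transform_carrier[OF out_tensors(2)[OF i]] inv_transform_carrier[OF out_tensors(3)[OF i]] assms(1-4),
          unfolded transform_inv_transform[OF out_tensors(1)[OF i]] transform_inv_transform[OF out_tensors(2)[OF i]]
            transform_inv_transform[OF out_tensors(3)[OF i]]]
      show "?T i \<in> tensors (m\<^sub>1 * m\<^sub>2) (n\<^sub>1 * n\<^sub>2) l"
        unfolding out[OF i] by (rule R(1))
      show "transform L (?T i) ! j = (Us i j \<otimes>\<^sub>K 1\<^sub>m m\<^sub>2) * Ss i j * ((Vs i j)\<^sup>T \<otimes>\<^sub>K 1\<^sub>m n\<^sub>2)"
        if "j < l"
        unfolding out[OF i] R(2)[OF that] using that by simp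
    qed
    have D: "?D \<in> tensors (m\<^sub>1 * m\<^sub>2) (n\<^sub>1 * n\<^sub>2) l"
      unfolding approx by (rule transform_minus_sum(1)[OF A]) (use T(1) in auto)
    have "fro (transform L ?D ! j) \<le> g j \<omega>" if j: "j < l" for j
    proof -
      have Gj: "transform L (\<G> \<omega>) ! j \<in> carrier_mat ?n (k + s)"
        by (rule tensorsD(2)[OF transform_carrier[OF G] j])
      have "transform L ?D ! j $$ (a, b) = transform L \<A> ! j $$ (a, b) -
          (\<Sum>i<k. ((Us i j \<otimes>\<^sub>K 1\<^sub>m m\<^sub>2) * Ss i j * ((Vs i j)\<^sup>T \<otimes>\<^sub>K 1\<^sub>m n\<^sub>2)) $$ (a, b))"
        if ab: "a < m\<^sub>1 * m\<^sub>2" "b < n\<^sub>1 * n\<^sub>2" for a b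
      proof -
        have "transform L ?D ! j $$ (a, b) = transform L \<A> ! j $$ (a, b) - (\<Sum>i<k. transform L (?T i) ! j $$ (a, b))"
          unfolding approx by (rule transform_minus_sum(2)[OF A _ j ab]) (use T(1) in auto)
        also have "(\<Sum>i<k. transform L (?T i) ! j $$ (a, b)) =
            (\<Sum>i<k. ((Us i j \<otimes>\<^sub>K 1\<^sub>m m\<^sub>2) * Ss i j * ((Vs i j)\<^sup>T \<otimes>\<^sub>K 1\<^sub>m n\<^sub>2)) $$ (a, b))"
          by (rule sum.cong[OF refl]) (simp only: T(2)[OF _ j] lessThan_iff)
        finally show ?thesis .
      qed
      moreover have "transform L (\<G> \<omega>) ! j = Matrix.mat ?n (k + s) (\<lambda>i. ?X j i \<omega>)"
        using Gj by (intro eq_matI) auto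
      then have "randomized_svd_error_le q k (?M j) (transform L (\<G> \<omega>) ! j) (g j \<omega>)"
        using g[OF j] by simp
      ultimately show ?thesis
        using ks by (intro mrstp_svd_slice_error[OF slice[OF j] tensorsD(2)[OF transform_carrier[OF A] j] Gj _ _
          tensorsD(2)[OF transform_carrier[OF D] j]]) auto
    qed
    then show ?thesis
      unfolding frobenius_norm_transform[OF D] using \<rho> by (intro divide_right_mono sum_mono) auto
  qed
  have "AE \<omega> in P. \<forall>j\<in>{..<l}. 0 \<le> g j \<omega> \<and> ?error_le j \<omega> (g j \<omega>)"
    using g_bound by (intro AE_finite_allI) auto
  then have "AE \<omega> in P. ennreal ((frobenius_norm (t_minus \<A> (\<A>' \<omega>)))\<^sup>2) \<le> (\<Sum>j<l. ennreal (1 / \<rho>) * ennreal (g j \<omega>))"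
    using AE_space
  proof eventually_elim
    fix \<omega> assume g: "\<forall>j\<in>{..<l}. 0 \<le> g j \<omega> \<and> ?error_le j \<omega> (g j \<omega>)"
      and \<omega>: "\<omega> \<in> space P"
    have "ennreal ((frobenius_norm (t_minus \<A> (\<A>' \<omega>)))\<^sup>2) \<le> ennreal ((\<Sum>j<l. g j \<omega>) / \<rho>)"
      using g by (intro ennreal_leI pointwise[OF \<omega>]) blast
    also have "\<dots> = ennreal (\<Sum>j<l. 1 / \<rho> * g j \<omega>)"
      by (simp add: sum_divide_distrib)
    also have "\<dots> = (\<Sum>j<l. ennreal (1 / \<rho> * g j \<omega>))"
      using g \<rho> by (intro sum_ennreal[symmetric]) auto
    also have "\<dots> = (\<Sum>j<l. ennreal (1 / \<rho>) * ennreal (g j \<omega>))"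
      using g \<rho> by (intro sum.cong refl ennreal_mult) auto
    finally show "ennreal ((frobenius_norm (t_minus \<A> (\<A>' \<omega>)))\<^sup>2) \<le> (\<Sum>j<l. ennreal (1 / \<rho>) * ennreal (g j \<omega>))" .
  qed
  \<comment> \<open>Monotonicity of \<open>nn_integral\<close> asks for no measurability, which the
    error on the left may lack. From here on every integrand is measurable.\<close>
  then have "(\<integral>\<^sup>+ \<omega>. ennreal ((frobenius_norm (t_minus \<A> (\<A>' \<omega>)))\<^sup>2) \<partial>P) \<le>
      (\<integral>\<^sup>+\<omega>. (\<Sum>j<l. ennreal (1 / \<rho>) * ennreal (g j \<omega>)) \<partial>P)"
    by (rule nn_integral_mono_AE)
  also have "\<dots> = (\<Sum>j<l. \<integral>\<^sup>+\<omega>. ennreal (1 / \<rho>) * ennreal (g j \<omega>) \<partial>P)"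
    using g_meas by (intro nn_integral_sum borel_measurable_times_ennreal borel_measurable_const measurable_compose[OF _ measurable_ennreal]) auto
  also have "\<dots> = (\<Sum>j<l. ennreal (1 / \<rho>) * (\<integral>\<^sup>+\<omega>. ennreal (g j \<omega>) \<partial>P))"
    using g_meas by (intro sum.cong refl nn_integral_cmult measurable_compose[OF _ measurable_ennreal]) auto
  also have "\<dots> \<le> (\<Sum>j<l. ennreal (1 / \<rho>) * ennreal (bound j))"
    by (intro sum_mono mult_left_mono g_int) auto
  also have "\<dots> = (\<Sum>j<l. ennreal (1 / \<rho> * bound j))"
    using \<rho> by (intro sum.cong refl ennreal_mult'[symmetric]) auto
  also have "\<dots> = ennreal (\<Sum>j<l. 1 / \<rho> * bound j)"
    using \<rho> bound_nonneg by (intro sum_ennreal) auto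
  \<comment> \<open>Up to this point the constant is 1 / \<rho>; the leading factor 2 of the claim
    is obtained by weakening.\<close>
  also have "\<dots> \<le> ennreal (2 / \<rho> * (\<Sum>j<l. bound j))"
    unfolding sum_distrib_left using \<rho> bound_nonneg
    by (intro ennreal_leI sum_mono mult_right_mono divide_right_mono) auto
  finally show ?thesis by (simp only: bound_def)
qed

end
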